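(* Let $A\in\Lambda(2)$, $K_1=\{B\in\Lambda(2):|A-B|=2\}$ ($4600$ points), $K_2=\{C\in\Lambda(2):|A-C|=\sqrt6\}$ ($47104$ points), $\overline K_2=\{A-C: C\in K_2\}$, and $\widetilde K_2=K_2\cup\overline K_2$. With $W=\mathrm{span}\{A\}$, let $\widehat K_1=N_W(K_1)$, $\widehat K_2=N_W(K_2)$, $\widehat{\widetilde K}_2=N_W(\widetilde K_2)$ (codes on $\mathbb S^{22}$; $|\widehat{\widetilde K}_2|=94208$). Then: (a) for every potential $h$ with $h^{(8)}(t)>0$ on $(-1,1)$, $m^h(\widehat K_2)=2816h(-\tfrac{\sqrt5}{5})+20736h(-\tfrac{\sqrt5}{15})+20736h(\tfrac{\sqrt5}{15})+2816h(\tfrac{\sqrt5}{5})$ and $m^h(\widehat{\widetilde K}_2)=5632h(-\tfrac{\sqrt5}{5})+41472h(-\tfrac{\sqrt5}{15})+41472h(\tfrac{\sqrt5}{15})+5632h(\tfrac{\sqrt5}{5})$, these minima being attained at the points of $\widehat K_1$; moreover $\widehat K_1$ attains its bound $m^h(\widehat K_1)=275h(-\tfrac{\sqrt5}5)+2025h(-\tfrac{\sqrt5}{15})+2025h(\tfrac{\sqrt5}{15})+275h(\tfrac{\sqrt5}5)$, and $m^h(\widehat K_1)/4600=m^h(\widehat{\widetilde K}_2)/94208=m^h(\widehat K_2)/47104$; (b) $(\widehat K_1,\widehat{\widetilde K}_2)$ is a universal polar dual pair: for every strictly absolutely monotone $h$ the set of minimizers on $\mathbb S^{22}$ of $U_h(\cdot,\widehat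 K_1)$ is exactly $\widehat{\widetilde K}_2$ and that of $U_h(\cdot,\widehat{\widetilde K}_2)$ is exactly $\widehat K_1$. (Thus $(\widehat K_1,\widehat{\widetilde K}_2)$ is a maximal PULB-optimal pair.)
   Context: $\Lambda_{24}$ is the Leech lattice normalized as the unique even unimodular lattice in $\mathbb R^{24}$ with no vectors of squared length $2$; $\Lambda(k)=\{x\in\Lambda_{24}:|x|^2=2k\}$. For a linear subspace $W\subset\mathbb R^{24}$ with orthogonal projection $P_W$ and $x\notin W$, $N_W(x)=(x-P_Wx)/|x-P_Wx|$, a point of the unit sphere of $W^\perp$, identified with $\mathbb S^{23-\dim W}$ by a linear isometry; $N_W(X)=\{N_W(x):x\in X\}$. A potential is $h:[-1,1]\to(-\infty,+\infty]$ continuous in the extended sense and finite on $[-1,1)$; $U_h(x,Z)=\sum_{y\in Z}h(x\cdot y)$, $m^h(Z)=\min_x U_h(x,Z)$ over the unit sphere. $h$ is strictly absolutely monotone if $h^{(j)}>0$ on $(-1,1)$ for all $j\ge0$. *)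

theory Defs
  imports "HOL-Analysis.Analysis"
begin

subsection \<open>The Leech lattice\<close>

definition lattice_generated_by :: "real^'n^'n \<Rightarrow> (real^'n) set" where
  "lattice_generated_by B = {\<Sum>i\<in>UNIV. of_int (z i) *\<^sub>R row i B | z :: 'n \<Rightarrow> int. True}"

text \<open>Integral of covolume one; \<open>\<bar>det B\<bar> = 1\<close> forces the rows of \<open>B\<close> to be a basis, so the
  lattice has full rank.\<close>

definition unimodular_lattice :: "(real^'n) set \<Rightarrow> bool" where
  "unimodular_lattice L \<longleftrightarrow>
     (\<exists>B. \<bar>det B\<bar> = 1 \<and> L = lattice_generated_by B) \<and> (\<forall>x\<in>L. \<forall>y\<in>L. x \<bullet> y \<in> \<int>)"

definition even_lattice :: "(real^'n) set \<Rightarrow> bool" where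
  "even_lattice L \<longleftrightarrow> (\<forall>x\<in>L. \<exists>k::int. x \<bullet> x = 2 * of_int k)"

text \<open>The characterisation determines the Leech lattice up to an isometry of the ambient space.\<close>

definition leech_lattice :: "(real^24) set \<Rightarrow> bool" where
  "leech_lattice L \<longleftrightarrow>
     unimodular_lattice L \<and> even_lattice L \<and> (\<forall>x\<in>L. (norm x)\<^sup>2 \<noteq> 2)"

definition shell :: "(real^'n) set \<Rightarrow> nat \<Rightarrow> (real^'n) set" where
  "shell L k = {x \<in> L. (norm x)\<^sup>2 = 2 * real k}"


subsection \<open>Projection to the sphere of an orthogonal complement\<close>

definition orth_proj :: "'a::euclidean_space set \<Rightarrow> 'a \<Rightarrow> 'a" where
  "orth_proj W x = (THE p. p \<in> W \<and> x - p \<in> W\<^sup>\<bottom>)"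

lemma orth_proj:
  assumes "subspace W"
  shows "orth_proj W x \<in> W" and "x - orth_proj W x \<in> W\<^sup>\<bottom>"
proof -
  obtain y z where yz: "y \<in> span W" "\<And>w. w \<in> span W \<Longrightarrow> orthogonal z w" "x = y + z"
    using orthogonal_subspace_decomp_exists by blast
  have y: "y \<in> W \<and> x - y \<in> W\<^sup>\<bottom>"
    using yz assms by (auto simp: orthogonal_comp_def orthogonal_commute span_eq_iff[THEN iffD2])
  have "p = y" if p: "p \<in> W \<and> x - p \<in> W\<^sup>\<bottom>" for p
  proof -
    have "p - y \<in> W" using p y assms by (simp add: subspace_diff)
    moreover have "(x - y) - (x - p) \<in> W\<^sup>\<bottom>"
      using p y subspace_orthogonal_comp subspace_diff by blast
    hence "p - y \<in> W\<^sup>\<bottom>" by simp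
    ultimately show ?thesis by (auto simp: orthogonal_comp_def orthogonal_def)
  qed
  with y have "\<exists>!p. p \<in> W \<and> x - p \<in> W\<^sup>\<bottom>" by blast
  from theI'[OF this] show "orth_proj W x \<in> W" and "x - orth_proj W x \<in> W\<^sup>\<bottom>"
    by (auto simp: orth_proj_def)
qed

definition proj_sphere :: "'a::euclidean_space set \<Rightarrow> 'a \<Rightarrow> 'a" where
  "proj_sphere W x = (x - orth_proj W x) /\<^sub>R norm (x - orth_proj W x)"

text \<open>\<open>\<phi>\<close> identifies the subspace \<open>V\<close> with the space \<open>'b\<close>. Every linear isometry of \<open>V\<close> onto
  \<open>'b\<close> extends linearly to all of \<open>'a\<close>, so linearity is imposed globally; only the
  values on \<open>V\<close> matter.\<close>

definition linear_isometry_onto ::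
    "('a::euclidean_space \<Rightarrow> 'b::euclidean_space) \<Rightarrow> 'a set \<Rightarrow> bool" where
  "linear_isometry_onto \<phi> V \<longleftrightarrow> linear \<phi> \<and> (\<forall>x\<in>V. norm (\<phi> x) = norm x) \<and> \<phi> ` V = UNIV"


subsection \<open>Potentials and polarization\<close>

text \<open>Only the values of \<open>h\<close> on \<open>[-1,1]\<close> are relevant; \<open>h 1 = \<infinity>\<close> is allowed.\<close>

definition potential :: "(real \<Rightarrow> ereal) \<Rightarrow> bool" where
  "potential h \<longleftrightarrow>
     continuous_on {-1..1} h \<and> (\<forall>t\<in>{-1..<1}. \<bar>h t\<bar> \<noteq> \<infinity>) \<and> h 1 \<noteq> -\<infinity>"

definition positive_derivative :: "nat \<Rightarrow> (real \<Rightarrow> ereal) \<Rightarrow> bool" where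
  "positive_derivative k h \<longleftrightarrow>
     (let f = (\<lambda>t. real_of_ereal (h t)) in
       (\<forall>j<k. \<forall>t\<in>{-1<..<1}. (deriv ^^ j) f differentiable (at t)) \<and>
       (\<forall>t\<in>{-1<..<1}. (deriv ^^ k) f t > 0))"

definition strictly_absolutely_monotone :: "(real \<Rightarrow> ereal) \<Rightarrow> bool" where
  "strictly_absolutely_monotone h \<longleftrightarrow> (\<forall>j. positive_derivative j h)"

definition U :: "(real \<Rightarrow> ereal) \<Rightarrow> 'a::euclidean_space \<Rightarrow> 'a set \<Rightarrow> ereal" where
  "U h x Z = (\<Sum>y\<in>Z. h (x \<bullet> y))"

text \<open>The infimum always exists in \<open>ereal\<close>; it is a minimum exactly when \<open>minimizers h Z\<close> is
  nonempty.\<close>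

definition polarization :: "(real \<Rightarrow> ereal) \<Rightarrow> 'a::euclidean_space set \<Rightarrow> ereal" where
  "polarization h Z = (INF x\<in>sphere 0 1. U h x Z)"

definition minimizers :: "(real \<Rightarrow> ereal) \<Rightarrow> 'a::euclidean_space set \<Rightarrow> 'a set" where
  "minimizers h Z = {x \<in> sphere 0 1. \<forall>y\<in>sphere 0 1. U h x Z \<le> U h y Z}"

definition universal_polar_dual_pair ::
    "'a::euclidean_space set \<Rightarrow> 'a set \<Rightarrow> bool" where
  "universal_polar_dual_pair C D \<longleftrightarrow>
     (\<forall>h. potential h \<and> strictly_absolutely_monotone h \<longrightarrow>
        minimizers h C = D \<and> minimizers h D = C)"

end

theory Submission
  imports Defs "HOL-Probability.Probability" "HOL-Complex_Analysis.Complex_Analysis"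
begin

text \<open>
  If \<open>p\<close> and \<open>r\<close> are orthogonal of equal length, then \<open>(p \<bullet> x + \<i> (r \<bullet> x))\<^sup>d\<close> is a harmonic polynomial in \<open>x\<close>,
  and the theta series of \<open>L\<close> with these coefficients is a modular form of weight \<open>12 + d\<close> for the full
  modular group. For \<open>0 < d \<le> 10\<close> its coefficients at 1 and \<open>q\<close> vanish, since \<open>L\<close> has no
  vectors of squared length 2, and for weights up to 22 this forces the coefficient at \<open>q\<^sup>2\<close> to vanish as well.
  So the minimal vectors form a spherical 11-design. Sorting them by their inner product with \<open>A\<close>
  yields linear equations that determine the power sums of each layer on the hyperplane orthogonal to \<open>A\<close>: the
  layers have the stated sizes and project to spherical 7-designs.

  The Hermite interpolant of degree 7 at the four nodes lies below the potential, and its sum over a 7-design is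
  the stated constant. Equality at a point \<open>y\<close> holds iff all inner products of \<open>y\<close> with the design are
  nodes. Then \<open>y\<close> lifts to a vector with integral inner products with the layer and hence, as differences of
  layer vectors show, with the layers 0 and 2. These detect membership in the dual of
  \<open>{x \<in> L. A \<bullet> x \<in> 2\<int>}\<close>, which is \<open>L \<union> (L + A/2)\<close> by unimodularity, so the lift belongs to the
  partner layer up to sign.
\<close>

subsection \<open>Poisson summation for one-dimensional Gaussians\<close>

text \<open>For isotropic w = p + i r the Gaussian recentered at -w has no constant term w . w, so
  Poisson summation for it is the generating function, over all degrees d, of the inversion formulas
  of the theta series. An orthogonal sublattice of finite index reduces it to dimension one: the sum
  over each coset becomes a product.

  Strength 7 of the layers costs strength 11 of the shell. For even j \<le> 6 the power sums of
  degree j over the layers 2, 1, 0 are three unknowns, separated by the weights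
  \<open>(A \<bullet> B) ^ l\<close> with l = 0, 2, 4; the largest total degree is 10. In degree 0
  the size of the shell is a fourth unknown, and l = 6 supplies a fourth equation.

  The hyperplane components of the layers 2 and 1 have squared lengths 3 and 15/4 and mutual inner
  products +-1/2, +-3/2; divided by the lengths these are the nodes. As the nodes are symmetric, the
  set of minimizers is antipodal. Layer 2 gives an antipodal code by itself, since B \<mapsto> A - B
  acts on it as negation; layer 1 must be joined with its negative, hence \<open>K2tilde\<close> in
  the dual pair.\<close>

lemma gaussian_fourier_transform:
  assumes "a > 0"
  shows "has_bochner_integral lborel
           (\<lambda>x. of_real (exp (- pi * a * x\<^sup>2)) * cis (- 2 * pi * \<xi> * x))
           (of_real (exp (- pi * \<xi>\<^sup>2 / a) / sqrt a))"
proof -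
  \<comment> \<open>The Gaussian is a rescaled standard normal density, whose characteristic
    function is known. The factor c matches the variances, and t is chosen such that t c = -2 pi
    \<xi>.\<close>
  define t where "t = - \<xi> * sqrt (2 * pi / a)"
  define c where "c = sqrt (2 * pi * a)"
  have c: "c > 0" using assms by (simp add: c_def)
  interpret N: prob_space std_normal_distribution
    using real_dist_normal_dist by (simp add: real_distribution_def)
  have int: "integrable std_normal_distribution (\<lambda>x. iexp (t * x))"
  proof (rule N.integrable_iexp)
    have "(\<lambda>x. complex_of_real (t * x)) \<in> borel_measurable borel" by measurable
    thus "(\<lambda>x. complex_of_real (t * x)) \<in> borel_measurable std_normal_distribution" by simp
  qed (rule Im_complex_of_real)
  have "has_bochner_integral std_normal_distribution (\<lambda>x. iexp (t * x)) (of_real (exp (- t\<^sup>2 / 2)))"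
    using int fun_cong[OF char_std_normal_distribution, of t] unfolding has_bochner_integral_iff char_def
    by (intro conjI)
  hence "has_bochner_integral lborel (\<lambda>x. std_normal_density x *\<^sub>R iexp (t * x)) (of_real (exp (- t\<^sup>2 / 2)))"
    unfolding has_bochner_integral_iff
    by (subst (asm) integrable_density, simp, simp, simp, subst (asm) integral_density) auto
  hence "has_bochner_integral lborel
     (\<lambda>x. std_normal_density (0 + c * x) *\<^sub>R iexp (t * (0 + c * x))) (of_real (exp (- t\<^sup>2 / 2)) /\<^sub>R \<bar>c\<bar>)"
    using c by (subst (asm) lborel_has_bochner_integral_real_affine_iff[of c _ _ 0]) auto
  hence *: "has_bochner_integral lborel
     (\<lambda>x. of_real (sqrt (2 * pi)) * (std_normal_density (0 + c * x) *\<^sub>R iexp (t * (0 + c * x))))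
      (of_real (sqrt (2 * pi)) * (of_real (exp (- t\<^sup>2 / 2)) /\<^sub>R \<bar>c\<bar>))"
    by (rule has_bochner_integral_mult_right)
  have tc: "t * (c * x) = - 2 * pi * \<xi> * x" for x
  proof -
    have "sqrt (2 * pi / a) * sqrt (2 * pi * a) = 2 * pi"
      using assms by (simp flip: real_sqrt_mult) (simp add: real_sqrt_mult)
    thus ?thesis unfolding t_def c_def by (simp add: algebra_simps)
  qed
  have cx: "- (c * x)\<^sup>2 / 2 = - pi * a * x\<^sup>2" for x
    using assms by (simp add: c_def power_mult_distrib)
  have tt: "- t\<^sup>2 / 2 = - pi * \<xi>\<^sup>2 / a"
    using assms by (simp add: t_def power_mult_distrib)
  have sq: "sqrt (2 * pi) / c = 1 / sqrt a"
    using assms by (simp add: c_def real_sqrt_mult)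
  have "of_real (sqrt (2 * pi)) * (std_normal_density (0 + c * x) *\<^sub>R iexp (t * (0 + c * x)))
      = of_real (exp (- pi * a * x\<^sup>2)) * cis (- 2 * pi * \<xi> * x)" for x
    by (simp only: std_normal_density_def add_0 tc cx) (simp add: scaleR_conv_of_real cis_conv_exp)
  moreover have "of_real (sqrt (2 * pi)) * (of_real (exp (- t\<^sup>2 / 2)) /\<^sub>R \<bar>c\<bar>) = complex_of_real (exp (- pi * \<xi>\<^sup>2 / a) / sqrt a)"
  proof -
    have "sqrt (2 * pi) * (exp (- t\<^sup>2 / 2) / c) = exp (- pi * \<xi>\<^sup>2 / a) / sqrt a"
      unfolding tt using sq c by (simp add: field_simps)
    hence "complex_of_real (sqrt (2 * pi) * (exp (- t\<^sup>2 / 2) / c)) = of_real (exp (- pi * \<xi>\<^sup>2 / a) / sqrt a)"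
      by (rule arg_cong)
    moreover have "of_real (sqrt (2 * pi)) * (of_real (exp (- t\<^sup>2 / 2)) /\<^sub>R \<bar>c\<bar>)
       = complex_of_real (sqrt (2 * pi) * (exp (- t\<^sup>2 / 2) / c))"
      using c by (simp only: scaleR_conv_of_real of_real_mult divide_inverse abs_of_pos mult.commute)
    ultimately show ?thesis by simp
  qed
  ultimately show ?thesis using * by (simp only:)
qed

text \<open>The kernel is a combination of the characters of frequency -1, 0, 1, so each further
  factor only shifts the frequency; the induction therefore needs all k at once.\<close>

lemma trig_polynomial_orthogonal:
  fixes D :: "real \<Rightarrow> complex"
  assumes cont: "continuous_on {0..1} D"
    and orth: "\<And>k::int. integral {0..1} (\<lambda>x. D x * cis (2 * pi * k * x)) = 0"
  shows "integral {0..1} (\<lambda>x. D x * of_real (((1 + cos (2 * pi * (x - y))) / 2) ^ n) * cis (2 * pi * of_int k * x)) = 0"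
proof (induction n arbitrary: k)
  case 0
  then show ?case using orth by simp
next
  case (Suc n)
  define K where "K x = complex_of_real (((1 + cos (2 * pi * (x - y))) / 2))" for x
  have K: "K x = 1/2 + cis (- 2 * pi * y) / 4 * cis (2 * pi * x) + cis (2 * pi * y) / 4 * cis (- 2 * pi * x)" for x
    unfolding K_def by (auto simp: complex_eq_iff cos_diff sin_diff right_diff_distrib field_simps)
  define I where "I k x = D x * of_real (((1 + cos (2 * pi * (x - y))) / 2) ^ n) * cis (2 * pi * of_int k * x)" for k x
  have I: "I k integrable_on {0..1}" for k
    unfolding I_def by (intro integrable_continuous_real continuous_intros cont) auto
  have e: "cis (2 * pi * x) * cis (2 * pi * of_int k * x) = cis (2 * pi * of_int (k+1) * x)"
       "cis (- 2 * pi * x) * cis (2 * pi * of_int k * x) = cis (2 * pi * of_int (k-1) * x)" for x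
    by (simp_all add: cis_mult algebra_simps)
  have "D x * of_real (((1 + cos (2 * pi * (x - y))) / 2) ^ Suc n) * cis (2 * pi * of_int k * x)
     = (1/2) * I k x + cis (- 2 * pi * y) / 4 * I (k+1) x + cis (2 * pi * y) / 4 * I (k-1) x" for x
    unfolding power_Suc of_real_mult K_def[symmetric] unfolding I_def e[symmetric] K by (simp add: algebra_simps)
  moreover have "((\<lambda>x. (1/2) * I k x + cis (- 2 * pi * y) / 4 * I (k+1) x + cis (2 * pi * y) / 4 * I (k-1) x)
      has_integral ((1/2) * integral {0..1} (I k) + cis (- 2 * pi * y) / 4 * integral {0..1} (I (k+1))
       + cis (2 * pi * y) / 4 * integral {0..1} (I (k-1)))) {0..1}"
    by (intro has_integral_add has_integral_mult_right integrable_integral I)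
  moreover have "integral {0..1} (I j) = 0" for j
    using Suc.IH[of j] by (simp add: I_def[abs_def])
  ultimately show ?case by (metis (no_types, lifting) add.right_neutral ext integral_unique mult_zero_right)
qed

text \<open>The kernels \<open>((1 + cos 2\<pi>(x - y)) / 2)\<^sup>n\<close> concentrate at \<open>y\<close>.\<close>

lemma fourier_uniqueness_open:
  fixes D :: "real \<Rightarrow> complex"
  assumes cont: "continuous_on {0..1} D"
    and orth: "\<And>k::int. integral {0..1} (\<lambda>x. D x * cis (2 * pi * k * x)) = 0"
    and y: "0 < y" "y < 1"
  shows "D y = 0"
proof (rule ccontr)
  assume nz: "D y \<noteq> 0"
  define \<epsilon> where "\<epsilon> = norm (D y) / 2"
  have \<epsilon>: "\<epsilon> > 0" using nz by (simp add: \<epsilon>_def)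
  obtain d where d: "d > 0" "\<And>x. x \<in> {0..1} \<Longrightarrow> dist x y < d \<Longrightarrow> dist (D x) (D y) < \<epsilon>"
    using cont y \<epsilon> unfolding continuous_on_iff by (metis atLeastAtMost_iff less_imp_le)
  \<comment> \<open>The bounds y and 1 - y keep the window around y inside [0, 1] and keep far
    points far modulo 1 as well; the bound 1/2 keeps \<open>2 * pi * \<delta>\<close> in the range
    where the cosine decreases.\<close>
  define \<delta> where "\<delta> = min (d/2) (min y (min (1 - y) (1/2)))"
  have \<delta>: "0 < \<delta>" "\<delta> < d" "\<delta> \<le> y" "\<delta> \<le> 1 - y" "\<delta> \<le> 1/2"
    using d(1) y unfolding \<delta>_def by linarith+
  define K where "K x = (1 + cos (2 * pi * (x - y))) / 2" for x
  have half: "0 \<le> (1 + c) / 2" "(1 + c) / 2 \<le> 1" if "- 1 \<le> c" "c \<le> 1" for c :: real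
    using that by simp_all
  have K01: "0 \<le> K x" "K x \<le> 1" for x
    unfolding K_def by (intro half cos_ge_minus_one cos_le_one)+
  have Kc: "continuous_on A K" for A unfolding K_def by (intro continuous_intros) auto
  define \<kappa> where "\<kappa> = (1 + cos (2 * pi * \<delta>)) / 2"
  define \<mu> where "\<mu> = (1 + cos (pi * \<delta>)) / 2"
  have cosabs: "cos (2 * pi * (x - y)) = cos (2 * pi * \<bar>x - y\<bar>)" for x
    using cos_abs_real[of "2 * pi * (x - y)"] by (simp add: abs_mult)
  have far: "K x \<le> \<kappa>" if "x \<in> {0..1}" "\<bar>x - y\<bar> \<ge> \<delta>" for x
  proof (cases "\<bar>x - y\<bar> \<le> 1/2")
    case True
    have "cos (2 * pi * \<bar>x - y\<bar>) \<le> cos (2 * pi * \<delta>)"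
      using that True \<delta> by (intro cos_monotone_0_pi_le) auto
    thus ?thesis unfolding K_def \<kappa>_def cosabs by simp
  next
    case False
    have "\<bar>x - y\<bar> \<le> 1 - \<delta>" using that \<delta> by auto
    have "cos (2 * pi * \<bar>x - y\<bar>) = cos (2 * pi * (1 - \<bar>x - y\<bar>))"
      by (simp add: right_diff_distrib cos_diff)
    also have "\<dots> \<le> cos (2 * pi * \<delta>)"
      using \<open>\<bar>x - y\<bar> \<le> 1 - \<delta>\<close> False \<delta> by (intro cos_monotone_0_pi_le) auto
    finally show ?thesis unfolding K_def \<kappa>_def cosabs by simp
  qed
  have near: "K x \<ge> \<mu>" if "\<bar>x - y\<bar> \<le> \<delta> / 2" for x
  proof -
    have "cos (pi * \<delta>) \<le> cos (2 * pi * \<bar>x - y\<bar>)"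
      using that \<delta> by (intro cos_monotone_0_pi_le) auto
    thus ?thesis unfolding K_def \<mu>_def cosabs by simp
  qed
  have "cos (2 * pi * \<delta>) < cos (pi * \<delta>)"
    using \<delta> by (intro cos_monotone_0_pi) auto
  hence \<kappa>\<mu>: "\<kappa> < \<mu>" "0 \<le> \<kappa>" unfolding \<kappa>_def \<mu>_def
    by (simp, intro half cos_ge_minus_one cos_le_one)
  obtain M where M: "\<And>x. x \<in> {0..1} \<Longrightarrow> norm (D x - D y) \<le> M" "M \<ge> 0"
  proof -
    have "continuous_on {0..1} (\<lambda>x. D x - D y)" by (intro continuous_intros cont)
    hence "bounded ((\<lambda>x. D x - D y) ` {0..1})"
      using compact_continuous_image compact_imp_bounded by blast
    then obtain B where "\<And>x. x \<in> {0..1} \<Longrightarrow> norm (D x - D y) \<le> B" unfolding bounded_iff by blast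
    thus ?thesis using that[of "max B 0"] by (meson max.cobounded2 max.coboundedI1)
  qed
  \<comment> \<open>Since D integrates to 0 against the kernel, |D y| times the mass of the kernel
    is at most \<epsilon> times that mass plus the far part \<open>M * \<kappa> ^ n\<close>. As
    \<epsilon> is half of |D y|, the first part is absorbed, and the mass is at least
    \<open>\<delta> * \<mu> ^ n\<close>. Letting n grow contradicts \<kappa> < \<mu>.\<close>
  have main: "\<epsilon> * \<delta> * \<mu> ^ n \<le> M * \<kappa> ^ n" for n
  proof -
    let ?K = "\<lambda>x. K x ^ n"
    have Kn: "continuous_on A ?K" for A by (intro continuous_intros Kc)
    have iK: "?K integrable_on {a..b}" for a b by (intro integrable_continuous_real Kn)
    have z: "integral {0..1} (\<lambda>x. D x * of_real (?K x)) = 0"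
      using trig_polynomial_orthogonal[OF cont orth, of y n 0] by (simp add: K_def)
    have iC: "(\<lambda>x. complex_of_real (?K x)) integrable_on {0..1}"
      by (intro integrable_continuous_real continuous_intros Kn)
    have "integral {0..1} (\<lambda>x. (D y - D x) * of_real (?K x)) = 
       integral {0..1} (\<lambda>x. D y * of_real (?K x)) - integral {0..1} (\<lambda>x. D x * of_real (?K x))"
      unfolding left_diff_distrib
      by (intro Henstock_Kurzweil_Integration.integral_diff integrable_continuous_real continuous_intros cont Kn)
    also have "\<dots> = D y * integral {0..1} (\<lambda>x. of_real (?K x))" using z by simp
    also have "integral {0..1} (\<lambda>x. complex_of_real (?K x)) = of_real (integral {0..1} ?K)"
      using has_integral_of_real[OF integrable_integral[OF iK]] by (rule integral_unique)
    finally have e1: "D y * of_real (integral {0..1} ?K) = integral {0..1} (\<lambda>x. (D y - D x) * of_real (?K x))" by simp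
    have "norm (integral {0..1} (\<lambda>x. (D y - D x) * of_real (?K x))) \<le> integral {0..1} (\<lambda>x. \<epsilon> * ?K x + M * \<kappa> ^ n)"
    proof (rule integral_norm_bound_integral)
      show "(\<lambda>x. (D y - D x) * complex_of_real (K x ^ n)) integrable_on {0..1}"
        by (intro integrable_continuous_real continuous_intros cont Kn)
      show "(\<lambda>x. \<epsilon> * K x ^ n + M * \<kappa> ^ n) integrable_on {0..1}"
        by (intro integrable_continuous_real continuous_intros Kn)
      fix x :: real assume x: "x \<in> {0..1}"
      have nn: "norm ((D y - D x) * of_real (?K x)) = norm (D x - D y) * ?K x"
        using K01 by (simp add: norm_mult norm_minus_commute norm_power)
      show "norm ((D y - D x) * of_real (?K x)) \<le> \<epsilon> * ?K x + M * \<kappa> ^ n"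
      proof (cases "\<bar>x - y\<bar> < \<delta>")
        case True
        have "norm (D x - D y) \<le> \<epsilon>" using d(2)[OF x] True \<delta> by (auto simp: dist_norm dist_real_def less_imp_le)
        hence "norm (D x - D y) * ?K x \<le> \<epsilon> * ?K x" using K01 by (intro mult_right_mono) auto
        moreover have "0 \<le> M * \<kappa> ^ n" using M \<kappa>\<mu> by simp
        ultimately show ?thesis unfolding nn by simp
      next
        case False
        have "?K x \<le> \<kappa> ^ n" using far[OF x] False K01 by (intro power_mono) auto
        hence "norm (D x - D y) * ?K x \<le> M * \<kappa> ^ n" using M x K01 \<kappa>\<mu> by (intro mult_mono) auto
        moreover have "0 \<le> \<epsilon> * ?K x" using \<epsilon> K01 by simp
        ultimately show ?thesis unfolding nn by linarith
      qed
    qed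
    also have "\<dots> = \<epsilon> * integral {0..1} ?K + M * \<kappa> ^ n"
      by (subst Henstock_Kurzweil_Integration.integral_add) (auto intro!: integrable_on_cmult_left iK integrable_continuous_real continuous_intros Kn)
    finally have e2: "norm (D y) * integral {0..1} ?K \<le> \<epsilon> * integral {0..1} ?K + M * \<kappa> ^ n"
      unfolding e1[symmetric] using Henstock_Kurzweil_Integration.integral_nonneg[OF iK] K01
      by (simp add: norm_mult)
    have "integral {y - \<delta>/2..y + \<delta>/2} (\<lambda>x. \<mu> ^ n) \<le> integral {y - \<delta>/2..y + \<delta>/2} ?K"
      using \<kappa>\<mu> by (intro integral_le iK power_mono near) (auto simp: abs_le_iff abs_real_def)
    also have "\<dots> \<le> integral {0..1} ?K"
      using \<delta> K01 by (intro integral_subset_le iK) auto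
    finally have "\<delta> * \<mu> ^ n \<le> integral {0..1} ?K" using \<delta> by simp
    hence "\<epsilon> * (\<delta> * \<mu> ^ n) \<le> \<epsilon> * integral {0..1} ?K" using \<epsilon> by (intro mult_left_mono) auto
    also have "\<dots> = norm (D y) * integral {0..1} ?K - \<epsilon> * integral {0..1} ?K"
      by (simp add: \<epsilon>_def)
    finally show ?thesis using e2 by (simp add: mult.assoc)
  qed
  have \<mu>0: "\<mu> > 0" using \<kappa>\<mu> by linarith
  have "(\<lambda>n. M * (\<kappa> / \<mu>) ^ n) \<longlonglongrightarrow> M * 0"
    using \<kappa>\<mu> \<mu>0 by (intro tendsto_intros LIMSEQ_power_zero) auto
  moreover have "\<epsilon> * \<delta> \<le> M * (\<kappa> / \<mu>) ^ n" for n
    using main[of n] \<mu>0 by (simp add: power_divide field_simps)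
  ultimately have "\<epsilon> * \<delta> \<le> M * 0" by (intro LIMSEQ_le_const) auto
  thus False using mult_pos_pos[OF \<epsilon> \<delta>(1)] by simp
qed

lemma fourier_uniqueness:
  fixes D :: "real \<Rightarrow> complex"
  assumes cont: "continuous_on {0..1} D"
    and orth: "\<And>k::int. integral {0..1} (\<lambda>x. D x * cis (2 * pi * k * x)) = 0"
    and y: "y \<in> {0..1}"
  shows "D y = 0"
proof -
  have "closure {0<..<1::real} = {0..1}" by simp
  moreover have "D x = 0" if "x \<in> {0<..<1}" for x
    using fourier_uniqueness_open[OF cont orth] that by auto
  ultimately show ?thesis
    using continuous_constant_on_closure[of "{0<..<1}" D 0 y] cont y by auto
qed

section \<open>Termwise integration and periodization\<close>

lemma has_integral_infsum_uniform:
  fixes f :: "'i \<Rightarrow> real \<Rightarrow> 'b::banach"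
  assumes cont: "\<And>n. continuous_on {a..b} (f n)"
    and bound: "\<And>n x. x \<in> {a..b} \<Longrightarrow> norm (f n x) \<le> M n" and M: "M summable_on UNIV"
  shows "continuous_on {a..b} (\<lambda>x. \<Sum>\<^sub>\<infinity>n. f n x)"
    and "((\<lambda>n. integral {a..b} (f n)) has_sum integral {a..b} (\<lambda>x. \<Sum>\<^sub>\<infinity>n. f n x)) UNIV"
proof -
  have unif: "uniform_limit {a..b} (\<lambda>X x. \<Sum>n\<in>X. f n x) (\<lambda>x. \<Sum>\<^sub>\<infinity>n. f n x) (finite_subsets_at_top UNIV)"
    by (rule Weierstrass_m_test_general[OF bound M])
  have cs: "continuous_on {a..b} (\<lambda>x. \<Sum>n\<in>X. f n x)" for X
    by (intro continuous_intros cont)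
  show "continuous_on {a..b} (\<lambda>x. \<Sum>\<^sub>\<infinity>n. f n x)"
    by (rule uniform_limit_theorem[OF _ unif]) (auto intro: cs)
  obtain I J where IJ: "\<And>X. ((\<lambda>x. \<Sum>n\<in>X. f n x) has_integral I X) {a..b}"
      "((\<lambda>x. \<Sum>\<^sub>\<infinity>n. f n x) has_integral J) {a..b}" "(I \<longlongrightarrow> J) (finite_subsets_at_top UNIV)"
    by (rule uniform_limit_integral[OF unif cs]) auto
  have I: "I X = (\<Sum>n\<in>X. integral {a..b} (f n))" if "finite X" for X
    using integral_unique[OF IJ(1)[of X]] Henstock_Kurzweil_Integration.integral_sum[OF that, of f "{a..b}"]
      integrable_continuous_real[OF cont] by metis
  have "\<forall>\<^sub>F X in finite_subsets_at_top UNIV. I X = (\<Sum>n\<in>X. integral {a..b} (f n))"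
    by (rule eventually_finite_subsets_at_top_weakI) (use I in auto)
  hence "((\<lambda>X. \<Sum>n\<in>X. integral {a..b} (f n)) \<longlongrightarrow> J) (finite_subsets_at_top UNIV)"
    using IJ(3) tendsto_cong by blast
  thus "((\<lambda>n. integral {a..b} (f n)) has_sum integral {a..b} (\<lambda>x. \<Sum>\<^sub>\<infinity>n. f n x)) UNIV"
    using integral_unique[OF IJ(2)] by (simp add: has_sum_def)
qed

lemma summable_on_int_reflect:
  fixes f :: "int \<Rightarrow> real"
  assumes "(\<lambda>n::nat. f (int n)) summable_on UNIV" "(\<lambda>n::nat. f (- int n)) summable_on UNIV"
  shows "f summable_on UNIV"
proof -
  have "f summable_on (range int)" "f summable_on (range (\<lambda>n. - int n))"
    using assms by (auto simp: summable_on_reindex inj_on_def o_def)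
  hence "f summable_on (range int \<union> range (\<lambda>n. - int n))" by (rule summable_on_union)
  moreover have "range int \<union> range (\<lambda>n. - int n) = UNIV"
    by (auto simp: image_def) (metis int_cases2)
  ultimately show ?thesis by simp
qed

lemma summable_gaussian_int:
  fixes c d :: real
  assumes "c > 0"
  shows "(\<lambda>n::int. exp (- c * (of_int n)\<^sup>2 + d * \<bar>of_int n\<bar>)) summable_on UNIV"
proof -
  \<comment> \<open>C is the maximum of -c x^2 + (d + 1) x, found by completing the square; the
    exponent is then at most C - x, and a geometric series dominates.\<close>
  define C where "C = (d + 1)\<^sup>2 / (4 * c)"
  have le: "- c * x\<^sup>2 + d * x \<le> C - x" for x
  proof -
    have "0 \<le> c * (x - (d + 1) / (2 * c))\<^sup>2" using assms by simp
    also have "\<dots> = c * x\<^sup>2 - (d + 1) * x + C"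
      using assms by (simp add: C_def power2_eq_square field_simps)
    finally show ?thesis by (simp add: algebra_simps)
  qed
  have "summable (\<lambda>n. exp C * exp (-1 :: real) ^ n)"
    by (intro summable_mult summable_geometric) auto
  hence "summable (\<lambda>n::nat. norm (exp (- c * (of_nat n)\<^sup>2 + d * of_nat n)))"
  proof (rule summable_comparison_test')
    fix n :: nat
    have "exp (- c * (of_nat n)\<^sup>2 + d * of_nat n) \<le> exp (C - of_nat n)" using le by simp
    also have "\<dots> = exp C * exp (- 1) ^ n" by (simp add: exp_diff exp_minus exp_of_nat_mult[symmetric] power_inverse divide_inverse)
    finally show "norm (norm (exp (- c * (of_nat n)\<^sup>2 + d * of_nat n))) \<le> exp C * exp (- 1) ^ n" by simp
  qed
  hence "(\<lambda>n::nat. exp (- c * (of_nat n)\<^sup>2 + d * of_nat n)) summable_on UNIV"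
    by (rule norm_summable_imp_summable_on)
  thus ?thesis by (intro summable_on_int_reflect) auto
qed

text \<open>Unfolding: the integral of a periodization over the unit interval is the integral over
  the line. The unordered sum over the integers is evaluated along the windows from -N to N - 1,
  which exhaust all finite sets; the corresponding integrals converge to I by dominated
  convergence.\<close>

lemma has_integral_periodization:
  fixes \<psi> :: "real \<Rightarrow> complex"
  assumes cont: "continuous_on UNIV \<psi>" and int: "has_bochner_integral lborel \<psi> I"
    and bound: "\<And>n x. x \<in> {0..1} \<Longrightarrow> norm (\<psi> (of_int n + x)) \<le> M n" and M: "M summable_on (UNIV :: int set)"
  shows "continuous_on {0..1} (\<lambda>x. \<Sum>\<^sub>\<infinity>n::int. \<psi> (of_int n + x))"
    and "integral {0..1} (\<lambda>x. \<Sum>\<^sub>\<infinity>n::int. \<psi> (of_int n + x)) = I"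
proof -
  have c: "continuous_on A (\<lambda>x. \<psi> (of_int n + x))" for n :: int and A
    by (intro continuous_on_compose2[OF cont] continuous_intros) auto
  note * = has_integral_infsum_uniform[where a = 0 and b = 1, OF c bound M]
  show "continuous_on {0..1} (\<lambda>x. \<Sum>\<^sub>\<infinity>n::int. \<psi> (of_int n + x))" by (rule *(1))
  let ?J = "integral {0..1} (\<lambda>x. \<Sum>\<^sub>\<infinity>n::int. \<psi> (of_int n + x))"
  have shift: "integral {0..1} (\<lambda>x. \<psi> (of_int n + x)) = integral {of_int n..of_int n + 1} \<psi>" for n :: int
    using integral_shift_Icc_real[of 0 1 \<psi> "of_int n"] by (simp add: o_def add.commute)
  have fin: "(\<Sum>n\<in>{- int N..<int N}. integral {0..1} (\<lambda>x. \<psi> (of_int n + x))) = integral {- real N..real N} \<psi>" for N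
  proof (induction N)
    case 0 then show ?case by simp
  next
    case (Suc N)
    have i: "\<psi> integrable_on {x..y}" for x y
      by (intro integrable_continuous_real continuous_on_subset[OF cont]) auto
    have "{- int (Suc N)..<int (Suc N)} = insert (- int (Suc N)) (insert (int N) {- int N..<int N})" by auto
    hence "(\<Sum>n\<in>{- int (Suc N)..<int (Suc N)}. integral {0..1} (\<lambda>x. \<psi> (of_int n + x)))
       = integral {- real (Suc N)..- real N} \<psi> + (integral {real N..real (Suc N)} \<psi> + integral {- real N..real N} \<psi>)"
      using Suc.IH shift[of "- int (Suc N)"] shift[of "int N"] by (simp add: add.commute)
    also have "integral {real N..real (Suc N)} \<psi> + integral {- real N..real N} \<psi> = integral {- real N..real (Suc N)} \<psi>"
      using Henstock_Kurzweil_Integration.integral_combine[of "- real N" "real N" "real (Suc N)" \<psi>] i by (simp add: add.commute)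
    also have "integral {- real (Suc N)..- real N} \<psi> + integral {- real N..real (Suc N)} \<psi> = integral {- real (Suc N)..real (Suc N)} \<psi>"
      using Henstock_Kurzweil_Integration.integral_combine[of "- real (Suc N)" "- real N" "real (Suc N)" \<psi>] i by simp
    finally show ?case .
  qed
  have "filterlim (\<lambda>N. {- int N..<int N}) (finite_subsets_at_top UNIV) sequentially"
    unfolding filterlim_finite_subsets_at_top
  proof (intro allI impI)
    fix X :: "int set" assume X: "finite X \<and> X \<subseteq> UNIV"
    obtain N where N: "\<And>x. x \<in> X \<Longrightarrow> nat \<bar>x\<bar> < N"
      using X finite_nat_set_iff_bounded[of "(\<lambda>x. nat \<bar>x\<bar>) ` X"] by auto
    have "X \<subseteq> {- int n..<int n}" if "n \<ge> N" for n
    proof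
      fix x assume "x \<in> X"
      from N[OF this] that show "x \<in> {- int n..<int n}" by auto
    qed
    thus "\<forall>\<^sub>F n in sequentially. finite {- int n..<int n} \<and> X \<subseteq> {- int n..<int n} \<and> {- int n..<int n} \<subseteq> UNIV"
      using eventually_sequentially by auto
  qed
  from filterlim_compose[OF *(2)[unfolded has_sum_def] this]
  have lim1: "(\<lambda>N. integral {- real N..real N} \<psi>) \<longlonglongrightarrow> ?J" by (simp add: fin)
  have meas: "\<psi> \<in> borel_measurable lborel" using cont by (simp add: borel_measurable_continuous_onI)
  have iN: "set_integrable lborel {- real N..real N} \<psi>" for N
    by (intro borel_integrable_atLeastAtMost' continuous_on_subset[OF cont]) auto
  have "(\<lambda>N. LINT x|lborel. indicat_real {- real N..real N} x *\<^sub>R \<psi> x) \<longlonglongrightarrow> (LINT x|lborel. \<psi> x)"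
  proof (rule integral_dominated_convergence[where w = "\<lambda>x. norm (\<psi> x)"])
    show "integrable lborel (\<lambda>x. norm (\<psi> x))" using int by (auto simp: has_bochner_integral_iff)
    show "AE x in lborel. (\<lambda>N. indicat_real {- real N..real N} x *\<^sub>R \<psi> x) \<longlonglongrightarrow> \<psi> x"
    proof (intro AE_I2 tendsto_eventually)
      fix x :: real
      obtain N where "\<bar>x\<bar> \<le> real N" using real_arch_simple by blast
      hence "indicat_real {- real n..real n} x *\<^sub>R \<psi> x = \<psi> x" if "n \<ge> N" for n using that by (auto simp: indicator_def)
      thus "\<forall>\<^sub>F n in sequentially. indicat_real {- real n..real n} x *\<^sub>R \<psi> x = \<psi> x"
        using eventually_sequentially by blast
    qed
  qed (use meas in \<open>auto simp: indicator_def\<close>)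
  hence "(\<lambda>N. integral {- real N..real N} \<psi>) \<longlonglongrightarrow> I"
    using set_borel_integral_eq_integral(2)[OF iN] int
    by (simp add: set_lebesgue_integral_def has_bochner_integral_iff)
  with lim1 show "?J = I" by (rule LIMSEQ_unique)
qed

lemma integral_cis:
  "integral {0..1} (\<lambda>x. cis (2 * pi * of_int m * x)) = (if m = 0 then 1 else 0)"
proof (cases "m = 0")
  case False
  define F where "F x = cis (2 * pi * of_int m * x) / (2 * pi * of_int m * \<i>)" for x :: real
  have "((\<lambda>x. cis (2 * pi * of_int m * x)) has_integral (F 1 - F 0)) {0..1}"
    unfolding F_def
    by (rule fundamental_theorem_of_calculus)
       (use False in \<open>auto simp: has_vector_derivative_def scaleR_conv_of_real field_simps intro!: derivative_eq_intros\<close>)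
  moreover have "F 1 = F 0" by (simp add: F_def cis_multiple_2pi)
  ultimately show ?thesis using False by (simp add: integral_unique)
qed simp

lemma cis_int_period: "cis (2 * pi * of_int k * (of_int n + x)) = cis (2 * pi * of_int k * x)"
proof -
  have "cis (2 * pi * of_int k * (of_int n + x)) = cis (2 * pi * of_int (k * n)) * cis (2 * pi * of_int k * x)"
    by (simp add: cis_mult algebra_simps)
  also have "cis (2 * pi * of_int (k * n)) = 1" by (rule cis_multiple_2pi) auto
  finally show ?thesis by simp
qed

lemma summable_shifted_gaussian_int:
  fixes c x :: real
  assumes "c > 0"
  shows "(\<lambda>n::int. exp (- c * (of_int n + x)\<^sup>2)) summable_on UNIV"
proof (rule summable_on_comparison_test)
  show "(\<lambda>n::int. exp (- c * (of_int n)\<^sup>2 + (2 * c * \<bar>x\<bar>) * \<bar>of_int n\<bar>)) summable_on UNIV"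
    by (rule summable_gaussian_int[OF assms])
  fix n :: int
  have "\<bar>c * x * of_int n\<bar> = c * \<bar>x\<bar> * \<bar>of_int n\<bar>" using assms by (simp add: abs_mult)
  hence "- 2 * (c * x * of_int n) \<le> 2 * (c * \<bar>x\<bar> * \<bar>of_int n\<bar>)" by linarith
  moreover have "0 \<le> c * x\<^sup>2" using assms by simp
  ultimately have "- c * (of_int n + x)\<^sup>2 \<le> - c * (of_int n)\<^sup>2 + (2 * c * \<bar>x\<bar>) * \<bar>of_int n\<bar>"
    by (simp add: power2_eq_square algebra_simps)
  thus "exp (- c * (of_int n + x)\<^sup>2) \<le> exp (- c * (of_int n)\<^sup>2 + (2 * c * \<bar>x\<bar>) * \<bar>of_int n\<bar>)" by simp
qed auto

text \<open>Both sides are continuous and 1-periodic in x and have the same Fourier coefficients.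
  The shift x and the frequency b are both kept, because a complex shift will later supply its real
  part to x and its imaginary part to b.\<close>

theorem poisson_gaussian:
  fixes a b x :: real
  assumes a: "a > 0"
  shows "(\<Sum>\<^sub>\<infinity>n::int. of_real (exp (- pi * a * (of_int n + x)\<^sup>2)) * cis (- 2 * pi * b * (of_int n + x)))
       = (\<Sum>\<^sub>\<infinity>k::int. of_real (exp (- pi * (of_int k + b)\<^sup>2 / a) / sqrt a) * cis (2 * pi * of_int k * x))"
proof -
  define \<phi> where "\<phi> u = of_real (exp (- pi * a * u\<^sup>2)) * cis (- 2 * pi * b * u)" for u
  define c where "c k = complex_of_real (exp (- pi * (of_int k + b)\<^sup>2 / a) / sqrt a)" for k :: int
  define H where "H x = (\<Sum>\<^sub>\<infinity>n::int. \<phi> (of_int n + x))" for x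
  define G where "G x = (\<Sum>\<^sub>\<infinity>k::int. c k * cis (2 * pi * of_int k * x))" for x
  define M where "M n = exp (- (pi * a) * (of_int n)\<^sup>2 + (2 * pi * a) * \<bar>of_int n\<bar>)" for n :: int
  have M: "M summable_on UNIV" unfolding M_def by (intro summable_gaussian_int) (use a in auto)
  have leM: "exp (- pi * a * (of_int n + x)\<^sup>2) \<le> M n" if "x \<in> {0..1}" for n :: int and x
  proof -
    have "(of_int n :: real)\<^sup>2 \<le> (of_int n + x)\<^sup>2 + 2 * \<bar>of_int n\<bar>"
    proof -
      have "\<bar>of_int n * x\<bar> \<le> \<bar>of_int n\<bar>" using that by (simp add: abs_mult mult_left_le)
      hence "- (of_int n * x) \<le> \<bar>of_int n\<bar>" by linarith
      thus ?thesis by (simp add: power2_eq_square algebra_simps)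
    qed
    hence "(pi * a) * (of_int n :: real)\<^sup>2 \<le> (pi * a) * ((of_int n + x)\<^sup>2 + 2 * \<bar>of_int n\<bar>)"
      using a by (intro mult_left_mono) auto
    thus ?thesis unfolding M_def by (simp add: algebra_simps)
  qed
  have cM: "(\<lambda>k. norm (c k)) summable_on UNIV"
  proof -
    have "(\<lambda>k::int. exp (- (pi / a) * (of_int k + b)\<^sup>2) * (1 / sqrt a)) summable_on UNIV"
      by (intro summable_on_cmult_left summable_shifted_gaussian_int) (use a in auto)
    moreover have "norm (c k) = exp (- (pi / a) * (of_int k + b)\<^sup>2) * (1 / sqrt a)" for k
      using a by (simp add: c_def norm_divide del: of_real_divide)
    ultimately show ?thesis by simp
  qed
  have Hc: "continuous_on {0..1} (\<lambda>x. H x * cis (2 * pi * of_int j * x))"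
    and Hi: "integral {0..1} (\<lambda>x. H x * cis (2 * pi * of_int j * x)) = c (- j)" for j
  proof -
    \<comment> \<open>The character of frequency j has period 1, so it can be moved into each term
      of the periodization, where it changes the frequency b to b - j.\<close>
    define \<psi> where "\<psi> u = of_real (exp (- pi * a * u\<^sup>2)) * cis (- 2 * pi * (of_int (- j) + b) * u)" for u
    have \<psi>: "\<phi> (of_int n + x) * cis (2 * pi * of_int j * x) = \<psi> (of_int n + x)" for n :: int and x
      unfolding cis_int_period[of j n x, symmetric] \<phi>_def \<psi>_def by (simp add: mult.assoc cis_mult) (simp add: algebra_simps)
    have H: "H x * cis (2 * pi * of_int j * x) = (\<Sum>\<^sub>\<infinity>n::int. \<psi> (of_int n + x))" for x
      unfolding H_def \<psi>[symmetric] by (rule infsum_cmult_left'[symmetric])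
    have "continuous_on UNIV \<psi>" unfolding \<psi>_def by (intro continuous_intros) 
    moreover have "has_bochner_integral lborel \<psi> (c (- j))"
      unfolding \<psi>_def c_def by (rule gaussian_fourier_transform[OF a])
    moreover have "norm (\<psi> (of_int n + x)) \<le> M n" if "x \<in> {0..1}" for n x
      using leM[OF that] by (simp add: \<psi>_def norm_mult)
    ultimately show "continuous_on {0..1} (\<lambda>x. H x * cis (2 * pi * of_int j * x))"
      "integral {0..1} (\<lambda>x. H x * cis (2 * pi * of_int j * x)) = c (- j)"
      unfolding H using has_integral_periodization[OF _ _ _ M] by blast+
  qed
  have Gc: "continuous_on {0..1} (\<lambda>x. G x * cis (2 * pi * of_int j * x))"
    and Gi: "integral {0..1} (\<lambda>x. G x * cis (2 * pi * of_int j * x)) = c (- j)" for j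
  proof -
    have G: "G x * cis (2 * pi * of_int j * x) = (\<Sum>\<^sub>\<infinity>k::int. c k * cis (2 * pi * of_int (k + j) * x))" for x
      unfolding G_def by (subst infsum_cmult_left'[symmetric]) (simp add: mult.assoc cis_mult algebra_simps)
    note * = has_integral_infsum_uniform[of 0 1 "\<lambda>k x. c k * cis (2 * pi * of_int (k + j) * x)" "\<lambda>k. norm (c k)"]
    have cont: "continuous_on {0..1} (\<lambda>x. c k * cis (2 * pi * of_int (k + j) * x))" for k by (intro continuous_intros)
    have bd: "norm (c k * cis (2 * pi * of_int (k + j) * x)) \<le> norm (c k)" for k x by (simp add: norm_mult)
    show "continuous_on {0..1} (\<lambda>x. G x * cis (2 * pi * of_int j * x))"
      unfolding G by (rule *(1)[OF cont bd cM])
    have "((\<lambda>k. integral {0..1} (\<lambda>x. c k * cis (2 * pi * of_int (k + j) * x))) has_sum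
        integral {0..1} (\<lambda>x. G x * cis (2 * pi * of_int j * x))) UNIV"
      unfolding G by (rule *(2)[OF cont bd cM])
    moreover have "integral {0..1} (\<lambda>x. c k * cis (2 * pi * of_int (k + j) * x)) = (if k = - j then c k else 0)" for k
      using integral_cis[of "k + j"] by (simp add: eq_neg_iff_add_eq_0)
    ultimately have "((\<lambda>k. if k = - j then c k else 0) has_sum
        integral {0..1} (\<lambda>x. G x * cis (2 * pi * of_int j * x))) UNIV" by simp
    moreover have "((\<lambda>k. if k = - j then c k else 0) has_sum c (- j)) UNIV"
      by (rule has_sum_finite_neutralI[of "{- j}"]) auto
    ultimately show "integral {0..1} (\<lambda>x. G x * cis (2 * pi * of_int j * x)) = c (- j)"
      by (rule has_sum_unique)
  qed
  have eq01: "H y = G y" if "y \<in> {0..1}" for y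
  proof -
    have "H y - G y = 0"
    proof (rule fourier_uniqueness[of "\<lambda>x. H x - G x", OF _ _ that])
      show "continuous_on {0..1} (\<lambda>x. H x - G x)"
        using Hc[of 0] Gc[of 0] by (intro continuous_intros) auto
      fix k :: int
      have "integral {0..1} (\<lambda>x. (H x - G x) * cis (2 * pi * of_int k * x))
         = integral {0..1} (\<lambda>x. H x * cis (2 * pi * of_int k * x)) - integral {0..1} (\<lambda>x. G x * cis (2 * pi * of_int k * x))"
        unfolding left_diff_distrib
        by (rule Henstock_Kurzweil_Integration.integral_diff; rule integrable_continuous_real) (rule Hc, rule Gc)
      also have "\<dots> = c (- k) - c (- k)" by (simp only: Hi Gi)
      finally have "integral {0..1} (\<lambda>x. (H x - G x) * cis (2 * pi * of_int k * x)) = c (- k) - c (- k)" .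
      thus "integral {0..1} (\<lambda>x. (H x - G x) * cis (2 * pi * of_int k * x)) = 0" by simp
    qed
    thus ?thesis by simp
  qed
  have per: "H (of_int n + y) = H y" "G (of_int n + y) = G y" for n y
  proof -
    have "H (of_int n + y) = (\<Sum>\<^sub>\<infinity>m::int. \<phi> (of_int (m + n) + y))" by (simp add: H_def algebra_simps)
    also have "\<dots> = H y" unfolding H_def
      by (rule infsum_reindex_bij_betw[of "\<lambda>m. m + n" UNIV UNIV "\<lambda>m. \<phi> (of_int m + y)"]) (auto simp: bij_betw_def inj_on_def intro: surjI[of _ "\<lambda>m. m - n"])
    finally show "H (of_int n + y) = H y" .
    show "G (of_int n + y) = G y" unfolding G_def cis_int_period ..
  qed
  have "of_int \<lfloor>x\<rfloor> + frac x = x" by (simp add: frac_def)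
  hence "H x = G x"
    using per[of "\<lfloor>x\<rfloor>" "frac x"] eq01[of "frac x"] frac_lt_1[of x] frac_ge_0[of x] by (simp add: less_imp_le)
  thus ?thesis by (simp add: H_def G_def \<phi>_def c_def)
qed

subsection \<open>Unimodular lattices\<close>

lemma lattice_generated_by_closed:
  assumes "x \<in> lattice_generated_by B" "y \<in> lattice_generated_by B"
  shows "x + of_int k *\<^sub>R y \<in> lattice_generated_by B"
proof -
  obtain u v where "x = (\<Sum>i\<in>UNIV. of_int (u i) *\<^sub>R row i B)" "y = (\<Sum>i\<in>UNIV. of_int (v i) *\<^sub>R row i B)"
    using assms unfolding lattice_generated_by_def by blast
  hence "x + of_int k *\<^sub>R y = (\<Sum>i\<in>UNIV. of_int (u i + k * v i) *\<^sub>R row i B)"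
    by (simp add: scaleR_sum_right scaleR_add_left sum.distrib)
  thus ?thesis unfolding lattice_generated_by_def by (intro CollectI exI[of _ "\<lambda>i. u i + k * v i"]) simp
qed

lemma zero_in_lattice_generated_by: "0 \<in> lattice_generated_by B"
  unfolding lattice_generated_by_def by (auto intro!: exI[of _ "\<lambda>_. 0"])

lemma row_in_lattice_generated_by: "row i B \<in> lattice_generated_by B"
proof -
  have "row i B = (\<Sum>j\<in>UNIV. of_int (if j = i then 1 else 0) *\<^sub>R row j B)"
  proof -
    have "of_int (if j = i then 1 else 0) *\<^sub>R row j B = (if j = i then row j B else 0)" for j by simp
    thus ?thesis by simp
  qed
  thus ?thesis unfolding lattice_generated_by_def by (intro CollectI exI conjI TrueI)
qed

locale unimodular =
  fixes L :: "(real^'n) set"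
  assumes unimodular: "unimodular_lattice L"
begin

lemma inner_Ints: "x \<in> L \<Longrightarrow> y \<in> L \<Longrightarrow> x \<bullet> y \<in> \<int>"
  using unimodular by (auto simp: unimodular_lattice_def)

lemma add_scale_mem: "x \<in> L \<Longrightarrow> y \<in> L \<Longrightarrow> x + of_int k *\<^sub>R y \<in> L"
  using unimodular lattice_generated_by_closed by (auto simp: unimodular_lattice_def)

lemma zero_mem [simp]: "0 \<in> L"
  using unimodular zero_in_lattice_generated_by by (auto simp: unimodular_lattice_def)

lemma scale_mem: "y \<in> L \<Longrightarrow> of_int k *\<^sub>R y \<in> L"
  using add_scale_mem[of 0 y k] by simp

lemma add_mem: "x \<in> L \<Longrightarrow> y \<in> L \<Longrightarrow> x + y \<in> L"
  using add_scale_mem[of x y 1] by simp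

lemma uminus_mem: "y \<in> L \<Longrightarrow> - y \<in> L"
  using scale_mem[of y "-1"] by simp

lemma diff_mem: "x \<in> L \<Longrightarrow> y \<in> L \<Longrightarrow> x - y \<in> L"
  using add_scale_mem[of x y "-1"] by simp

lemma sum_mem: "(\<And>i. i \<in> I \<Longrightarrow> f i \<in> L) \<Longrightarrow> sum f I \<in> L"
  by (induction I rule: infinite_finite_induct) (auto intro: add_mem)

lemma span_eq_UNIV: "span L = UNIV"
proof -
  obtain B where B: "\<bar>det B\<bar> = 1" "L = lattice_generated_by B"
    using unimodular by (auto simp: unimodular_lattice_def)
  have "invertible B" using B by (subst invertible_det_nz) auto
  hence "span (rows B) = UNIV"
    unfolding invertible_def by (metis matrix_left_invertible_span_rows)
  moreover have "rows B \<subseteq> L" using B row_in_lattice_generated_by by (auto simp: rows_def)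
  ultimately show ?thesis using span_mono by blast
qed

text \<open>A unimodular lattice contains its dual: the coordinates z of y solve a linear system
  whose matrix is the Gram matrix of the basis. That matrix is integral of determinant 1, so
  Cramer's rule gives integral coordinates.\<close>

lemma dual_mem:
  assumes "\<And>x. x \<in> L \<Longrightarrow> y \<bullet> x \<in> \<int>"
  shows "y \<in> L"
proof -
  obtain B where B: "\<bar>det B\<bar> = 1" "L = lattice_generated_by B"
    using unimodular by (auto simp: unimodular_lattice_def)
  have rB: "row i B \<in> L" for i using B row_in_lattice_generated_by by auto
  have "invertible (transpose B)" using B by (subst invertible_det_nz) (auto simp: det_transpose)
  then obtain C where C: "transpose B ** C = mat 1" unfolding invertible_def by blast
  define z where "z = C *v y"
  have yz: "transpose B *v z = y" by (simp add: z_def matrix_vector_mul_assoc C)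
  define A where "A = B ** transpose B"
  define d where "d = B *v y"
  have "A *v z = d" by (simp add: A_def d_def flip: matrix_vector_mul_assoc yz)
  moreover have detA: "det A = 1"
    using B(1) by (simp add: A_def det_mul det_transpose) (metis abs_mult abs_mult_self mult_1)
  ultimately have z: "z = (\<chi> k. det (\<chi> i j. if j = k then d $ i else A $ i $ j))"
    using cramer[of A z d] by simp
  have dI: "d $ i \<in> \<int>" for i
  proof -
    have "d $ i = y \<bullet> row i B"
      by (simp add: d_def matrix_vector_mult_def inner_vec_def row_def mult.commute)
    thus ?thesis using assms[OF rB] by simp
  qed
  have AI: "A $ i $ j \<in> \<int>" for i j
  proof -
    have "A $ i $ j = row i B \<bullet> row j B"
      by (simp add: A_def matrix_matrix_mult_def transpose_def inner_vec_def row_def)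
    thus ?thesis using inner_Ints[OF rB rB] by simp
  qed
  have zI: "z $ k \<in> \<int>" for k
    unfolding z det_def by (auto intro!: Ints_sum Ints_mult Ints_prod dI AI)
  have "y = (\<Sum>i\<in>UNIV. of_int \<lfloor>z $ i\<rfloor> *\<^sub>R row i B)"
  proof -
    have "y = (\<Sum>i\<in>UNIV. z $ i *\<^sub>R row i B)"
      unfolding yz[symmetric] by (simp add: vec_eq_iff matrix_vector_mult_def transpose_def row_def mult.commute)
    moreover have "of_int \<lfloor>z $ i\<rfloor> = z $ i" for i using zI[of i] by (auto elim: Ints_cases)
    ultimately show ?thesis by (simp only:)
  qed
  thus ?thesis unfolding B lattice_generated_by_def by (intro CollectI exI conjI TrueI)
qed

text \<open>A lattice vector is determined by its integral inner products with the basis, and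
  Cauchy-Schwarz bounds these.\<close>

lemma finite_bounded: "finite {x \<in> L. norm x \<le> c}"
proof -
  obtain B where B: "\<bar>det B\<bar> = 1" "L = lattice_generated_by B"
    using unimodular by (auto simp: unimodular_lattice_def)
  have rB: "row i B \<in> L" for i using B row_in_lattice_generated_by by auto
  have "invertible B" using B by (subst invertible_det_nz) auto
  hence sp: "span (rows B) = UNIV"
    unfolding invertible_def by (metis matrix_left_invertible_span_rows)
  define N where "N = \<lceil>\<Sum>i\<in>UNIV. \<bar>c\<bar> * norm (row i B)\<rceil>"
  define \<kappa> where "\<kappa> x i = \<lfloor>x \<bullet> row i B\<rfloor>" for x i
  have \<kappa>: "of_int (\<kappa> x i) = x \<bullet> row i B" if "x \<in> L" for x i
    using inner_Ints[OF that rB[of i]] by (auto simp: \<kappa>_def elim!: Ints_cases)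
  have "inj_on \<kappa> {x \<in> L. norm x \<le> c}"
  proof (rule inj_onI)
    fix x y assume xy: "x \<in> {x \<in> L. norm x \<le> c}" "y \<in> {x \<in> L. norm x \<le> c}" "\<kappa> x = \<kappa> y"
    hence "x \<bullet> row i B = y \<bullet> row i B" for i using \<kappa>[of x i] \<kappa>[of y i] by simp
    hence "orthogonal (x - y) w" if "w \<in> rows B" for w
      using that by (auto simp: rows_def orthogonal_def inner_diff_left)
    hence "orthogonal (x - y) (x - y)" using sp orthogonal_to_span[of "x - y" "rows B"] by simp
    thus "x = y" by (simp add: orthogonal_self)
  qed
  moreover have "\<kappa> ` {x \<in> L. norm x \<le> c} \<subseteq> PiE UNIV (\<lambda>_. {-N..N})"
  proof (clarsimp simp: PiE_UNIV_domain)
    fix x i assume x: "x \<in> L" "norm x \<le> c"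
    have "\<bar>x \<bullet> row i B\<bar> \<le> \<bar>c\<bar> * norm (row i B)"
      using Cauchy_Schwarz_ineq2[of x "row i B"] x by (smt (verit) mult_right_mono norm_ge_zero)
    also have "\<dots> \<le> (\<Sum>i\<in>UNIV. \<bar>c\<bar> * norm (row i B))" by (rule member_le_sum) auto
    finally have "\<bar>of_int (\<kappa> x i)\<bar> \<le> (of_int N :: real)" unfolding \<kappa>[OF x(1)] N_def by linarith
    thus "- N \<le> \<kappa> x i \<and> \<kappa> x i \<le> N" by linarith
  qed
  ultimately show ?thesis by (rule inj_on_finite) (intro finite_PiE, auto)
qed

text \<open>Such vectors generate a sublattice of finite index that is an orthogonal product of
  one-dimensional lattices, so Gaussian sums over its cosets factor.\<close>

definition orthogonal_frame :: "(real^'n) set \<Rightarrow> bool" where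
  "orthogonal_frame S \<longleftrightarrow> finite S \<and> S \<subseteq> L - {0} \<and> pairwise orthogonal S \<and> span S = UNIV"

text \<open>Gram-Schmidt over the integers: for a maximal orthogonal set S, a lattice vector outside
  its span could be made orthogonal to S without leaving L, after multiplication by the product D of
  all \<open>s \<bullet> s\<close>, which clears the denominators of the projection.\<close>

lemma orthogonal_frame_exists: "\<exists>S. orthogonal_frame S"
proof -
  define P where "P S \<longleftrightarrow> S \<subseteq> L - {0} \<and> pairwise orthogonal S" for S
  have ind: "independent S" if "P S" for S
    using that pairwise_orthogonal_independent unfolding P_def by auto
  hence bd: "card S \<le> DIM(real^'n)" if "P S" for S
    using independent_bound[OF ind[OF that]] by simp
  have "P {}" by (simp add: P_def)
  then obtain S where S: "P S" and max: "\<And>T. P T \<Longrightarrow> card T \<le> card S"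
    using ex_has_greatest_nat[of P "{}" card "Suc DIM(real^'n)"] bd by (metis le_imp_less_Suc)
  have fin: "finite S" using independent_bound[OF ind[OF S]] by simp
  have "span S = UNIV"
  proof (rule ccontr)
    assume "span S \<noteq> UNIV"
    then obtain x where x: "x \<in> L" "x \<notin> span S"
      using span_eq_UNIV by (metis span_mono span_span subsetI top.extremum_uniqueI)
    define D where "D = (\<Prod>s\<in>S. s \<bullet> s)"
    have s0: "s \<bullet> s \<noteq> 0" if "s \<in> S" for s using that S by (auto simp: P_def)
    have D0: "D \<noteq> 0" using s0 fin by (simp add: D_def)
    define y where "y = D *\<^sub>R x - (\<Sum>s\<in>S. (D * (x \<bullet> s) / (s \<bullet> s)) *\<^sub>R s)"
    have int: "D * (x \<bullet> s) / (s \<bullet> s) \<in> \<int>" if "s \<in> S" for s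
    proof -
      have "D = (s \<bullet> s) * (\<Prod>u\<in>S - {s}. u \<bullet> u)" using fin that by (simp add: D_def prod.remove)
      hence "D * (x \<bullet> s) / (s \<bullet> s) = (\<Prod>u\<in>S - {s}. u \<bullet> u) * (x \<bullet> s)" using s0[OF that] by simp
      also have "\<dots> \<in> \<int>" using S x that by (intro Ints_mult Ints_prod inner_Ints) (auto simp: P_def)
      finally show ?thesis .
    qed
    have scale: "c *\<^sub>R s \<in> L" if "c \<in> \<int>" "s \<in> L" for c s using that scale_mem by (auto elim: Ints_cases)
    have "D \<in> \<int>" unfolding D_def using S by (intro Ints_prod inner_Ints) (auto simp: P_def)
    hence yL: "y \<in> L" unfolding y_def using S x int
      by (intro diff_mem sum_mem scale) (auto simp: P_def)
    have y0: "y \<noteq> 0"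
    proof
      assume "y = 0"
      hence "inverse D *\<^sub>R (D *\<^sub>R x) = inverse D *\<^sub>R (\<Sum>s\<in>S. (D * (x \<bullet> s) / (s \<bullet> s)) *\<^sub>R s)" by (simp add: y_def)
      hence "x = inverse D *\<^sub>R (\<Sum>s\<in>S. (D * (x \<bullet> s) / (s \<bullet> s)) *\<^sub>R s)" using D0 by simp
      also have "\<dots> \<in> span S" by (intro span_scale span_sum span_base)
      finally show False using x by simp
    qed
    have orth: "y \<bullet> u = 0" if u: "u \<in> S" for u
    proof -
      have "(\<Sum>s\<in>S. (D * (x \<bullet> s) / (s \<bullet> s)) * (s \<bullet> u)) = (\<Sum>s\<in>S. if s = u then D * (x \<bullet> u) else 0)"
        using S u s0 by (intro sum.cong) (auto simp: P_def pairwise_def orthogonal_def)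
      thus ?thesis using fin u by (simp add: y_def inner_diff_left inner_sum_left)
    qed
    have "P (insert y S)"
      using S yL y0 orth unfolding P_def by (auto simp: pairwise_insert orthogonal_def inner_commute)
    moreover have "y \<notin> S" using orth[of y] y0 by auto
    ultimately show False using max[of "insert y S"] fin by simp
  qed
  thus ?thesis using S fin by (auto simp: orthogonal_frame_def P_def)
qed

end

section \<open>Poisson summation over a unimodular lattice\<close>

text \<open>Completing the square in the real part of w gives the shift Re w / m and in the
  imaginary part the frequency t Im w. What remains is the factor with \<open>w\<^sup>2\<close> in
  the exponent, which isotropy will cancel once all coordinates are multiplied.\<close>

lemma poisson_gaussian_complex:
  fixes m t \<gamma> :: real and w :: complex
  assumes m: "m > 0" and t: "t > 0"
  shows "(\<Sum>\<^sub>\<infinity>n::int. exp (- of_real (pi * t * m * (of_int n + \<gamma>)\<^sup>2) - of_real (2 * pi * t * (of_int n + \<gamma>)) * w))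
       = exp (of_real (pi * t / m) * w\<^sup>2) / of_real (sqrt (t * m)) *
         (\<Sum>\<^sub>\<infinity>k::int. exp (- of_real (pi * (of_int k)\<^sup>2 / (t * m)) + of_real (2 * pi * of_int k / m) * (\<i> * w) + of_real (2 * pi * of_int k * \<gamma>) * \<i>))"
proof -
  define P where "P = Re w"
  define R where "R = Im w"
  have w: "w = of_real P + \<i> * of_real R" by (simp add: P_def R_def complex_eq)
  define a where "a = t * m"
  define b where "b = t * R"
  define x where "x = \<gamma> + P / m"
  define E where "E = exp (of_real (pi * t / m) * w\<^sup>2)"
  have a: "a > 0" using assms by (simp add: a_def)
  have l: "exp (- of_real (pi * t * m * (of_int n + \<gamma>)\<^sup>2) - of_real (2 * pi * t * (of_int n + \<gamma>)) * w)
     = (exp (of_real (pi * t * P\<^sup>2 / m) + \<i> * of_real (2 * pi * t * P * R / m))) * (of_real (exp (- pi * a * (of_int n + x)\<^sup>2)) * cis (- 2 * pi * b * (of_int n + x)))" for n :: int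
    unfolding cis_conv_exp exp_of_real[symmetric] mult_exp_exp
    by (rule arg_cong[of _ _ exp]) (use assms in \<open>simp add: complex_eq_iff w a_def b_def x_def power2_eq_square field_simps\<close>)
  have rr: "E * exp (- of_real (pi * (of_int k)\<^sup>2 / (t * m)) + of_real (2 * pi * of_int k / m) * (\<i> * w) + of_real (2 * pi * of_int k * \<gamma>) * \<i>)
     = exp (of_real (pi * t * P\<^sup>2 / m) + \<i> * of_real (2 * pi * t * P * R / m)) * (of_real (exp (- pi * (of_int k + b)\<^sup>2 / a)) * cis (2 * pi * of_int k * x))" for k :: int
    unfolding E_def cis_conv_exp exp_of_real[symmetric] mult_exp_exp
    by (rule arg_cong[of _ _ exp]) (use assms in \<open>simp add: complex_eq_iff w a_def b_def x_def power2_eq_square field_simps\<close>)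
  have "(\<Sum>\<^sub>\<infinity>n::int. exp (- of_real (pi * t * m * (of_int n + \<gamma>)\<^sup>2) - of_real (2 * pi * t * (of_int n + \<gamma>)) * w))
    = exp (of_real (pi * t * P\<^sup>2 / m) + \<i> * of_real (2 * pi * t * P * R / m)) * (\<Sum>\<^sub>\<infinity>k::int. of_real (exp (- pi * (of_int k + b)\<^sup>2 / a) / sqrt a) * cis (2 * pi * of_int k * x))"
    unfolding l poisson_gaussian[OF a, symmetric] by (rule infsum_cmult_right')
  also have "\<dots> = (\<Sum>\<^sub>\<infinity>k::int. (1 / of_real (sqrt a)) * (exp (of_real (pi * t * P\<^sup>2 / m) + \<i> * of_real (2 * pi * t * P * R / m)) * (of_real (exp (- pi * (of_int k + b)\<^sup>2 / a)) * cis (2 * pi * of_int k * x))))"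
    by (subst infsum_cmult_right'[symmetric]) (simp add: field_simps)
  also have "\<dots> = E / of_real (sqrt a) * (\<Sum>\<^sub>\<infinity>k::int. exp (- of_real (pi * (of_int k)\<^sup>2 / (t * m)) + of_real (2 * pi * of_int k / m) * (\<i> * w) + of_real (2 * pi * of_int k * \<gamma>) * \<i>))"
    unfolding rr[symmetric] by (subst infsum_cmult_right'[symmetric]) (simp add: field_simps)
  finally show ?thesis by (simp add: E_def a_def)
qed

definition complex_inner :: "real^'n \<Rightarrow> real^'n \<Rightarrow> real^'n \<Rightarrow> complex" where
  "complex_inner p r x = Complex (p \<bullet> x) (r \<bullet> x)"

text \<open>For isotropic w = p + i r this is exp(-pi t (x + w) . (x + w)), the Gaussian recentered
  at -w; \<open>dual_term\<close> is its Fourier transform up to a power of t.\<close>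

definition theta_term :: "real \<Rightarrow> real^'n \<Rightarrow> real^'n \<Rightarrow> real^'n \<Rightarrow> complex" where
  "theta_term t p r x = exp (- of_real (pi * t * (x \<bullet> x)) - of_real (2 * pi * t) * complex_inner p r x)"

definition dual_term :: "real \<Rightarrow> real^'n \<Rightarrow> real^'n \<Rightarrow> real^'n \<Rightarrow> complex" where
  "dual_term t p r x = exp (- of_real (pi * (x \<bullet> x) / t) + of_real (2 * pi) * (\<i> * complex_inner p r x))"

context unimodular
begin

context
  fixes S assumes S: "orthogonal_frame S"
begin

lemma finite_frame: "finite S" and frame_mem: "s \<in> S \<Longrightarrow> s \<in> L" and frame_pos: "s \<in> S \<Longrightarrow> s \<bullet> s > 0"
  and frame_orthogonal: "s \<in> S \<Longrightarrow> u \<in> S \<Longrightarrow> s \<noteq> u \<Longrightarrow> s \<bullet> u = 0"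
  using S by (auto simp: orthogonal_frame_def pairwise_def orthogonal_def)

lemma frame_sum_inner:
  assumes "u \<in> S"
  shows "(\<Sum>s\<in>S. f s *\<^sub>R s) \<bullet> u = f u * (u \<bullet> u)"
proof -
  have "(\<Sum>s\<in>S. f s *\<^sub>R s) \<bullet> u = (\<Sum>s\<in>S. if s = u then f u * (u \<bullet> u) else 0)"
    unfolding inner_sum_left using frame_orthogonal assms by (intro sum.cong) auto
  thus ?thesis using assms finite_frame by simp
qed

lemma frame_ext:
  assumes "\<And>s. s \<in> S \<Longrightarrow> x \<bullet> s = y \<bullet> s"
  shows "x = y"
proof -
  have "orthogonal (x - y) w" if "w \<in> S" for w
    using that assms by (auto simp: orthogonal_def inner_diff_left)
  hence "orthogonal (x - y) (x - y)" using S orthogonal_to_span[of "x - y" S] by (auto simp: orthogonal_frame_def)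
  thus "x = y" by (simp add: orthogonal_self)
qed

lemma frame_expand: "x = (\<Sum>s\<in>S. (x \<bullet> s / (s \<bullet> s)) *\<^sub>R s)"
  by (rule frame_ext) (use frame_pos in \<open>force simp: frame_sum_inner\<close>)

lemma frame_inner: "x \<bullet> y = (\<Sum>s\<in>S. (x \<bullet> s) * (y \<bullet> s) / (s \<bullet> s))"
proof -
  have "x \<bullet> y = (\<Sum>s\<in>S. (x \<bullet> s / (s \<bullet> s)) *\<^sub>R s) \<bullet> y" using frame_expand[of x] by simp
  also have "\<dots> = (\<Sum>s\<in>S. (x \<bullet> s) * (y \<bullet> s) / (s \<bullet> s))"
    unfolding inner_sum_left by (intro sum.cong) (auto simp: inner_commute[of y])
  finally show ?thesis .
qed

lemma frame_complex_inner: "complex_inner p r x = (\<Sum>s\<in>S. of_real (x \<bullet> s / (s \<bullet> s)) * complex_inner p r s)"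
  using frame_inner[of p x] frame_inner[of r x]
  by (simp add: complex_inner_def complex_eq_iff mult.commute)

text \<open>By Parseval in the frame the sum is the bilinear square of p + i r, that is,
  \<open>p \<bullet> p - r \<bullet> r\<close> plus 2 i times \<open>p \<bullet> r\<close>.\<close>

lemma frame_complex_isotropic:
  assumes "p \<bullet> p = r \<bullet> r" "p \<bullet> r = 0"
  shows "(\<Sum>s\<in>S. (complex_inner p r s)\<^sup>2 / of_real (s \<bullet> s)) = 0"
proof -
  have "(complex_inner p r s)\<^sup>2 / of_real (s \<bullet> s) = of_real ((p \<bullet> s) * (p \<bullet> s) / (s \<bullet> s)) - of_real ((r \<bullet> s) * (r \<bullet> s) / (s \<bullet> s))
     + 2 * \<i> * of_real ((p \<bullet> s) * (r \<bullet> s) / (s \<bullet> s))" (is "_ = ?q s") for s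
    by (simp add: complex_inner_def complex_eq_iff power2_eq_square diff_divide_distrib)
  hence "(\<Sum>s\<in>S. (complex_inner p r s)\<^sup>2 / of_real (s \<bullet> s)) = (\<Sum>s\<in>S. ?q s)" by (rule sum.cong[OF refl])
  also have "\<dots> = of_real (p \<bullet> p) - of_real (r \<bullet> r) + 2 * \<i> * of_real (p \<bullet> r)"
    unfolding frame_inner[of p p] frame_inner[of r r] frame_inner[of p r]
    by (simp only: sum.distrib sum_subtractf of_real_sum sum_distrib_left)
  finally show ?thesis using assms by simp
qed

definition coords :: "real^'n \<Rightarrow> real^'n \<Rightarrow> int" where
  "coords x = (\<lambda>s\<in>S. \<lfloor>x \<bullet> s\<rfloor>)"

lemma coords: "x \<in> L \<Longrightarrow> s \<in> S \<Longrightarrow> of_int (coords x s) = x \<bullet> s"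
  using inner_Ints[of x s] frame_mem by (auto simp: coords_def elim!: Ints_cases)

text \<open>In frame coordinates the quadratic form is diagonal and the norm is at most the sum of
  the coordinate lengths. Hence the summand is dominated by a product of one-dimensional Gaussians,
  and L embeds into the integer points by \<open>coords\<close>. The linear term in the norm later
  absorbs exponentials of linear forms.\<close>

lemma summable_gaussian_lattice_frame:
  assumes c: "c > 0"
  shows "(\<lambda>x. exp (- c * (x \<bullet> x) + d * norm x)) summable_on L"
proof -
  define f where "f s k = exp (- (c / (s \<bullet> s)) * (of_int k)\<^sup>2 + (\<bar>d\<bar> / sqrt (s \<bullet> s)) * \<bar>of_int k\<bar>)" for s :: "real^'n" and k :: int
  have "Infinite_Set_Sum.abs_summable_on (f s) UNIV" if "s \<in> S" for s
    unfolding abs_summable_equivalent[symmetric] f_def norm_exp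
    using summable_gaussian_int[of "c / (s \<bullet> s)" "\<bar>d\<bar> / sqrt (s \<bullet> s)"] c frame_pos[OF that] by simp
  hence "Infinite_Set_Sum.abs_summable_on (\<lambda>g. \<Prod>s\<in>S. f s (g s)) (PiE S (\<lambda>_. UNIV))"
    by (intro abs_summable_on_prod_PiE finite_frame) auto
  hence sum: "(\<lambda>g. \<Prod>s\<in>S. f s (g s)) summable_on PiE S (\<lambda>_. UNIV)"
    unfolding abs_summable_equivalent[symmetric] by (rule abs_summable_summable)
  have inj: "inj_on coords L"
  proof (rule inj_onI)
    fix x y assume "x \<in> L" "y \<in> L" "coords x = coords y"
    thus "x = y" using coords[of x] coords[of y] by (intro frame_ext) metis
  qed
  have "coords ` L \<subseteq> PiE S (\<lambda>_. UNIV)" by (auto simp: coords_def)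
  from summable_on_subset_banach[OF sum this]
  have "(\<lambda>x. \<Prod>s\<in>S. f s (coords x s)) summable_on L"
    using summable_on_reindex[OF inj, of "\<lambda>g. \<Prod>s\<in>S. f s (g s)"] unfolding o_def by blast
  thus ?thesis
  proof (rule summable_on_comparison_test)
    fix x assume x: "x \<in> L"
    have "x \<bullet> x = (\<Sum>s\<in>S. (x \<bullet> s)\<^sup>2 / (s \<bullet> s))" using frame_inner[of x x] by (simp add: power2_eq_square)
    moreover have "norm x \<le> (\<Sum>s\<in>S. \<bar>x \<bullet> s\<bar> / sqrt (s \<bullet> s))"
    proof -
      have "norm x \<le> (\<Sum>s\<in>S. norm ((x \<bullet> s / (s \<bullet> s)) *\<^sub>R s))"
        by (subst frame_expand[of x]) (rule norm_sum)
      also have "\<dots> = (\<Sum>s\<in>S. \<bar>x \<bullet> s\<bar> / sqrt (s \<bullet> s))"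
      proof (rule sum.cong[OF refl])
        fix s assume s: "s \<in> S"
        have "norm s = sqrt (s \<bullet> s)" by (rule norm_eq_sqrt_inner)
        moreover have "s \<bullet> s = sqrt (s \<bullet> s) * sqrt (s \<bullet> s)" using frame_pos[OF s] by simp
        ultimately show "norm ((x \<bullet> s / (s \<bullet> s)) *\<^sub>R s) = \<bar>x \<bullet> s\<bar> / sqrt (s \<bullet> s)"
          using frame_pos[OF s] by (simp add: abs_mult field_simps)
      qed
      finally show ?thesis .
    qed
    hence "\<bar>d\<bar> * norm x \<le> \<bar>d\<bar> * (\<Sum>s\<in>S. \<bar>x \<bullet> s\<bar> / sqrt (s \<bullet> s))" by (rule mult_left_mono) auto
    moreover have "d * norm x \<le> \<bar>d\<bar> * norm x" by (intro mult_right_mono) auto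
    moreover have "\<bar>d\<bar> * (\<Sum>s\<in>S. \<bar>x \<bullet> s\<bar> / sqrt (s \<bullet> s)) = (\<Sum>s\<in>S. (\<bar>d\<bar> / sqrt (s \<bullet> s)) * \<bar>x \<bullet> s\<bar>)"
      by (simp add: sum_distrib_left)
    moreover have "- c * (\<Sum>s\<in>S. (x \<bullet> s)\<^sup>2 / (s \<bullet> s)) = (\<Sum>s\<in>S. - (c / (s \<bullet> s)) * (x \<bullet> s)\<^sup>2)"
      unfolding sum_distrib_left by (intro sum.cong) auto
    ultimately have d: "d * norm x \<le> (\<Sum>s\<in>S. (\<bar>d\<bar> / sqrt (s \<bullet> s)) * \<bar>x \<bullet> s\<bar>)"
      and c: "- c * (x \<bullet> x) = (\<Sum>s\<in>S. - (c / (s \<bullet> s)) * (x \<bullet> s)\<^sup>2)" by simp_all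
    have "- c * (x \<bullet> x) + d * norm x \<le> (\<Sum>s\<in>S. - (c / (s \<bullet> s)) * (x \<bullet> s)\<^sup>2 + (\<bar>d\<bar> / sqrt (s \<bullet> s)) * \<bar>x \<bullet> s\<bar>)"
      unfolding sum.distrib c using d by (rule add_left_mono)
    also have "exp \<dots> = (\<Prod>s\<in>S. f s (coords x s))"
      unfolding exp_sum[OF finite_frame] f_def by (intro prod.cong) (auto simp: coords[OF x])
    finally show "exp (- c * (x \<bullet> x) + d * norm x) \<le> (\<Prod>s\<in>S. f s (coords x s))" by simp
  qed auto
qed

text \<open>The half-open box picks one representative from every coset of L modulo the sublattice
  generated by S.\<close>

definition frame_residues :: "(real^'n) set" where
  "frame_residues = {x \<in> L. \<forall>s\<in>S. 0 \<le> x \<bullet> s \<and> x \<bullet> s < s \<bullet> s}"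

lemma finite_frame_residues: "finite frame_residues"
proof (rule finite_subset[OF _ finite_bounded[of "sqrt (\<Sum>s\<in>S. s \<bullet> s)"]])
  show "frame_residues \<subseteq> {x \<in> L. norm x \<le> sqrt (\<Sum>s\<in>S. s \<bullet> s)}"
  proof clarsimp
    fix x assume x: "x \<in> frame_residues"
    have "x \<bullet> x \<le> (\<Sum>s\<in>S. s \<bullet> s)"
      unfolding frame_inner[of x x]
    proof (rule sum_mono)
      fix s assume s: "s \<in> S"
      have "(x \<bullet> s) * (x \<bullet> s) \<le> (s \<bullet> s) * (s \<bullet> s)" using x s frame_pos[OF s] by (intro mult_mono) (simp_all add: frame_residues_def less_imp_le)
      thus "(x \<bullet> s) * (x \<bullet> s) / (s \<bullet> s) \<le> s \<bullet> s" using frame_pos[OF s] by (simp add: divide_le_eq)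
    qed
    thus "x \<in> L \<and> norm x \<le> sqrt (\<Sum>s\<in>S. s \<bullet> s)" using x by (simp add: frame_residues_def norm_eq_sqrt_inner)
  qed
qed

definition frame_shift :: "(real^'n) \<times> (real^'n \<Rightarrow> int) \<Rightarrow> real^'n" where
  "frame_shift = (\<lambda>(c, n). c + (\<Sum>s\<in>S. of_int (n s) *\<^sub>R s))"

lemma frame_shift_inner: "u \<in> S \<Longrightarrow> frame_shift (c, n) \<bullet> u = c \<bullet> u + of_int (n u) * (u \<bullet> u)"
  by (simp add: frame_shift_def inner_add_left frame_sum_inner)

definition reduction :: "real^'n \<Rightarrow> (real^'n) \<times> (real^'n \<Rightarrow> int)" where
  "reduction x = (let n = (\<lambda>s\<in>S. \<lfloor>x \<bullet> s / (s \<bullet> s)\<rfloor>) in (x - (\<Sum>s\<in>S. of_int (n s) *\<^sub>R s), n))"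

lemma frame_shift_reduction: "frame_shift (reduction x) = x"
  by (simp add: frame_shift_def reduction_def Let_def)

lemma reduction_mem:
  assumes "x \<in> L"
  shows "reduction x \<in> frame_residues \<times> PiE S (\<lambda>_. UNIV)"
proof -
  have "0 \<le> fst (reduction x) \<bullet> s" "fst (reduction x) \<bullet> s < s \<bullet> s" if s: "s \<in> S" for s
  proof -
    let ?q = "x \<bullet> s / (s \<bullet> s)"
    have e: "fst (reduction x) \<bullet> s = frac ?q * (s \<bullet> s)"
      using s frame_pos[OF s] by (simp add: reduction_def Let_def inner_diff_left frame_sum_inner frac_def left_diff_distrib)
    show "0 \<le> fst (reduction x) \<bullet> s" "fst (reduction x) \<bullet> s < s \<bullet> s"
      unfolding e using frac_ge_0[of ?q] frac_lt_1[of ?q] frame_pos[OF s] by auto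
  qed
  moreover have "fst (reduction x) \<in> L"
    unfolding reduction_def Let_def fst_conv by (intro diff_mem sum_mem scale_mem frame_mem assms)
  moreover have "snd (reduction x) \<in> PiE S (\<lambda>_. UNIV)" by (simp add: reduction_def Let_def)
  ultimately show ?thesis by (simp add: frame_residues_def mem_Times_iff)
qed

lemma bij_betw_frame_shift: "bij_betw frame_shift (frame_residues \<times> PiE S (\<lambda>_. UNIV)) L"
proof (rule bij_betw_imageI)
  show "frame_shift ` (frame_residues \<times> PiE S (\<lambda>_. UNIV)) = L"
  proof
    show "frame_shift ` (frame_residues \<times> PiE S (\<lambda>_. UNIV)) \<subseteq> L"
      unfolding frame_shift_def frame_residues_def
      by clarsimp (rule add_mem, assumption, intro sum_mem scale_mem frame_mem)
    show "L \<subseteq> frame_shift ` (frame_residues \<times> PiE S (\<lambda>_. UNIV))"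
      using reduction_mem frame_shift_reduction by (metis imageI subsetI)
  qed
  show "inj_on frame_shift (frame_residues \<times> PiE S (\<lambda>_. UNIV))"
  proof (rule inj_onI, clarify)
    fix c n d k assume cd: "c \<in> frame_residues" "d \<in> frame_residues" and nk: "n \<in> PiE S (\<lambda>_. UNIV)" "k \<in> PiE S (\<lambda>_. UNIV)"
      and eq: "frame_shift (c, n) = frame_shift (d, k)"
    have "n s = k s" if s: "s \<in> S" for s
    proof -
      have "frame_shift (c, n) \<bullet> s = frame_shift (d, k) \<bullet> s" using eq by simp
      hence "(of_int (n s) - of_int (k s)) * (s \<bullet> s) = d \<bullet> s - c \<bullet> s" by (simp add: frame_shift_inner[OF s] algebra_simps)
      hence "\<bar>of_int (n s - k s)\<bar> * (s \<bullet> s) = \<bar>d \<bullet> s - c \<bullet> s\<bar>"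
        using frame_pos[OF s] by (metis abs_mult abs_of_pos of_int_diff)
      also have "\<dots> < 1 * (s \<bullet> s)" using cd s by (force simp: frame_residues_def)
      finally have "\<bar>of_int (n s - k s)\<bar> < (1::real)" using frame_pos[OF s] mult_less_cancel_right_pos by blast
      thus ?thesis by linarith
    qed
    hence "n = k" using nk by (intro PiE_ext) auto
    thus "c = d \<and> n = k" using eq by (simp add: frame_shift_def)
  qed
qed

text \<open>These vectors form the dual of the sublattice generated by S; it contains L, whose inner
  products are integral.\<close>

definition codual :: "(real^'n \<Rightarrow> int) \<Rightarrow> real^'n" where
  "codual k = (\<Sum>s\<in>S. (of_int (k s) / (s \<bullet> s)) *\<^sub>R s)"

lemma codual_inner: "u \<in> S \<Longrightarrow> codual k \<bullet> u = of_int (k u)"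
  using frame_pos by (force simp: codual_def frame_sum_inner)

lemma bij_betw_codual: "bij_betw codual {k \<in> PiE S (\<lambda>_. UNIV). codual k \<in> L} L"
proof (rule bij_betwI[where g = coords])
  show "coords \<in> L \<rightarrow> {k \<in> PiE S (\<lambda>_. UNIV). codual k \<in> L}"
  proof
    fix x assume x: "x \<in> L"
    have "codual (coords x) = x" by (rule frame_ext) (simp add: codual_inner coords[OF x])
    thus "coords x \<in> {k \<in> PiE S (\<lambda>_. UNIV). codual k \<in> L}" using x by (auto simp: coords_def)
  qed
  show "codual (coords x) = x" if "x \<in> L" for x
    by (rule frame_ext) (simp add: codual_inner coords[OF that])
  show "coords (codual k) = k" if "k \<in> {k \<in> PiE S (\<lambda>_. UNIV). codual k \<in> L}" for k
  proof
    fix s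
    show "coords (codual k) s = k s"
      using that PiE_arb[of k S "\<lambda>_. UNIV" s] by (cases "s \<in> S") (simp_all add: coords_def codual_inner)
  qed
  show "codual \<in> {k \<in> PiE S (\<lambda>_. UNIV). codual k \<in> L} \<rightarrow> L" by blast
qed

text \<open>The vector \<open>codual k\<close> is a character of the finite group of residues. It is
  trivial exactly when it lies in L, by self-duality. Otherwise some y in L has character value
  different from 1; translation by y, followed by reduction, permutes the residues and multiplies
  the sum by this value, so the sum is 0.\<close>

lemma character_sum:
  assumes k: "k \<in> PiE S (\<lambda>_. UNIV)"
  shows "(\<Sum>c\<in>frame_residues. cis (2 * pi * (codual k \<bullet> c))) = (if codual k \<in> L then of_nat (card frame_residues) else 0)"
proof (cases "codual k \<in> L")
  case True
  have "cis (2 * pi * (codual k \<bullet> c)) = 1" if "c \<in> frame_residues" for c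
    using inner_Ints[OF True, of c] that by (intro cis_multiple_2pi) (auto simp: frame_residues_def)
  thus ?thesis using True by simp
next
  case False
  define ch where "ch x = cis (2 * pi * (codual k \<bullet> x))" for x
  from False obtain y where y: "y \<in> L" "codual k \<bullet> y \<notin> \<int>" using dual_mem by blast
  have add: "ch (u + v) = ch u * ch v" for u v by (simp add: ch_def cis_mult inner_add_right algebra_simps)
  have tr: "ch (frame_shift (c, n)) = ch c" for c n
  proof -
    have "codual k \<bullet> (\<Sum>s\<in>S. of_int (n s) *\<^sub>R s) = (\<Sum>s\<in>S. of_int (n s * k s))"
      by (simp add: inner_sum_right codual_inner)
    hence "ch (\<Sum>s\<in>S. of_int (n s) *\<^sub>R s) = 1" unfolding ch_def by (intro cis_multiple_2pi) auto
    thus ?thesis by (simp add: frame_shift_def add)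
  qed
  have red: "ch (fst (reduction x)) = ch x" for x
    using tr[of "fst (reduction x)" "snd (reduction x)"] by (simp add: frame_shift_reduction)
  have inj: "inj_on (\<lambda>c. fst (reduction (c + y))) frame_residues"
  proof (rule inj_onI)
    fix c d assume cd: "c \<in> frame_residues" "d \<in> frame_residues" "fst (reduction (c + y)) = fst (reduction (d + y))"
    define e where "e = fst (reduction (c + y))"
    obtain n where n: "c + y = frame_shift (e, n)" unfolding e_def by (metis frame_shift_reduction prod.collapse)
    obtain m where m: "d + y = frame_shift (e, m)" unfolding e_def by (metis frame_shift_reduction prod.collapse cd(3))
    have "c = frame_shift (d, (\<lambda>s\<in>S. n s - m s))"
    proof (rule frame_ext)
      fix s assume s: "s \<in> S"
      have "(c + y) \<bullet> s - (d + y) \<bullet> s = (of_int (n s) - of_int (m s)) * (s \<bullet> s)"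
        unfolding n m frame_shift_inner[OF s] by (simp add: left_diff_distrib)
      thus "c \<bullet> s = frame_shift (d, (\<lambda>s\<in>S. n s - m s)) \<bullet> s"
        using s by (simp add: frame_shift_inner inner_add_left)
    qed
    moreover have "c = frame_shift (c, (\<lambda>s\<in>S. 0))" by (simp add: frame_shift_def)
    ultimately have "frame_shift (c, (\<lambda>s\<in>S. 0)) = frame_shift (d, (\<lambda>s\<in>S. n s - m s))" by simp
    hence "(c, (\<lambda>s\<in>S. 0)) = (d, (\<lambda>s\<in>S. n s - m s))"
      using bij_betw_imp_inj_on[OF bij_betw_frame_shift] cd by (auto dest: inj_onD)
    thus "c = d" by simp
  qed
  have "(\<lambda>c. fst (reduction (c + y))) ` frame_residues \<subseteq> frame_residues"
    using reduction_mem add_mem y by (auto simp: frame_residues_def mem_Times_iff)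
  hence bij: "bij_betw (\<lambda>c. fst (reduction (c + y))) frame_residues frame_residues"
    using endo_inj_surj[OF finite_frame_residues _ inj] inj by (auto simp: bij_betw_def)
  have "(\<Sum>c\<in>frame_residues. ch c) = (\<Sum>c\<in>frame_residues. ch (fst (reduction (c + y))))"
    using sum.reindex_bij_betw[OF bij, of ch] by simp
  also have "\<dots> = (\<Sum>c\<in>frame_residues. ch c) * ch y" by (simp add: red add sum_distrib_right)
  finally have "(\<Sum>c\<in>frame_residues. ch c) * (1 - ch y) = 0" by (simp add: algebra_simps)
  moreover have "ch y \<noteq> 1"
  proof
    assume "ch y = 1"
    hence "cos (2 * pi * (codual k \<bullet> y)) = 1" by (simp add: ch_def complex_eq_iff)
    then obtain j :: int where "2 * pi * (codual k \<bullet> y) = of_int j * 2 * pi" using cos_one_2pi_int by blast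
    hence "codual k \<bullet> y = of_int j" by simp
    thus False using y(2) by simp
  qed
  ultimately show ?thesis using False by (simp add: ch_def)
qed

context
  fixes t :: real and p r :: "real^'n"
  assumes t: "t > 0"
begin

lemma theta_term_shift:
  "theta_term t p r (frame_shift (c, n)) = (\<Prod>s\<in>S. exp (- of_real (pi * t * (s \<bullet> s) * (of_int (n s) + c \<bullet> s / (s \<bullet> s))\<^sup>2)
      - of_real (2 * pi * t * (of_int (n s) + c \<bullet> s / (s \<bullet> s))) * complex_inner p r s))"
proof -
  define x where "x = frame_shift (c, n)"
  have xs: "x \<bullet> s / (s \<bullet> s) = of_int (n s) + c \<bullet> s / (s \<bullet> s)" if "s \<in> S" for s
    using frame_shift_inner[OF that, of c n] frame_pos[OF that] by (simp add: x_def add_divide_distrib)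
  have "x \<bullet> x = (\<Sum>s\<in>S. (s \<bullet> s) * (x \<bullet> s / (s \<bullet> s))\<^sup>2)"
    unfolding frame_inner[of x x] by (intro sum.cong) (auto simp: power2_eq_square)
  hence "- of_real (pi * t * (x \<bullet> x)) - of_real (2 * pi * t) * complex_inner p r x
     = (\<Sum>s\<in>S. - of_real (pi * t * (s \<bullet> s) * (x \<bullet> s / (s \<bullet> s))\<^sup>2) - of_real (2 * pi * t * (x \<bullet> s / (s \<bullet> s))) * complex_inner p r s)"
    unfolding frame_complex_inner[of p r x] by (simp add: sum_distrib_left sum_subtractf sum_negf mult.assoc)
  thus ?thesis
    unfolding theta_term_def x_def[symmetric] by (simp add: exp_sum finite_frame xs cong: prod.cong)
qed

lemma dual_term_codual:
  "dual_term t p r (codual k) * cis (2 * pi * (codual k \<bullet> c)) = (\<Prod>s\<in>S. exp (- of_real (pi * (of_int (k s))\<^sup>2 / (t * (s \<bullet> s)))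
      + of_real (2 * pi * of_int (k s) / (s \<bullet> s)) * (\<i> * complex_inner p r s) + of_real (2 * pi * of_int (k s) * (c \<bullet> s / (s \<bullet> s))) * \<i>))"
proof -
  define x where "x = codual k"
  have xs: "x \<bullet> s = of_int (k s)" if "s \<in> S" for s using that by (simp add: x_def codual_inner)
  have "x \<bullet> x = (\<Sum>s\<in>S. (of_int (k s))\<^sup>2 / (s \<bullet> s))"
    unfolding frame_inner[of x x] by (intro sum.cong) (auto simp: power2_eq_square xs)
  hence 1: "- of_real (pi * (x \<bullet> x) / t) = (\<Sum>s\<in>S. - complex_of_real (pi * (of_int (k s))\<^sup>2 / (t * (s \<bullet> s))))"
    by (simp add: sum_distrib_left sum_divide_distrib sum_negf mult.commute)
  have 2: "of_real (2 * pi) * (\<i> * complex_inner p r x) = (\<Sum>s\<in>S. of_real (2 * pi * of_int (k s) / (s \<bullet> s)) * (\<i> * complex_inner p r s))"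
    unfolding frame_complex_inner[of p r x] sum_distrib_left by (intro sum.cong) (auto simp: xs)
  have 3: "\<i> * of_real (2 * pi * (x \<bullet> c)) = (\<Sum>s\<in>S. of_real (2 * pi * of_int (k s) * (c \<bullet> s / (s \<bullet> s))) * \<i>)"
    unfolding frame_inner[of x c] sum_distrib_left of_real_sum by (intro sum.cong) (auto simp: xs)
  show ?thesis
    unfolding dual_term_def x_def[symmetric] cis_conv_exp mult_exp_exp exp_sum[OF finite_frame, symmetric] sum.distrib 1 2 3 ..
qed

text \<open>A coset is a shifted product of one-dimensional lattices, so the formula is the product
  over S of \<open>poisson_gaussian_complex\<close>. The exponents left over from completing the
  squares add up to a multiple of the isotropic sum, hence to 0.\<close>

lemma poisson_coset:
  assumes iso: "p \<bullet> p = r \<bullet> r" "p \<bullet> r = 0"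
  shows "(\<Sum>\<^sub>\<infinity>n\<in>PiE S (\<lambda>_. UNIV). theta_term t p r (frame_shift (c, n))) =
     (\<Prod>s\<in>S. 1 / of_real (sqrt (t * (s \<bullet> s)))) * (\<Sum>\<^sub>\<infinity>k\<in>PiE S (\<lambda>_. UNIV). dual_term t p r (codual k) * cis (2 * pi * (codual k \<bullet> c)))"
proof -
  define w where "w s = complex_inner p r s" for s
  define \<gamma> where "\<gamma> s = c \<bullet> s / (s \<bullet> s)" for s
  define f where "f s n = exp (- of_real (pi * t * (s \<bullet> s) * (of_int n + \<gamma> s)\<^sup>2) - of_real (2 * pi * t * (of_int n + \<gamma> s)) * w s)" for s and n :: int
  define g where "g s k = exp (- of_real (pi * (of_int k)\<^sup>2 / (t * (s \<bullet> s))) + of_real (2 * pi * of_int k / (s \<bullet> s)) * (\<i> * w s) + of_real (2 * pi * of_int k * \<gamma> s) * \<i>)" for s and k :: int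
  have fs: "(\<lambda>n. norm (f s n)) summable_on UNIV" if s: "s \<in> S" for s
  proof -
    have "(\<lambda>n::int. exp (- (pi * t * (s \<bullet> s)) * (of_int n + (\<gamma> s + Re (w s) / (s \<bullet> s)))\<^sup>2) * exp (pi * t * (Re (w s))\<^sup>2 / (s \<bullet> s))) summable_on UNIV"
      using frame_pos[OF s] t by (intro summable_on_cmult_left summable_shifted_gaussian_int) auto
    moreover have "norm (f s n) = exp (- (pi * t * (s \<bullet> s)) * (of_int n + (\<gamma> s + Re (w s) / (s \<bullet> s)))\<^sup>2) * exp (pi * t * (Re (w s))\<^sup>2 / (s \<bullet> s))" for n :: int
      unfolding f_def norm_exp_eq_Re mult_exp_exp
      by (rule arg_cong[of _ _ exp]) (use frame_pos[OF s] in \<open>simp add: power2_eq_square field_simps\<close>)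
    ultimately show ?thesis by simp
  qed
  have gs: "(\<lambda>n. norm (g s n)) summable_on UNIV" if s: "s \<in> S" for s
  proof -
    have "(\<lambda>n::int. exp (- (pi / (t * (s \<bullet> s))) * (of_int n + t * Im (w s))\<^sup>2) * exp (pi * t * (Im (w s))\<^sup>2 / (s \<bullet> s))) summable_on UNIV"
      using frame_pos[OF s] t by (intro summable_on_cmult_left summable_shifted_gaussian_int) auto
    moreover have "norm (g s n) = exp (- (pi / (t * (s \<bullet> s))) * (of_int n + t * Im (w s))\<^sup>2) * exp (pi * t * (Im (w s))\<^sup>2 / (s \<bullet> s))" for n :: int
      unfolding g_def norm_exp_eq_Re mult_exp_exp
      by (rule arg_cong[of _ _ exp]) (use frame_pos[OF s] t in \<open>simp add: power2_eq_square field_simps\<close>)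
    ultimately show ?thesis by simp
  qed
  have fg: "infsum (f s) UNIV = exp (of_real (pi * t / (s \<bullet> s)) * (w s)\<^sup>2) * (1 / of_real (sqrt (t * (s \<bullet> s)))) * infsum (g s) UNIV" if "s \<in> S" for s
    unfolding f_def g_def using poisson_gaussian_complex[OF frame_pos[OF that] t, of "\<gamma> s" "w s"] by simp
  have one: "(\<Prod>s\<in>S. exp (of_real (pi * t / (s \<bullet> s)) * (w s)\<^sup>2)) = 1"
  proof -
    have "(\<Sum>s\<in>S. of_real (pi * t / (s \<bullet> s)) * (w s)\<^sup>2) = of_real (pi * t) * (\<Sum>s\<in>S. (w s)\<^sup>2 / of_real (s \<bullet> s))"
      by (simp add: sum_distrib_left)
    also have "\<dots> = 0" using frame_complex_isotropic[OF iso] by (simp add: w_def)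
    finally show ?thesis by (simp flip: exp_sum[OF finite_frame])
  qed
  have "(\<Sum>\<^sub>\<infinity>n\<in>PiE S (\<lambda>_. UNIV). theta_term t p r (frame_shift (c, n))) = (\<Sum>\<^sub>\<infinity>n\<in>PiE S (\<lambda>_. UNIV). \<Prod>s\<in>S. f s (n s))"
    by (simp add: theta_term_shift f_def w_def \<gamma>_def)
  also have "\<dots> = (\<Prod>s\<in>S. infsum (f s) UNIV)"
    by (rule infsum_prod_PiE_abs[OF finite_frame fs])
  also have "\<dots> = (\<Prod>s\<in>S. 1 / of_real (sqrt (t * (s \<bullet> s)))) * (\<Prod>s\<in>S. infsum (g s) UNIV)"
    using one by (simp add: fg prod.distrib prod_dividef cong: prod.cong)
  also have "(\<Prod>s\<in>S. infsum (g s) UNIV) = (\<Sum>\<^sub>\<infinity>n\<in>PiE S (\<lambda>_. UNIV). \<Prod>s\<in>S. g s (n s))"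
    by (rule infsum_prod_PiE_abs[OF finite_frame gs, symmetric])
  also have "\<dots> = (\<Sum>\<^sub>\<infinity>k\<in>PiE S (\<lambda>_. UNIV). dual_term t p r (codual k) * cis (2 * pi * (codual k \<bullet> c)))"
    by (simp add: dual_term_codual g_def w_def \<gamma>_def)
  finally show ?thesis .
qed

end

end

lemma summable_gaussian_lattice: "c > 0 \<Longrightarrow> (\<lambda>x. exp (- c * (x \<bullet> x) + d * norm x)) summable_on L"
  using orthogonal_frame_exists summable_gaussian_lattice_frame by blast

end

lemma infsum_finite_sum:
  fixes f :: "'a \<Rightarrow> 'b \<Rightarrow> 'c::banach"
  assumes "finite R" "\<And>c. c \<in> R \<Longrightarrow> f c summable_on P"
  shows "(\<lambda>k. \<Sum>c\<in>R. f c k) summable_on P \<and> (\<Sum>\<^sub>\<infinity>k\<in>P. \<Sum>c\<in>R. f c k) = (\<Sum>c\<in>R. infsum (f c) P)"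
  using assms
proof (induction R rule: finite_induct)
  case (insert x F)
  thus ?case by (simp add: summable_on_add infsum_add)
qed simp

context unimodular
begin

lemma summable_exp_linear:
  assumes "a > 0"
  shows "(\<lambda>x. exp (- complex_of_real (a * (x \<bullet> x)) + c * complex_inner p r x)) summable_on L" (is "?f summable_on L")
    and "(\<lambda>x. norm (exp (- complex_of_real (a * (x \<bullet> x)) + c * complex_inner p r x))) summable_on L"
proof -
  show *: "(\<lambda>x. norm (exp (- complex_of_real (a * (x \<bullet> x)) + c * complex_inner p r x))) summable_on L"
  proof (rule summable_on_comparison_test[OF summable_gaussian_lattice[OF assms]])
    fix x
    have "Re (c * complex_inner p r x) \<le> norm (c * complex_inner p r x)" by (rule complex_Re_le_cmod)
    also have "\<dots> \<le> norm c * (\<bar>p \<bullet> x\<bar> + \<bar>r \<bullet> x\<bar>)"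
      unfolding norm_mult using cmod_le[of "complex_inner p r x"] by (intro mult_left_mono) (auto simp: complex_inner_def)
    also have "\<dots> \<le> norm c * (norm p * norm x + norm r * norm x)"
      by (intro mult_left_mono add_mono Cauchy_Schwarz_ineq2) auto
    also have "\<dots> = norm c * (norm p + norm r) * norm x" by (simp add: algebra_simps)
    finally show "norm (exp (- complex_of_real (a * (x \<bullet> x)) + c * complex_inner p r x)) \<le> exp (- a * (x \<bullet> x) + norm c * (norm p + norm r) * norm x)"
      by simp
  qed auto
  thus "?f summable_on L" by (rule abs_summable_summable)
qed

text \<open>Adding up the cosets and exchanging the sums produces the character sums, which keep
  precisely the codual vectors in L. The number of residues and the lengths of the frame are
  collected in one constant K that does not depend on t, p, r.\<close>

lemma poisson_lattice_frame:
  assumes S: "orthogonal_frame S"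
  obtains K :: real where "\<And>t p r. t > 0 \<Longrightarrow> p \<bullet> p = r \<bullet> r \<Longrightarrow> p \<bullet> r = 0 \<Longrightarrow>
     (\<Sum>\<^sub>\<infinity>x\<in>L. exp (- of_real (pi * t * (x \<bullet> x)) - of_real (2 * pi * t) * complex_inner p r x)) =
     of_real (K / sqrt t ^ card S) * (\<Sum>\<^sub>\<infinity>x\<in>L. exp (- of_real (pi * (x \<bullet> x) / t) + of_real (2 * pi) * (\<i> * complex_inner p r x)))"
proof (rule that)
  fix t :: real and p r :: "real^'n"
  assume t: "t > 0" and iso: "p \<bullet> p = r \<bullet> r" "p \<bullet> r = 0"
  let ?P = "PiE S (\<lambda>_. UNIV :: int set)"
  let ?R = "frame_residues S"
  define A :: complex where "A = (\<Prod>s\<in>S. 1 / of_real (sqrt (t * (s \<bullet> s))))"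
  define T where "T = theta_term t p r"
  define D where "D = dual_term t p r"
  have sT: "T summable_on L"
    using summable_exp_linear(1)[of "pi * t" "- of_real (2 * pi * t)" p r] t
    by (simp add: T_def theta_term_def[abs_def])
  have sD: "D summable_on L" "(\<lambda>x. norm (D x)) summable_on L"
    using summable_exp_linear[of "pi / t" "of_real (2 * pi) * \<i>" p r] t
    by (simp_all add: D_def dual_term_def[abs_def] mult.assoc)
  have sP: "(\<lambda>k. D (codual S k) * cis (2 * pi * (codual S k \<bullet> c))) summable_on ?P" for c
  proof -
    define w where "w s = complex_inner p r s" for s
    have "(\<lambda>g. \<Prod>s\<in>S. exp (- (pi / (t * (s \<bullet> s))) * (of_int (g s) + t * Im (w s))\<^sup>2)) summable_on ?P"
    proof -
      have "Infinite_Set_Sum.abs_summable_on (\<lambda>n::int. exp (- (pi / (t * (s \<bullet> s))) * (of_int n + t * Im (w s))\<^sup>2)) UNIV" if "s \<in> S" for s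
        unfolding abs_summable_equivalent[symmetric] norm_exp real_norm_def abs_exp_cancel
        using frame_pos[OF S that] t by (intro summable_shifted_gaussian_int) auto
      from abs_summable_on_prod_PiE[OF finite_frame[OF S] _ this]
      show ?thesis unfolding abs_summable_equivalent[symmetric] by (rule abs_summable_summable) auto
    qed
    hence "(\<lambda>g. (\<Prod>s\<in>S. exp (- (pi / (t * (s \<bullet> s))) * (of_int (g s) + t * Im (w s))\<^sup>2)) * (\<Prod>s\<in>S. exp (pi * t * (Im (w s))\<^sup>2 / (s \<bullet> s)))) summable_on ?P"
      by (rule summable_on_cmult_left)
    moreover have "norm (D (codual S k) * cis (2 * pi * (codual S k \<bullet> c))) = (\<Prod>s\<in>S. exp (- (pi / (t * (s \<bullet> s))) * (of_int (k s) + t * Im (w s))\<^sup>2)) * (\<Prod>s\<in>S. exp (pi * t * (Im (w s))\<^sup>2 / (s \<bullet> s)))" for k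
      unfolding D_def dual_term_codual[OF S t] prod_norm[symmetric] norm_exp_eq_Re prod.distrib[symmetric] mult_exp_exp
      by (intro prod.cong refl arg_cong[of _ _ exp]) (use frame_pos[OF S] t in \<open>simp add: w_def power2_eq_square field_simps\<close>)
    ultimately have "(\<lambda>k. norm (D (codual S k) * cis (2 * pi * (codual S k \<bullet> c)))) summable_on ?P" by simp
    thus ?thesis by (rule abs_summable_summable)
  qed
  have "infsum T L = infsum (\<lambda>x. T (frame_shift S x)) (?R \<times> ?P)"
    using infsum_reindex_bij_betw[OF bij_betw_frame_shift[OF S], of T] by simp
  also have "\<dots> = (\<Sum>\<^sub>\<infinity>c\<in>?R. \<Sum>\<^sub>\<infinity>n\<in>?P. T (frame_shift S (c, n)))"
    using summable_on_reindex_bij_betw[OF bij_betw_frame_shift[OF S], of T] sT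
    by (intro infsum_Sigma_banach[symmetric]) auto
  also have "\<dots> = (\<Sum>c\<in>?R. A * (\<Sum>\<^sub>\<infinity>k\<in>?P. D (codual S k) * cis (2 * pi * (codual S k \<bullet> c))))"
    unfolding T_def D_def A_def poisson_coset[OF S t iso] by (rule infsum_finite[OF finite_frame_residues[OF S]])
  also have "\<dots> = A * (\<Sum>c\<in>?R. \<Sum>\<^sub>\<infinity>k\<in>?P. D (codual S k) * cis (2 * pi * (codual S k \<bullet> c)))"
    by (rule sum_distrib_left[symmetric])
  also have "\<dots> = A * (\<Sum>\<^sub>\<infinity>k\<in>?P. \<Sum>c\<in>?R. D (codual S k) * cis (2 * pi * (codual S k \<bullet> c)))"
    using infsum_finite_sum[of ?R "\<lambda>c k. D (codual S k) * cis (2 * pi * (codual S k \<bullet> c))" ?P,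
        OF finite_frame_residues[OF S] sP] by (simp only:)
  also have "(\<Sum>\<^sub>\<infinity>k\<in>?P. \<Sum>c\<in>?R. D (codual S k) * cis (2 * pi * (codual S k \<bullet> c)))
     = (\<Sum>\<^sub>\<infinity>k\<in>?P. if codual S k \<in> L then D (codual S k) * of_nat (card ?R) else 0)"
    unfolding sum_distrib_left[symmetric] by (intro infsum_cong) (simp add: character_sum[OF S])
  also have "\<dots> = (\<Sum>\<^sub>\<infinity>k\<in>{k \<in> ?P. codual S k \<in> L}. D (codual S k) * of_nat (card ?R))"
    by (rule infsum_cong_neutral) auto
  also have "\<dots> = infsum D L * of_nat (card ?R)"
    using infsum_reindex_bij_betw[OF bij_betw_codual[OF S], of "\<lambda>x. D x * of_nat (card ?R)"]
    by (simp add: infsum_cmult_left')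
  also have "A * (infsum D L * of_nat (card ?R)) = of_real ((real (card ?R) * (\<Prod>s\<in>S. 1 / sqrt (s \<bullet> s))) / sqrt t ^ card S) * infsum D L"
  proof -
    have "A = of_real ((\<Prod>s\<in>S. 1 / sqrt (s \<bullet> s)) / sqrt t ^ card S)"
      unfolding A_def by (simp add: real_sqrt_mult prod_dividef prod.distrib mult.commute)
    thus ?thesis by simp
  qed
  finally show "(\<Sum>\<^sub>\<infinity>x\<in>L. exp (- of_real (pi * t * (x \<bullet> x)) - of_real (2 * pi * t) * complex_inner p r x)) =
     of_real ((real (card ?R) * (\<Prod>s\<in>S. 1 / sqrt (s \<bullet> s))) / sqrt t ^ card S) *
     (\<Sum>\<^sub>\<infinity>x\<in>L. exp (- of_real (pi * (x \<bullet> x) / t) + of_real (2 * pi) * (\<i> * complex_inner p r x)))"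
    by (simp add: T_def D_def theta_term_def[abs_def] dual_term_def[abs_def])
qed

theorem poisson_lattice:
  assumes "t > 0" "p \<bullet> p = r \<bullet> r" "p \<bullet> r = 0"
  shows "(\<Sum>\<^sub>\<infinity>x\<in>L. exp (- of_real (pi * t * (x \<bullet> x)) - of_real (2 * pi * t) * complex_inner p r x)) =
     of_real (1 / sqrt t ^ CARD('n)) * (\<Sum>\<^sub>\<infinity>x\<in>L. exp (- of_real (pi * (x \<bullet> x) / t) + of_real (2 * pi) * (\<i> * complex_inner p r x)))"
proof -
  obtain S where S: "orthogonal_frame S" using orthogonal_frame_exists by blast
  from S have "independent S" "span S = UNIV"
    using pairwise_orthogonal_independent[of S] by (auto simp: orthogonal_frame_def)
  hence card: "card S = CARD('n)" using dim_eq_card[of S S] dim_UNIV[where 'a = "real^'n"] by (metis DIM_cart DIM_real dim_span mult_1_right dim_eq_card_independent)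
  obtain K where K: "\<And>t p r. t > 0 \<Longrightarrow> p \<bullet> p = r \<bullet> r \<Longrightarrow> p \<bullet> r = 0 \<Longrightarrow>
     (\<Sum>\<^sub>\<infinity>x\<in>L. exp (- of_real (pi * t * (x \<bullet> x)) - of_real (2 * pi * t) * complex_inner p r x)) =
     of_real (K / sqrt t ^ card S) * (\<Sum>\<^sub>\<infinity>x\<in>L. exp (- of_real (pi * (x \<bullet> x) / t) + of_real (2 * pi) * (\<i> * complex_inner p r x)))"
    using poisson_lattice_frame[OF S] by blast
  define Q where "Q = (\<Sum>\<^sub>\<infinity>x\<in>L. exp (- (pi * (x \<bullet> x))))"
  have z: "complex_inner 0 0 x = 0" for x :: "real^'n" by (simp add: complex_inner_def complex_eq_iff)
  have sQ: "(\<lambda>x. exp (- (pi * (x \<bullet> x)))) summable_on L"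
    using summable_gaussian_lattice[of pi 0] by simp
  have Q: "(\<Sum>\<^sub>\<infinity>x\<in>L. exp (- complex_of_real (pi * (x \<bullet> x)))) = of_real Q"
  proof (rule infsumI)
    have "complex_of_real (exp (- (pi * (x \<bullet> x)))) = exp (- complex_of_real (pi * (x \<bullet> x)))" for x :: "real^'n"
      by (simp flip: exp_of_real)
    moreover have "((\<lambda>x. complex_of_real (exp (- (pi * (x \<bullet> x))))) has_sum of_real Q) L"
      unfolding has_sum_of_real_iff Q_def by (rule has_sum_infsum[OF sQ])
    ultimately show "((\<lambda>x. exp (- complex_of_real (pi * (x \<bullet> x)))) has_sum of_real Q) L" by (simp only:)
  qed
  \<comment> \<open>At t = 1 and p = r = 0 both sides are the same positive sum Q, which forces K =
    1 without any computation of the index of the frame.\<close>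
  have "of_real Q = of_real K * complex_of_real Q" using K[of 1 0 0] Q by (simp add: z)
  moreover have "Q > 0"
  proof -
    have "(\<Sum>\<^sub>\<infinity>x\<in>{0::real^'n}. exp (- (pi * (x \<bullet> x)))) \<le> Q"
      unfolding Q_def by (rule infsum_mono_neutral) (use sQ in auto)
    thus ?thesis by simp
  qed
  ultimately have "K = 1" by (simp flip: of_real_mult)
  thus ?thesis using K[OF assms] card by simp
qed

end

subsection \<open>Vanishing of cusp forms of small weight\<close>

lemma arctan_bounds:
  assumes "x \<ge> 0"
  shows "x - x ^ 3 / 3 \<le> arctan x" "arctan x \<le> x"
proof -
  have d: "((\<lambda>x. arctan x - (x - x ^ 3 / 3)) has_real_derivative inverse (1 + y\<^sup>2) - (1 - y\<^sup>2)) (at y)" for y :: real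
    by (auto intro!: derivative_eq_intros)
  have "arctan 0 - (0 - 0 ^ 3 / 3) \<le> arctan x - (x - x ^ 3 / 3)"
  proof (rule DERIV_nonneg_imp_nondecreasing[OF assms], intro exI conjI)
    fix y :: real
    show "((\<lambda>x. arctan x - (x - x ^ 3 / 3)) has_real_derivative inverse (1 + y\<^sup>2) - (1 - y\<^sup>2)) (at y)" by (rule d)
    have "(1 - y\<^sup>2) * (1 + y\<^sup>2) \<le> 1" by (simp add: algebra_simps)
    moreover have "0 < 1 + y\<^sup>2" by (simp add: add_pos_nonneg)
    ultimately have "1 - y\<^sup>2 \<le> 1 / (1 + y\<^sup>2)" by (subst pos_le_divide_eq)
    thus "0 \<le> inverse (1 + y\<^sup>2) - (1 - y\<^sup>2)" by (simp add: inverse_eq_divide)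
  qed
  thus "x - x ^ 3 / 3 \<le> arctan x" by simp
  have "0 - arctan 0 \<le> x - arctan x"
  proof (rule DERIV_nonneg_imp_nondecreasing[OF assms, where f = "\<lambda>x. x - arctan x"], intro exI conjI)
    fix y :: real
    show "((\<lambda>x. x - arctan x) has_real_derivative 1 - inverse (1 + y\<^sup>2)) (at y)"
      by (auto intro!: derivative_eq_intros)
    show "0 \<le> 1 - inverse (1 + y\<^sup>2)" by (simp add: field_simps add_pos_nonneg)
  qed
  thus "arctan x \<le> x" by simp
qed

text \<open>Euler's formula pi/4 = 5 arctan (1/7) + 2 arctan (3/79), with the arctangent bounded by
  its first two Taylor polynomials.\<close>

lemma pi_bounds: "3.1413 \<le> pi" "pi \<le> 3.17"
  using arctan_bounds[of "1/7"] arctan_bounds[of "3/79"] machin_Euler by (simp_all add: power3_eq_cube)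

text \<open>This number is 1/|q| on the line Im \<tau> = 3/4. Low-order exponential bounds are
  accurate enough at a sixteenth and at a sixty-fourth of the exponent; the results are then raised
  to these powers.\<close>

lemma exp_bounds: "105 \<le> exp (3 * pi / 2)" "exp (3 * pi / 2) \<le> 145"
proof -
  define a where "a = 3 * pi / 32"
  have "(1 + a + a\<^sup>2 / 2) \<le> exp a" by (rule exp_lower_Taylor_quadratic) (simp add: a_def)
  moreover have a: "0.29449 \<le> a" using pi_bounds by (simp add: a_def)
  have "(0.29449::real)\<^sup>2 \<le> a\<^sup>2" using a by (intro power_mono) auto
  ultimately have "1.33785 \<le> exp a" using a by (simp add: power2_eq_square)
  hence "(1.33785::real) ^ 16 \<le> exp a ^ 16" by (intro power_mono) auto
  also have "exp a ^ 16 = exp (3 * pi / 2)" by (simp add: a_def flip: exp_of_nat_mult)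
  finally show "105 \<le> exp (3 * pi / 2)" by (rule order.trans[rotated]) (simp add: power_divide)
  define b where "b = 3 * pi / 128"
  have b: "0 \<le> b" "b \<le> 0.0743" using pi_bounds by (simp_all add: b_def)
  have "exp b \<le> 1 + b + b\<^sup>2" using b by (intro exp_bound) auto
  also have "b\<^sup>2 \<le> 0.0743\<^sup>2" using b by (intro power_mono) auto
  finally have "exp b \<le> 1.07983" using b by (simp add: power2_eq_square)
  hence "exp b ^ 64 \<le> 1.07983 ^ 64" by (intro power_mono) auto
  also have "exp b ^ 64 = exp (3 * pi / 2)" by (simp add: b_def flip: exp_of_nat_mult)
  finally show "exp (3 * pi / 2) \<le> 145" by (rule order.trans) (simp add: power_divide)
qed

text \<open>On a subinterval \<rho> is replaced by its largest value \<sigma>. This is legitimate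
  because the right-hand side decreases for \<rho> below 3 pi / 11, which exceeds 0.85. The other
  parameters are numerical bounds: c for -ln \<sigma>, C for the cosine D, and W for the second
  exponential relative to the first.\<close>

lemma siegel_inequality_case:
  fixes \<rho> \<sigma> c C W :: real
  assumes \<rho>: "0 < \<rho>" "\<rho> \<le> \<sigma>" "\<sigma> \<le> 0.85" and c: "1 / \<sigma> \<le> exp c"
    and W: "exp (- (3 * pi / 2 * (1 / \<sigma> - 1))) \<le> W"
    and C: "D \<le> C"
    and main: "40 * (C + W) * exp (- (3 * pi / 2)) < 3 * pi * (1 / \<sigma> - 1) - 11 * c"
  shows "40 * D * exp (- (3 * pi / 2)) + 40 * exp (- (3 * pi / (2 * \<rho>))) < 11 * ln \<rho> + 3 * pi * (1 / \<rho> - 1)"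
proof -
  have \<sigma>: "\<sigma> > 0" using \<rho> by linarith
  have "exp (- (3 * pi / (2 * \<rho>))) \<le> exp (- (3 * pi / (2 * \<sigma>)))"
    using \<rho> \<sigma> by (simp add: frac_le)
  also have "\<dots> = exp (- (3 * pi / 2 * (1 / \<sigma> - 1))) * exp (- (3 * pi / 2))"
    using \<sigma> by (simp add: field_simps flip: exp_add)
  also have "\<dots> \<le> W * exp (- (3 * pi / 2))" using W by simp
  finally have 1: "exp (- (3 * pi / (2 * \<rho>))) \<le> W * exp (- (3 * pi / 2))" .
  have 2: "D * exp (- (3 * pi / 2)) \<le> C * exp (- (3 * pi / 2))" using C by simp
  have "ln (1 / \<sigma>) \<le> ln (exp c)" using c \<sigma> by (subst ln_le_cancel_iff) auto
  hence 3: "- c \<le> ln \<sigma>" using \<sigma> by (simp add: ln_div)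
  have "ln (\<sigma> / \<rho>) \<le> \<sigma> / \<rho> - 1" using \<rho> \<sigma> by (intro ln_le_minus_one) auto
  hence 4: "ln \<sigma> + 1 - \<sigma> / \<rho> \<le> ln \<rho>" using \<rho> \<sigma> by (simp add: ln_div)
  have "0 \<le> (1 / \<rho> - 1 / \<sigma>) * (3 * pi - 11 * \<sigma>)"
    using \<rho> \<sigma> pi_bounds by (intro mult_nonneg_nonneg) (auto simp: frac_le)
  also have "\<dots> = 11 * (1 - \<sigma> / \<rho>) + 3 * pi * (1 / \<rho> - 1) - 3 * pi * (1 / \<sigma> - 1)"
    using \<rho> \<sigma> by (simp add: field_simps)
  finally have 5: "3 * pi * (1 / \<sigma> - 1) \<le> 11 * (1 - \<sigma> / \<rho>) + 3 * pi * (1 / \<rho> - 1)" by simp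
  have "40 * (C + W) * exp (- (3 * pi / 2)) = 40 * (C * exp (- (3 * pi / 2))) + 40 * (W * exp (- (3 * pi / 2)))"
    by (simp add: algebra_simps)
  moreover have "40 * D * exp (- (3 * pi / 2)) = 40 * (D * exp (- (3 * pi / 2)))" by simp
  moreover have "11 * (1 - \<sigma> / \<rho>) = 11 - 11 * (\<sigma> / \<rho>)" by simp
  ultimately show ?thesis using 1 2 3 4 5 main by linarith
qed

lemma exp_minus_le:
  assumes "0 \<le> v" "v \<le> (u::real)"
  shows "exp (- u) \<le> 1 / (1 + v + v\<^sup>2 / 2)"
proof -
  have p: "0 < 1 + v + v\<^sup>2 / 2" using assms by (intro add_pos_nonneg) auto
  have "1 + v + v\<^sup>2 / 2 \<le> exp v" by (rule exp_lower_Taylor_quadratic[OF assms(1)])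
  also have "\<dots> \<le> exp u" using assms by simp
  finally show ?thesis using p by (simp add: exp_minus field_simps)
qed

text \<open>Here \<rho> is the squared modulus of \<tau> = x + 3i/4. The left-hand side bounds 40
  (Re q - Re q') for the images q, q' of \<tau> and -1/\<tau>; on the right, 11 ln \<rho> is the
  logarithm of the factor of weight 22 and the other term comes from the division by
  \<open>q\<^sup>2\<close>.\<close>

lemma siegel_inequality:
  fixes x :: real
  assumes x: "\<bar>x\<bar> \<le> 1/2" and \<rho>: "\<rho> = x\<^sup>2 + 9/16"
  shows "40 * cos (2 * pi * x) * exp (- (3 * pi / 2)) + 40 * exp (- (3 * pi / (2 * \<rho>))) < 11 * ln \<rho> + 3 * pi * (1 / \<rho> - 1)"
proof -
  define E where "E = exp (- (3 * pi / 2))"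
  have E: "1 / 145 \<le> E" "E \<le> 1 / 105"
    using exp_bounds unfolding E_def exp_minus by (auto simp: field_simps)
  have \<rho>0: "\<rho> > 0" using \<rho> by (simp add: add_nonneg_pos)
  have \<rho>le: "\<rho> \<le> y\<^sup>2 + 9/16" if "\<bar>x\<bar> \<le> y" for y using that power_mono[of "\<bar>x\<bar>" y 2] by (simp add: \<rho>)
  have cosle: "cos (2 * pi * x) \<le> cos (2 * pi * y)" if "0 \<le> y" "y \<le> \<bar>x\<bar>" for y
  proof -
    have "cos (2 * pi * x) = cos (2 * pi * \<bar>x\<bar>)" using cos_abs_real[of "2 * pi * x"] by (simp add: abs_mult)
    also have "\<dots> \<le> cos (2 * pi * y)" using that x by (intro cos_monotone_0_pi_le) auto
    finally show ?thesis .
  qed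
  have ex: "y \<le> exp c" if "0 \<le> c" "y \<le> 1 + c + c\<^sup>2 / 2" for y c :: real
    using exp_lower_Taylor_quadratic[OF that(1)] that(2) by linarith
  \<comment> \<open>On each interval \<sigma> is the value of \<rho> at the right end and C is the
    cosine, rounded up, at the left end. A single interval would not do: where \<rho> is close to 1
    the gain on the right is small, and the negative cosine has to help.\<close>
  consider "\<bar>x\<bar> \<le> 1/4" | "1/4 \<le> \<bar>x\<bar>" "\<bar>x\<bar> \<le> 1/3" | "1/3 \<le> \<bar>x\<bar>" "\<bar>x\<bar> \<le> 5/12" | "5/12 \<le> \<bar>x\<bar>"
    by linarith
  thus ?thesis
  proof cases
    case 1
    show ?thesis
    proof (rule siegel_inequality_case[where \<sigma> = "5/8" and c = "0.4742" and C = 1 and W = "0.13"])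
      show "\<rho> \<le> 5/8" using \<rho>le[OF 1] by (simp add: power2_eq_square)
      \<comment> \<open>The quadratic bound at 0.4742 itself falls short of 8/5, so it is applied to
        half the exponent and squared.\<close>
      have "(8/5::real) \<le> (exp 0.2371)\<^sup>2"
      proof -
        have "(1.2652::real) \<le> exp 0.2371" by (rule ex) (auto simp: power2_eq_square)
        hence "(1.2652::real)\<^sup>2 \<le> (exp 0.2371)\<^sup>2" by (intro power_mono) auto
        thus ?thesis by (simp add: power2_eq_square)
      qed
      also have "(exp 0.2371)\<^sup>2 = exp (0.4742::real)" by (simp flip: exp_of_nat_mult)
      finally show "1 / (5/8) \<le> exp (0.4742::real)" by simp
      have "exp (- (3 * pi / 2 * (1 / (5/8) - 1))) \<le> 1 / (1 + 2.8 + 2.8\<^sup>2 / 2)"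
        by (rule exp_minus_le) (use pi_bounds in auto)
      thus "exp (- (3 * pi / 2 * (1 / (5/8) - 1))) \<le> 0.13" by (simp add: power2_eq_square)
      show "40 * (1 + 0.13) * exp (- (3 * pi / 2)) < 3 * pi * (1 / (5/8) - 1) - 11 * 0.4742"
        using E pi_bounds unfolding E_def by simp
    qed (use \<rho>0 in auto)
  next
    case 2
    show ?thesis
    proof (rule siegel_inequality_case[where \<sigma> = "97/144" and c = "0.4085" and C = 0 and W = "0.18"])
      show "\<rho> \<le> 97/144" using \<rho>le[OF 2(2)] by (simp add: power2_eq_square)
      show "1 / (97/144) \<le> exp (0.4085::real)" by (rule ex) (auto simp: power2_eq_square)
      have "exp (- (3 * pi / 2 * (1 / (97/144) - 1))) \<le> 1 / (1 + 2.2 + 2.2\<^sup>2 / 2)"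
        by (rule exp_minus_le) (use pi_bounds in auto)
      thus "exp (- (3 * pi / 2 * (1 / (97/144) - 1))) \<le> 0.18" by (simp add: power2_eq_square)
      show "cos (2 * pi * x) \<le> 0" using cosle[OF _ 2(1)] cos_pi_half by simp
      show "40 * (0 + 0.18) * exp (- (3 * pi / 2)) < 3 * pi * (1 / (97/144) - 1) - 11 * 0.4085"
        using E pi_bounds unfolding E_def by simp
    qed (use \<rho>0 in auto)
  next
    case 3
    show ?thesis
    proof (rule siegel_inequality_case[where \<sigma> = "53/72" and c = "0.312" and C = "-0.5" and W = "0.25"])
      show "\<rho> \<le> 53/72" using \<rho>le[OF 3(2)] by (simp add: power2_eq_square)
      show "1 / (53/72) \<le> exp (0.312::real)" by (rule ex) (auto simp: power2_eq_square)
      have "exp (- (3 * pi / 2 * (1 / (53/72) - 1))) \<le> 1 / (1 + 1.68 + 1.68\<^sup>2 / 2)"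
        by (rule exp_minus_le) (use pi_bounds in auto)
      thus "exp (- (3 * pi / 2 * (1 / (53/72) - 1))) \<le> 0.25" by (simp add: power2_eq_square)
      have "cos (2 * pi * (1/3)) = - cos (pi / 3)"
        using cos_pi_minus[of "pi / 3"] by (simp add: field_simps)
      thus "cos (2 * pi * x) \<le> -0.5" using cosle[OF _ 3(1)] cos_60 by simp
      show "40 * (-0.5 + 0.25) * exp (- (3 * pi / 2)) < 3 * pi * (1 / (53/72) - 1) - 11 * 0.312"
        using E pi_bounds unfolding E_def by simp
    qed (use \<rho>0 in auto)
  next
    case 4
    show ?thesis
    proof (rule siegel_inequality_case[where \<sigma> = "13/16" and c = "0.2098" and C = "-0.866" and W = "0.38"])
      show "\<rho> \<le> 13/16" using \<rho>le[OF x] by (simp add: power2_eq_square)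
      show "1 / (13/16) \<le> exp (0.2098::real)" by (rule ex) (auto simp: power2_eq_square)
      have "exp (- (3 * pi / 2 * (1 / (13/16) - 1))) \<le> 1 / (1 + 1.08 + 1.08\<^sup>2 / 2)"
        by (rule exp_minus_le) (use pi_bounds in auto)
      thus "exp (- (3 * pi / 2 * (1 / (13/16) - 1))) \<le> 0.38" by (simp add: power2_eq_square)
      have "cos (2 * pi * (5/12)) = - cos (pi / 6)"
        using cos_pi_minus[of "pi / 6"] by (simp add: field_simps)
      moreover have "1.732 \<le> sqrt 3" by (rule real_le_rsqrt) (simp add: power2_eq_square)
      ultimately show "cos (2 * pi * x) \<le> -0.866" using cosle[OF _ 4] cos_30 by simp
      show "40 * (-0.866 + 0.38) * exp (- (3 * pi / 2)) < 3 * pi * (1 / (13/16) - 1) - 11 * 0.2098"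
        using E pi_bounds unfolding E_def by simp
    qed (use \<rho>0 in auto)
  qed
qed

section \<open>Siegel's maximum modulus argument\<close>

lemma power_series_holomorphic_ball:
  fixes a :: "nat \<Rightarrow> complex"
  assumes "\<And>q. norm q < 1 \<Longrightarrow> summable (\<lambda>n. a n * q ^ n)"
  shows "(\<lambda>q. \<Sum>n. a n * q ^ n) holomorphic_on ball 0 1"
  by (rule power_series_holomorphic[of 0 1 a]) (use assms in \<open>auto simp: dist_norm summable_sums\<close>)

text \<open>Siegel's argument: on the horizontal line \<open>Im \<tau> = 3/4\<close>, the modulus of
  \<open>f(\<tau>) q\<^sup>-\<^sup>2 exp(40 q)\<close> grows under \<open>\<tau> \<mapsto> -1/\<tau>\<close>, which contradicts the maximum modulus
  principle in the disc \<open>\<bar>q\<bar> \<le> exp(-3\<pi>/2)\<close>. The factor \<open>exp(40 q)\<close> imitates \<open>q\<^sup>2 / \<Delta>\<^sup>2\<close>, with which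
  the argument would work for all weights below 24.\<close>

lemma modular_form_vanishing:
  fixes a :: "nat \<Rightarrow> complex" and k :: nat
  defines "f \<equiv> \<lambda>\<tau>. \<Sum>n. a n * exp (2 * pi * \<i> * \<tau>) ^ n"
  assumes k: "k \<le> 22" and conv: "\<And>q. norm q < 1 \<Longrightarrow> summable (\<lambda>n. a n * q ^ n)"
    and a01: "a 0 = 0" "a 1 = 0"
    and mod: "\<And>\<tau>. Im \<tau> > 0 \<Longrightarrow> f (- 1 / \<tau>) = \<tau> ^ k * f \<tau>"
  shows "a 2 = 0"
proof -
  define g where "g q = (\<Sum>n. a (n + 2) * q ^ n)" for q
  have conv': "summable (\<lambda>n. a (n + 2) * q ^ n)" if "norm q < 1" for q
  proof (cases "q = 0")
    case True
    thus ?thesis by (simp add: power_0_left if_distrib[of "\<lambda>x. _ * x"] cong: if_cong)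
  next
    case False
    have "summable (\<lambda>n. a (n + 2) * q ^ (n + 2))"
      using conv[OF that] summable_iff_shift[of "\<lambda>n. a n * q ^ n" 2] by blast
    hence "summable (\<lambda>n. a (n + 2) * q ^ (n + 2) / q\<^sup>2)" by (rule summable_divide)
    moreover have "a (n + 2) * q ^ (n + 2) / q\<^sup>2 = a (n + 2) * q ^ n" for n
      using False unfolding power_add by simp
    ultimately show ?thesis by (simp only:)
  qed
  have series: "(\<Sum>n. a n * q ^ n) = q\<^sup>2 * g q" if "norm q < 1" for q
  proof -
    have "(\<Sum>n. a n * q ^ n) = (\<Sum>n. a (n + 2) * q ^ (n + 2))"
      using suminf_minus_initial_segment[OF conv[OF that], of 2] a01 by (simp add: numeral_2_eq_2)
    also have "\<dots> = (\<Sum>n. q\<^sup>2 * (a (n + 2) * q ^ n))" by (simp only: power_add mult_ac)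
    also have "\<dots> = q\<^sup>2 * g q" unfolding g_def by (rule suminf_mult[OF conv'[OF that]])
    finally show ?thesis .
  qed
  define Q where "Q \<tau> = exp (2 * pi * \<i> * \<tau>)" for \<tau>
  have normQ: "norm (Q \<tau>) = exp (- 2 * pi * Im \<tau>)" for \<tau> by (simp add: Q_def)
  have ReQ: "Re (Q \<tau>) = exp (- 2 * pi * Im \<tau>) * cos (2 * pi * Re \<tau>)" for \<tau> by (simp add: Q_def Re_exp)
  have Q1: "norm (Q \<tau>) < 1" if "Im \<tau> > 0" for \<tau> using that by (simp add: normQ)
  have fQ: "f \<tau> = (Q \<tau>)\<^sup>2 * g (Q \<tau>)" if "Im \<tau> > 0" for \<tau>
    using series[OF Q1[OF that]] by (simp add: f_def Q_def)
  define H where "H q = g q * exp (40 * q)" for q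
  have gH: "g holomorphic_on ball 0 1" unfolding g_def by (rule power_series_holomorphic_ball[OF conv'])
  hence HH: "H holomorphic_on ball 0 1" unfolding H_def by (intro holomorphic_intros)
  define r where "r = exp (- (3 * pi / 2))"
  have r: "0 < r" "r < 1" by (auto simp: r_def)
  have sub: "cball 0 r \<subseteq> ball (0::complex) 1" using r by auto
  have Hc: "continuous_on (cball 0 r) H"
    using holomorphic_on_imp_continuous_on[OF HH] sub continuous_on_subset by blast
  obtain q0 where q0: "q0 \<in> sphere 0 r" "\<And>q. q \<in> sphere 0 r \<Longrightarrow> norm (H q) \<le> norm (H q0)"
  proof -
    have "continuous_on (sphere 0 r) (\<lambda>q. norm (H q))"
      by (intro continuous_intros continuous_on_subset[OF Hc]) auto
    moreover have "sphere (0::complex) r \<noteq> {}" using r by simp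
    ultimately show ?thesis using continuous_attains_sup[of "sphere 0 r" "\<lambda>q. norm (H q)"] that by auto
  qed
  have le: "norm (H q) \<le> norm (H q0)" if "q \<in> cball 0 r" for q
  proof (rule maximum_modulus_frontier[of H "cball 0 r"])
    show "H holomorphic_on interior (cball 0 r)" using HH sub holomorphic_on_subset interior_subset by blast
    show "continuous_on (closure (cball 0 r)) H" using Hc by simp
  qed (use that q0 r in auto)
  have "H q0 = 0"
  proof (rule ccontr)
    assume nz: "H q0 \<noteq> 0"
    have nq0: "norm q0 = r" using q0 by simp
    \<comment> \<open>The maximizer on the circle is lifted to a point \<tau> with Im \<tau> = 3/4
      and |Re \<tau>| at most 1/2. Then |\<tau>| < 1, so -1/\<tau> lies higher and its image q'
      stays in the closed disc, where the value at q0 is still maximal.\<close>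
    define x where "x = Arg q0 / (2 * pi)"
    have x: "\<bar>x\<bar> \<le> 1/2" using Arg_bounded[of q0] by (simp add: x_def abs_le_iff field_simps)
    define \<tau> where "\<tau> = Complex x (3/4)"
    define \<rho> where "\<rho> = x\<^sup>2 + 9/16"
    have \<rho>: "0 < \<rho>" "\<rho> < 1"
      using x power_mono[of "\<bar>x\<bar>" "1/2" 2] by (auto simp: \<rho>_def power2_eq_square add_nonneg_pos)
    have normt: "(norm \<tau>)\<^sup>2 = \<rho>" unfolding cmod_power2 by (simp add: \<tau>_def \<rho>_def power2_eq_square)
    have \<tau>0: "\<tau> \<noteq> 0" "Im \<tau> > 0" by (auto simp: \<tau>_def complex_eq_iff)
    have Im': "Im (- 1 / \<tau>) = 3 / (4 * \<rho>)"
      by (simp add: Im_divide \<tau>_def \<rho>_def power2_eq_square)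
    have Im'0: "Im (- 1 / \<tau>) > 0" using Im' \<rho> by simp
    have Qt: "Q \<tau> = q0"
    proof -
      have "q0 = of_real r * exp (\<i> * of_real (Arg q0))" using nq0 Arg_eq[of q0] r by fastforce
      also have "\<dots> = exp (of_real (- (3 * pi / 2)) + \<i> * of_real (Arg q0))"
        by (simp only: r_def exp_of_real[symmetric] mult_exp_exp)
      also have "of_real (- (3 * pi / 2)) + \<i> * of_real (Arg q0) = 2 * pi * \<i> * \<tau>"
        by (simp add: \<tau>_def x_def complex_eq_iff)
      finally show ?thesis by (simp add: Q_def)
    qed
    define q' where "q' = Q (- 1 / \<tau>)"
    have nq': "norm q' = exp (- (3 * pi / (2 * \<rho>)))" by (simp only: q'_def normQ Im') simp
    have "3 * pi / 2 \<le> 3 * pi / (2 * \<rho>)" using \<rho> by (simp add: field_simps)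
    hence "q' \<in> cball 0 r" using nq' by (simp add: r_def)
    from le[OF this] have le': "norm (H q') \<le> norm (H q0)" .
    have "q'\<^sup>2 * g q' = \<tau> ^ k * (q0\<^sup>2 * g q0)"
      using mod[OF \<tau>0(2)] fQ[OF \<tau>0(2)] fQ[OF Im'0] by (simp add: q'_def Qt)
    hence "norm (q'\<^sup>2 * g q') = norm (\<tau> ^ k * (q0\<^sup>2 * g q0))" by simp
    hence eq: "(norm q')\<^sup>2 * norm (g q') = norm \<tau> ^ k * (r\<^sup>2 * norm (g q0))"
      by (simp add: norm_mult norm_power nq0)
    have g0: "norm (g q0) > 0" using nz by (auto simp: H_def)
    \<comment> \<open>As |\<tau>| < 1, the largest weight 22 is the worst case.\<close>
    have pow: "norm \<tau> ^ k \<ge> exp (11 * ln \<rho>)"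
    proof -
      have "exp (11 * ln \<rho>) = \<rho> ^ 11" using \<rho> exp_of_nat_mult[of 11 "ln \<rho>"] by simp
      also have "\<dots> = norm \<tau> ^ 22" by (simp flip: normt power_mult)
      also have "\<dots> \<le> norm \<tau> ^ k"
      proof (rule power_decreasing[OF k])
        show "norm \<tau> \<le> 1" by (rule power2_le_imp_le) (use \<rho> normt in auto)
      qed auto
      finally show ?thesis .
    qed
    have r2: "(norm q')\<^sup>2 = r\<^sup>2 * exp (- (3 * pi * (1 / \<rho> - 1)))"
      unfolding nq' r_def power2_eq_square by (simp add: field_simps flip: exp_add)
    have "norm (g q') * exp (- (3 * pi * (1 / \<rho> - 1))) \<ge> exp (11 * ln \<rho>) * norm (g q0)"
    proof -
      have "r\<^sup>2 * (norm (g q') * exp (- (3 * pi * (1 / \<rho> - 1)))) = r\<^sup>2 * (norm \<tau> ^ k * norm (g q0))"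
        using eq unfolding r2 by (simp add: mult_ac)
      hence "norm (g q') * exp (- (3 * pi * (1 / \<rho> - 1))) = norm \<tau> ^ k * norm (g q0)" using r by simp
      thus ?thesis using pow g0 by simp
    qed
    hence "exp (3 * pi * (1 / \<rho> - 1)) * (exp (11 * ln \<rho>) * norm (g q0)) \<le> exp (3 * pi * (1 / \<rho> - 1)) * (norm (g q') * exp (- (3 * pi * (1 / \<rho> - 1))))"
      by (intro mult_left_mono) auto
    also have "\<dots> = norm (g q')" by (simp add: exp_minus)
    finally have gg: "exp (11 * ln \<rho> + 3 * pi * (1 / \<rho> - 1)) * norm (g q0) \<le> norm (g q')" by (simp add: exp_add mult_ac)
    have Re0: "Re q0 = exp (- (3 * pi / 2)) * cos (2 * pi * x)" using ReQ[of \<tau>] by (simp add: Qt, simp add: \<tau>_def)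
    have Re': "- exp (- (3 * pi / (2 * \<rho>))) \<le> Re q'" using abs_Re_le_cmod[of q'] nq' by linarith
    have "40 * Re q0 < 40 * Re q' + (11 * ln \<rho> + 3 * pi * (1 / \<rho> - 1))"
      using siegel_inequality[OF x \<rho>_def] Re' unfolding Re0 by (simp add: mult_ac)
    hence "exp (40 * Re q0) * norm (g q0) < exp (40 * Re q' + (11 * ln \<rho> + 3 * pi * (1 / \<rho> - 1))) * norm (g q0)"
      using g0 by simp
    also have "\<dots> = exp (40 * Re q') * (exp (11 * ln \<rho> + 3 * pi * (1 / \<rho> - 1)) * norm (g q0))"
      by (simp only: exp_add mult_ac)
    also have "\<dots> \<le> exp (40 * Re q') * norm (g q')" using gg by (intro mult_left_mono) auto
    finally have "norm (H q0) < norm (H q')" by (simp add: H_def norm_mult mult_ac)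
    thus False using le' by simp
  qed
  hence "norm (H 0) \<le> 0" using le[of 0] r by simp
  hence "g 0 = 0" by (simp add: H_def)
  moreover have "g 0 = a (0 + 2)" unfolding g_def by (rule powser_zero)
  ultimately show ?thesis by (simp only: add_0)
qed

subsection \<open>Theta series with isotropic harmonic coefficients\<close>

lemma norm_complex_inner_le: "norm (complex_inner p r x) \<le> (norm p + norm r) * norm x"
proof -
  have "norm (complex_inner p r x) \<le> \<bar>p \<bullet> x\<bar> + \<bar>r \<bullet> x\<bar>"
    using cmod_le[of "complex_inner p r x"] by (simp add: complex_inner_def)
  also have "\<dots> \<le> norm p * norm x + norm r * norm x"
    by (intro add_mono Cauchy_Schwarz_ineq2)
  finally show ?thesis by (simp add: algebra_simps)
qed

lemma complex_inner_scale: "complex_inner (\<sigma> *\<^sub>R p) (\<sigma> *\<^sub>R r) x = of_real \<sigma> * complex_inner p r x"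
  by (simp add: complex_inner_def complex_eq_iff)

context unimodular
begin

text \<open>The theta series on the imaginary axis only, with a = pi t for \<tau> = i t; holomorphy
  extends its transformation law afterwards.\<close>

definition theta :: "nat \<Rightarrow> real^'n \<Rightarrow> real^'n \<Rightarrow> real \<Rightarrow> complex" where
  "theta d p r a = (\<Sum>\<^sub>\<infinity>x\<in>L. complex_inner p r x ^ d * exp (- complex_of_real (a * (x \<bullet> x))))"

lemma summable_exp_series:
  assumes a: "a > 0"
  shows "(\<lambda>(x, d). exp (- complex_of_real (a * (x \<bullet> x))) * ((c * complex_inner p r x) ^ d / fact d)) summable_on (L \<times> UNIV)"
proof -
  define F where "F = (\<lambda>(x, d). exp (- complex_of_real (a * (x \<bullet> x))) * ((c * complex_inner p r x) ^ d / fact d))"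
  define N where "N = norm c * (norm p + norm r)"
  have "(\<lambda>z. norm (F z)) summable_on (SIGMA x:L. UNIV)"
  proof (rule summable_on_SigmaI[where g = "\<lambda>x. exp (- a * (x \<bullet> x)) * exp (norm (c * complex_inner p r x))"])
    fix x assume "x \<in> L"
    have "(\<lambda>d. norm (c * complex_inner p r x) ^ d /\<^sub>R fact d) sums exp (norm (c * complex_inner p r x))"
      by (rule exp_converges)
    hence "((\<lambda>d. norm (c * complex_inner p r x) ^ d /\<^sub>R fact d) has_sum exp (norm (c * complex_inner p r x))) UNIV"
      by (rule sums_nonneg_imp_has_sum) simp
    hence "((\<lambda>d. exp (- a * (x \<bullet> x)) * (norm (c * complex_inner p r x) ^ d /\<^sub>R fact d)) has_sum
        exp (- a * (x \<bullet> x)) * exp (norm (c * complex_inner p r x))) UNIV"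
      by (rule has_sum_cmult_right)
    moreover have "exp (- a * (x \<bullet> x)) * (norm (c * complex_inner p r x) ^ d /\<^sub>R fact d) = norm (F (x, d))" for d
      by (simp add: F_def norm_mult norm_divide norm_power divide_inverse norm_inverse norm_fact mult_ac)
    ultimately show "((\<lambda>d. norm (F (x, d))) has_sum exp (- a * (x \<bullet> x)) * exp (norm (c * complex_inner p r x))) UNIV"
      by simp
  next
    show "(\<lambda>x. exp (- a * (x \<bullet> x)) * exp (norm (c * complex_inner p r x))) summable_on L"
    proof (rule summable_on_comparison_test[OF summable_gaussian_lattice[OF a, of N]])
      fix x
      have "norm (c * complex_inner p r x) \<le> N * norm x"
        unfolding N_def norm_mult mult.assoc by (intro mult_left_mono norm_complex_inner_le) auto
      thus "exp (- a * (x \<bullet> x)) * exp (norm (c * complex_inner p r x)) \<le> exp (- a * (x \<bullet> x) + N * norm x)"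
        by (simp flip: exp_add)
    qed auto
  qed auto
  hence "F summable_on (SIGMA x:L. UNIV)" by (rule abs_summable_summable)
  thus ?thesis by (simp add: F_def)
qed

text \<open>The Gaussian sum with a linear exponent is the exponential generating function of all
  theta series. The exchange of sums rests on joint absolute summability, which holds since the norm
  of the exponential series is at most exp of a multiple of |x|.\<close>

lemma exp_series_sums:
  assumes a: "a > 0"
  shows "(\<lambda>d. c ^ d / fact d * theta d p r a) sums (\<Sum>\<^sub>\<infinity>x\<in>L. exp (- complex_of_real (a * (x \<bullet> x)) + c * complex_inner p r x))"
    and "(\<lambda>x. complex_inner p r x ^ d * exp (- complex_of_real (a * (x \<bullet> x)))) summable_on L"
proof -
  define F where "F c = (\<lambda>(x, d). exp (- complex_of_real (a * (x \<bullet> x))) * ((c * complex_inner p r x) ^ d / fact d))" for c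
  note sF = summable_exp_series[OF a, of _ p r, folded F_def]
  have sFd: "(\<lambda>x. F c (x, d)) summable_on L" for c d
  proof -
    have "(\<lambda>(d, x). F c (x, d)) summable_on (UNIV \<times> L)" using sF[of c] summable_on_swap by blast
    from summable_on_SigmaD1[OF this, of d] show ?thesis by simp
  qed
  show s: "(\<lambda>x. complex_inner p r x ^ d * exp (- complex_of_real (a * (x \<bullet> x)))) summable_on L" for d
  proof -
    have "(\<lambda>x. fact d * F 1 (x, d)) summable_on L" by (intro summable_on_cmult_right sFd)
    thus ?thesis by (simp add: F_def mult_ac)
  qed
  have "((\<lambda>x. exp (- complex_of_real (a * (x \<bullet> x)) + c * complex_inner p r x)) has_sum infsum (F c) (L \<times> UNIV)) L"
  proof (rule has_sum_SigmaD[OF has_sum_infsum[OF sF]])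
    fix x
    have "(\<lambda>d. (c * complex_inner p r x) ^ d /\<^sub>R fact d) sums exp (c * complex_inner p r x)" by (rule exp_converges)
    hence "((\<lambda>d. (c * complex_inner p r x) ^ d /\<^sub>R fact d) has_sum exp (c * complex_inner p r x)) UNIV"
      by (intro norm_summable_imp_has_sum summable_norm_exp)
    from has_sum_cmult_right[OF this, of "exp (- complex_of_real (a * (x \<bullet> x)))"]
    show "((\<lambda>d. F c (x, d)) has_sum exp (- complex_of_real (a * (x \<bullet> x)) + c * complex_inner p r x)) UNIV"
      by (simp only: exp_add) (simp add: F_def scaleR_conv_of_real divide_inverse mult_ac)
  qed
  hence 1: "(\<Sum>\<^sub>\<infinity>x\<in>L. exp (- complex_of_real (a * (x \<bullet> x)) + c * complex_inner p r x)) = infsum (F c) (L \<times> UNIV)"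
    by (rule infsumI)
  have "((\<lambda>(d, x). F c (x, d)) has_sum infsum (F c) (L \<times> UNIV)) (UNIV \<times> L)"
    using has_sum_infsum[OF sF[of c]] has_sum_swap by blast
  hence "((\<lambda>d. c ^ d / fact d * theta d p r a) has_sum infsum (F c) (L \<times> UNIV)) UNIV"
  proof (rule has_sum_SigmaD)
    fix d
    have "((\<lambda>x. c ^ d / fact d * (complex_inner p r x ^ d * exp (- complex_of_real (a * (x \<bullet> x))))) has_sum c ^ d / fact d * theta d p r a) L"
      unfolding theta_def by (intro has_sum_cmult_right has_sum_infsum s)
    thus "((\<lambda>x. case (d, x) of (d, x) \<Rightarrow> F c (x, d)) has_sum c ^ d / fact d * theta d p r a) L"
      by (simp add: F_def power_mult_distrib mult_ac)
  qed
  thus "(\<lambda>d. c ^ d / fact d * theta d p r a) sums (\<Sum>\<^sub>\<infinity>x\<in>L. exp (- complex_of_real (a * (x \<bullet> x)) + c * complex_inner p r x))"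
    unfolding 1 by (rule has_sum_imp_sums)
qed

text \<open>Scaling p and r by a real \<sigma> preserves isotropy, so Poisson summation is an
  identity between two power series in \<sigma>. Comparison of the coefficients of degree d gives
  the inversion formula for degree d.\<close>

lemma theta_inversion:
  assumes t: "t > 0" and iso: "p \<bullet> p = r \<bullet> r" "p \<bullet> r = 0"
  shows "(- of_real (2 * pi * t)) ^ d * theta d p r (pi * t) = of_real (1 / sqrt t ^ CARD('n)) * (of_real (2 * pi) * \<i>) ^ d * theta d p r (pi / t)"
proof -
  define K where "K = complex_of_real (1 / sqrt t ^ CARD('n))"
  define A where "A d = (- of_real (2 * pi * t)) ^ d / fact d * theta d p r (pi * t)" for d
  define B where "B d = K * ((of_real (2 * pi) * \<i>) ^ d / fact d * theta d p r (pi / t))" for d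
  have pos: "pi * t > 0" "pi / t > 0" using t by auto
  define LA where "LA \<sigma> = (\<Sum>\<^sub>\<infinity>x\<in>L. exp (- complex_of_real (pi * t * (x \<bullet> x)) + (\<sigma> * - of_real (2 * pi * t)) * complex_inner p r x))" for \<sigma>
  define LB where "LB \<sigma> = K * (\<Sum>\<^sub>\<infinity>x\<in>L. exp (- complex_of_real (pi / t * (x \<bullet> x)) + (\<sigma> * (of_real (2 * pi) * \<i>)) * complex_inner p r x))" for \<sigma>
  have sA: "(\<lambda>d. A d * \<sigma> ^ d) sums LA \<sigma>" for \<sigma>
    using exp_series_sums(1)[OF pos(1), of "\<sigma> * - of_real (2 * pi * t)" p r] unfolding LA_def A_def power_mult_distrib
    by (simp only: mult_ac times_divide_eq_left times_divide_eq_right)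
  have sB: "(\<lambda>d. B d * \<sigma> ^ d) sums LB \<sigma>" for \<sigma>
    using sums_mult[OF exp_series_sums(1)[OF pos(2), of "\<sigma> * (of_real (2 * pi) * \<i>)" p r], of K] unfolding LB_def B_def power_mult_distrib
    by (simp only: mult_ac times_divide_eq_left times_divide_eq_right)
  have eq: "LA (of_real \<sigma>) = LB (of_real \<sigma>)" for \<sigma>
  proof -
    have "(\<sigma> *\<^sub>R p) \<bullet> (\<sigma> *\<^sub>R p) = (\<sigma> *\<^sub>R r) \<bullet> (\<sigma> *\<^sub>R r)" "(\<sigma> *\<^sub>R p) \<bullet> (\<sigma> *\<^sub>R r) = 0" using iso by auto
    from poisson_lattice[OF t this] show ?thesis
      unfolding LA_def LB_def K_def complex_inner_scale by (simp add: mult_ac)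
  qed
  have "A d - B d = 0"
  proof (rule ccontr)
    \<comment> \<open>The series of differences vanishes for all real \<sigma>. Dividing it by
      \<sigma>^n0, where n0 is the index of the first nonzero coefficient, and letting \<sigma> =
      1/(n+1) tend to 0 makes that coefficient 0.\<close>
    assume nz: "A d - B d \<noteq> 0"
    have sums: "(\<lambda>d. (A d - B d) * (\<sigma> - 0) ^ d) sums (LA \<sigma> - LB \<sigma>)" for \<sigma>
      using sums_diff[OF sA sB, of \<sigma>] by (simp add: left_diff_distrib)
    obtain n0 where n0: "A n0 - B n0 \<noteq> 0" "\<And>n. n < n0 \<Longrightarrow> A n - B n = 0"
      using exists_least_iff[of "\<lambda>n. A n - B n \<noteq> 0"] nz by auto
    have "(\<lambda>d. (A (d + n0) - B (d + n0)) * \<sigma> ^ d) sums ((LA \<sigma> - LB \<sigma>) / \<sigma> ^ n0)" if "\<sigma> \<noteq> 0" for \<sigma>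
    proof -
      have "(\<lambda>d. (A (d + n0) - B (d + n0)) * \<sigma> ^ (d + n0)) sums (LA \<sigma> - LB \<sigma>)"
        using sums[of \<sigma>] sums_iff_shift[of "\<lambda>d. (A d - B d) * \<sigma> ^ d" n0 "LA \<sigma> - LB \<sigma>"] n0(2) by simp
      from sums_divide[OF this, of "\<sigma> ^ n0"] show ?thesis using that by (simp add: power_add)
    qed
    hence s: "(\<lambda>d. (A (d + n0) - B (d + n0)) * \<sigma> ^ d) sums (if \<sigma> = 0 then A n0 - B n0 else (LA \<sigma> - LB \<sigma>) / \<sigma> ^ n0)" for \<sigma>
      using powser_sums_zero[of "\<lambda>d. A (d + n0) - B (d + n0)"] by auto
    have "((\<lambda>\<sigma>. if \<sigma> = 0 then A n0 - B n0 else (LA \<sigma> - LB \<sigma>) / \<sigma> ^ n0) \<longlongrightarrow> (A (0 + n0) - B (0 + n0))) (at 0)"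
      by (rule powser_limit_0_strong[of 1 "\<lambda>d. A (d + n0) - B (d + n0)"]) (simp, rule s)
    moreover have "filterlim (\<lambda>n. complex_of_real (inverse (of_nat (Suc n)))) (at 0) sequentially"
      unfolding filterlim_at using tendsto_of_real[OF LIMSEQ_inverse_real_of_nat, where 'a = complex]
      by (simp del: of_nat_Suc of_real_inverse)
    ultimately have "(\<lambda>n. if complex_of_real (inverse (of_nat (Suc n))) = 0 then A n0 - B n0 else (LA (of_real (inverse (of_nat (Suc n)))) - LB (of_real (inverse (of_nat (Suc n))))) / (of_real (inverse (of_nat (Suc n)))) ^ n0) \<longlonglongrightarrow> A (0 + n0) - B (0 + n0)"
      by (rule filterlim_compose)
    hence "(\<lambda>n. 0 :: complex) \<longlonglongrightarrow> A n0 - B n0" by (simp add: eq del: of_real_inverse of_nat_Suc)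
    thus False using n0(1) LIMSEQ_unique tendsto_const by metis
  qed
  thus ?thesis unfolding A_def B_def K_def by (simp add: field_simps)
qed

end


section \<open>Theta series of the Leech lattice\<close>

locale leech =
  fixes L :: "(real^24) set"
  assumes leech: "leech_lattice L"

sublocale leech \<subseteq> unimodular L
  using leech by unfold_locales (simp add: leech_lattice_def)

context leech
begin

definition level :: "real^24 \<Rightarrow> nat" where
  "level x = nat \<lfloor>x \<bullet> x / 2\<rfloor>"

lemma level: "x \<in> L \<Longrightarrow> x \<bullet> x = 2 * real (level x)"
proof -
  assume "x \<in> L"
  then obtain k :: int where k: "x \<bullet> x = 2 * of_int k"
    using leech by (auto simp: leech_lattice_def even_lattice_def)
  moreover have "0 \<le> k" using k inner_ge_zero[of x] by simp
  ultimately show ?thesis by (simp add: level_def)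
qed

lemma level_ne_1: "x \<in> L \<Longrightarrow> level x \<noteq> 1"
  using leech level[of x] by (auto simp: leech_lattice_def dot_square_norm)

lemma level_eq_0: "x \<in> L \<Longrightarrow> level x = 0 \<longleftrightarrow> x = 0"
  using level[of x] by auto

lemma shell_eq_level: "shell L n = {x \<in> L. level x = n}"
  using level by (auto simp: shell_def simp flip: dot_square_norm)

lemma finite_shell: "finite (shell L n)"
  by (rule finite_subset[OF _ finite_bounded[of "sqrt (2 * real n)"]])
     (auto simp: shell_def intro: real_le_rsqrt)

definition theta_coeff :: "nat \<Rightarrow> real^24 \<Rightarrow> real^24 \<Rightarrow> nat \<Rightarrow> complex" where
  "theta_coeff d p r n = (\<Sum>x\<in>shell L n. complex_inner p r x ^ d)"

lemma theta_coeff_sums: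
  assumes a: "a > 0"
  shows "(\<lambda>n. theta_coeff d p r n * exp (- complex_of_real (2 * a)) ^ n) sums theta d p r a"
proof -
  define T where "T x = complex_inner p r x ^ d * exp (- complex_of_real (a * (x \<bullet> x)))" for x
  have "bij_betw snd (Sigma UNIV (shell L)) L"
    by (rule bij_betwI[where g = "\<lambda>x. (level x, x)"]) (auto simp: shell_eq_level)
  hence "((\<lambda>z. T (snd z)) has_sum theta d p r a) (Sigma UNIV (shell L))"
    using exp_series_sums(2)[OF a, of p r d] has_sum_reindex_bij_betw[of snd "Sigma UNIV (shell L)" L T]
    by (simp add: theta_def T_def[abs_def])
  hence "((\<lambda>n. \<Sum>x\<in>shell L n. T x) has_sum theta d p r a) UNIV"
    by (rule has_sum_SigmaD) (simp add: finite_shell)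
  moreover have "(\<Sum>x\<in>shell L n. T x) = theta_coeff d p r n * exp (- complex_of_real (2 * a)) ^ n" for n
    unfolding theta_coeff_def sum_distrib_right
  proof (rule sum.cong[OF refl])
    fix x assume "x \<in> shell L n"
    hence "x \<bullet> x = 2 * real n" by (simp add: shell_def dot_square_norm)
    thus "T x = complex_inner p r x ^ d * exp (- complex_of_real (2 * a)) ^ n"
      by (simp add: T_def mult_ac flip: exp_of_nat_mult)
  qed
  ultimately show ?thesis using has_sum_imp_sums by simp
qed

text \<open>Convergence on the imaginary axis covers every real point s of (0, 1), with a = -ln s /
  2; a power series converging at s > |q| converges at q.\<close>

lemma theta_coeff_summable:
  assumes "norm q < 1"
  shows "summable (\<lambda>n. theta_coeff d p r n * q ^ n)"
proof -
  define s where "s = (1 + norm q) / 2"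
  have s: "norm q < s" "0 < s" "s < 1" using assms by (auto simp: s_def add_pos_nonneg)
  have "exp (- complex_of_real (2 * (- ln s / 2))) = of_real s"
    using s exp_of_real[of "ln s", where 'a = complex] by simp
  hence "summable (\<lambda>n. theta_coeff d p r n * of_real s ^ n)"
    using sums_summable[OF theta_coeff_sums[of "- ln s / 2" d p r]] s by simp
  thus ?thesis by (rule powser_inside) (use s in auto)
qed

text \<open>On the imaginary axis this is the inversion formula: half the dimension gives the
  exponent 12, where i^12 = 1 leaves no sign, and the ratio of the two d-th powers there gives
  \<tau>^d. Both sides are holomorphic, so the identity extends to the half-plane. Invariance under
  translation by 1 is built into the expansion in powers of q.\<close>

lemma theta_modular:
  fixes p r :: "real^24" and d :: nat
  defines "f \<equiv> \<lambda>\<tau>. \<Sum>n. theta_coeff d p r n * exp (2 * pi * \<i> * \<tau>) ^ n"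
  assumes iso: "p \<bullet> p = r \<bullet> r" "p \<bullet> r = 0" and \<tau>: "Im \<tau> > 0"
  shows "f (- 1 / \<tau>) = \<tau> ^ (12 + d) * f \<tau>"
proof -
  define P where "P q = (\<Sum>n. theta_coeff d p r n * q ^ n)" for q
  have P: "P holomorphic_on ball 0 1"
    unfolding P_def by (rule power_series_holomorphic_ball[OF theta_coeff_summable])
  define S where "S = {\<tau>. Im \<tau> > 0}"
  have fP: "f = P \<circ> (\<lambda>\<tau>. exp (2 * pi * \<i> * \<tau>))" by (simp add: f_def P_def o_def)
  have hf: "f holomorphic_on S"
    unfolding fP by (rule holomorphic_on_compose_gen[OF _ P]) (auto intro!: holomorphic_intros simp: S_def)
  have im: "Im (- 1 / z) > 0" if "z \<in> S" for z
  proof -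
    have "Im z > 0" using that by (simp add: S_def)
    moreover have "(Re z)\<^sup>2 + (Im z)\<^sup>2 > 0" using calculation by (simp add: add_nonneg_pos)
    moreover have "Im (- 1 / z) = Im z / ((Re z)\<^sup>2 + (Im z)\<^sup>2)" by (simp add: Im_divide)
    ultimately show ?thesis by simp
  qed
  have hf': "(f \<circ> (\<lambda>z. - 1 / z)) holomorphic_on S"
    by (rule holomorphic_on_compose_gen[OF _ hf]) (use im in \<open>auto intro!: holomorphic_intros simp: S_def\<close>)
  have axis: "f (\<i> * of_real t) = theta d p r (pi * t)" if "t > 0" for t
  proof -
    have "exp (2 * pi * \<i> * (\<i> * of_real t)) = exp (- complex_of_real (2 * (pi * t)))"
      by (rule arg_cong[of _ _ exp]) (simp add: complex_eq_iff)
    thus ?thesis using sums_unique[OF theta_coeff_sums[of "pi * t" d p r]] that by (simp add: f_def)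
  qed
  have "(f \<circ> (\<lambda>z. - 1 / z)) \<tau> - \<tau> ^ (12 + d) * f \<tau> = 0"
  proof (rule analytic_continuation[of "\<lambda>\<tau>. (f \<circ> (\<lambda>z. - 1 / z)) \<tau> - \<tau> ^ (12 + d) * f \<tau>" S "(\<lambda>t. \<i> * of_real t) ` {0<..}" \<i>])
    show "(\<lambda>\<tau>. (f \<circ> (\<lambda>z. - 1 / z)) \<tau> - \<tau> ^ (12 + d) * f \<tau>) holomorphic_on S"
      by (intro holomorphic_intros hf hf')
    show "open S" unfolding S_def by (rule open_halfspace_Im_gt)
    show "connected S" unfolding S_def by (intro convex_connected convex_halfspace_Im_gt)
    show "\<i> islimpt (\<lambda>t. \<i> * of_real t) ` {0<..}"
      unfolding islimpt_sequential
    proof (intro exI conjI allI)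
      have "(\<lambda>n. 1 + inverse (real (Suc n))) \<longlonglongrightarrow> 1 + 0" by (intro tendsto_intros LIMSEQ_inverse_real_of_nat)
      hence "(\<lambda>n. \<i> * of_real (1 + inverse (real (Suc n)))) \<longlonglongrightarrow> \<i> * of_real (1 + 0)" by (intro tendsto_mult_left tendsto_of_real)
      thus "(\<lambda>n. \<i> * of_real (1 + inverse (real (Suc n)))) \<longlonglongrightarrow> \<i>" by simp
      show "\<i> * of_real (1 + inverse (real (Suc n))) \<in> (\<lambda>t. \<i> * complex_of_real t) ` {0<..} - {\<i>}" for n
      proof -
        have "inverse (real (Suc n)) > 0" by simp
        hence "1 + inverse (real (Suc n)) \<in> {0<..}" "1 + inverse (real (Suc n)) \<noteq> 1"
          unfolding greaterThan_iff by linarith+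
        moreover from this have "\<i> * of_real (1 + inverse (real (Suc n))) \<noteq> \<i>"
          by (simp only: complex_eq_iff) simp
        ultimately show ?thesis by blast
      qed
    qed
    fix z assume "z \<in> (\<lambda>t. \<i> * complex_of_real t) ` {0<..}"
    then obtain t where t: "t > 0" and z: "z = \<i> * of_real t" by auto
    have "- 1 / z = \<i> * of_real (1 / t)" using t by (simp add: z complex_eq_iff Re_divide Im_divide power2_eq_square)
    hence l: "(f \<circ> (\<lambda>z. - 1 / z)) z = theta d p r (pi / t)" using axis[of "1 / t"] t by simp
    have "sqrt t ^ 24 = t ^ 12" using t power_mult[of "sqrt t" 2 12] by simp
    hence "(- of_real (2 * pi * t)) ^ d * theta d p r (pi * t) = of_real (1 / t ^ 12) * (of_real (2 * pi) * \<i>) ^ d * theta d p r (pi / t)"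
      using theta_inversion[OF t iso, of d] by simp
    moreover have "(- complex_of_real (2 * pi * t)) ^ d = (of_real (2 * pi) * \<i>) ^ d * z ^ d"
      unfolding power_mult_distrib[symmetric] by (rule arg_cong[of _ _ "\<lambda>z. z ^ d"]) (simp add: z complex_eq_iff)
    ultimately have "(of_real (2 * pi) * \<i>) ^ d * (z ^ d * theta d p r (pi * t)) = (of_real (2 * pi) * \<i>) ^ d * (of_real (1 / t ^ 12) * theta d p r (pi / t))"
      by (simp only: mult_ac)
    hence "z ^ d * theta d p r (pi * t) = of_real (1 / t ^ 12) * theta d p r (pi / t)"
      by (subst (asm) mult_left_cancel) simp_all
    hence "theta d p r (pi / t) = of_real (t ^ 12) * (z ^ d * theta d p r (pi * t))"
      using t by (simp add: field_simps)
    also have "of_real (t ^ 12) = z ^ 12" by (simp add: z power_mult_distrib) 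
    finally show "(f \<circ> (\<lambda>z. - 1 / z)) z - z ^ (12 + d) * f z = 0"
      unfolding l using axis[OF t] by (simp add: z power_add)
  next
    show "(\<lambda>t. \<i> * complex_of_real t) ` {0<..} \<subseteq> S" by (force simp: S_def)
    show "\<i> \<in> S" "\<tau> \<in> S" using \<tau> by (simp_all add: S_def)
  qed
  thus ?thesis by simp
qed

theorem shell_isotropic_sum:
  assumes iso: "p \<bullet> p = r \<bullet> r" "p \<bullet> r = 0" and d: "0 < d" "d \<le> 10"
  shows "(\<Sum>x\<in>shell L 2. complex_inner p r x ^ d) = 0"
proof -
  have "theta_coeff d p r 2 = 0"
  proof (rule modular_form_vanishing[where k = "12 + d"])
    show "12 + d \<le> 22" using d by simp
    have "shell L 0 = {0}" using level_eq_0 level[OF zero_mem] by (auto simp: shell_eq_level)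
    thus "theta_coeff d p r 0 = 0" using d by (simp add: theta_coeff_def complex_inner_def complex_eq_iff)
    have "shell L 1 = {}" using level_ne_1 by (auto simp: shell_eq_level)
    thus "theta_coeff d p r 1 = 0" by (simp add: theta_coeff_def)
    show "summable (\<lambda>n. theta_coeff d p r n * q ^ n)" if "norm q < 1" for q
      by (rule theta_coeff_summable[OF that])
    show "(\<Sum>n. theta_coeff d p r n * exp (2 * pi * \<i> * (- 1 / \<tau>)) ^ n) = \<tau> ^ (12 + d) * (\<Sum>n. theta_coeff d p r n * exp (2 * pi * \<i> * \<tau>) ^ n)"
      if "Im \<tau> > 0" for \<tau> by (rule theta_modular[OF iso that])
  qed
  thus ?thesis by (simp add: theta_coeff_def)
qed

end

subsection \<open>From isotropic sums to power sums\<close>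

text \<open>\<open>sphere_moment D j\<close> is the mean of \<open>(e \<bullet> r)\<^bsup>2j\<^esup>\<close> over the unit sphere of a \<open>D\<close>-dimensional space.
  The mean of a polynomial in \<open>r\<close> is read off by applying the Laplacian repeatedly.\<close>

definition sphere_moment :: "real \<Rightarrow> nat \<Rightarrow> real" where
  "sphere_moment D j = (\<Prod>i<j. (2 * real i + 1) / (D + 2 * real i))"

section \<open>Averaging over a sphere by repeated Laplacians\<close>

context
  fixes E :: "'a::euclidean_space set" and K :: "'k set" and y :: "'k \<Rightarrow> 'a"
  assumes finE: "finite E" and E: "pairwise orthogonal E" "\<And>e. e \<in> E \<Longrightarrow> norm e = 1"
begin

lemma E_expand: "v \<in> span E \<Longrightarrow> (\<Sum>e\<in>E. (v \<bullet> e) *\<^sub>R e) = v"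
  using orthonormal_basis_expand[OF E] finE by blast

lemma E_inner: "v \<in> span E \<Longrightarrow> (\<Sum>e\<in>E. (v \<bullet> e) * (e \<bullet> w)) = v \<bullet> w"
  by (subst (3) E_expand[symmetric]) (auto simp: inner_sum_left)

text \<open>The Laplacian of \<open>span E\<close> in the variable r sends a combination of products
  of powers of \<open>r \<bullet> r\<close> and \<open>r \<bullet> y k\<close> to one of the same
  shape, of degree lower by 2. The new weights are read off from this.\<close>

lemma laplacian_step:
  assumes zero: "\<And>r. r \<in> span E \<Longrightarrow> (\<Sum>j\<le>Suc m. \<Sum>k\<in>K. w j k * (r \<bullet> r) ^ (Suc m - j) * (r \<bullet> y k) ^ (2 * j)) = 0"
    and r: "r \<in> span E"
  shows "(\<Sum>j\<le>m. \<Sum>k\<in>K. (2 * real (Suc m - j) * (2 * real (Suc m - j) - 2 + real (card E) + 4 * real j) * w j k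
      + (2 * real j + 2) * (2 * real j + 1) * (\<Sum>e\<in>E. (e \<bullet> y k)\<^sup>2) * w (Suc j) k) * (r \<bullet> r) ^ (m - j) * (r \<bullet> y k) ^ (2 * j)) = 0"
proof -
  \<comment> \<open>First and second derivatives of
    \<open>(r \<bullet> r) ^ i * (r \<bullet> z) ^ (2 * j)\<close> in a unit direction e, as
    functions of \<rho> = \<open>r \<bullet> r\<close>, \<alpha> = \<open>r \<bullet> e\<close>,
    \<beta> = \<open>r \<bullet> z\<close> and \<gamma> = \<open>e \<bullet> z\<close>.\<close>
  define d1 where "d1 i j \<rho> \<alpha> \<beta> \<gamma> = 2 * real i * \<rho> ^ (i - 1) * \<alpha> * \<beta> ^ (2 * j) + 2 * real j * \<rho> ^ i * \<beta> ^ (2 * j - 1) * \<gamma>"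
    for i j :: nat and \<rho> \<alpha> \<beta> \<gamma> :: real
  define d2 where "d2 i j \<rho> \<alpha> \<beta> \<gamma> = 4 * real i * real (i - 1) * \<rho> ^ (i - 2) * \<beta> ^ (2 * j) * (\<alpha> * \<alpha>) + 2 * real i * \<rho> ^ (i - 1) * \<beta> ^ (2 * j)
     + 8 * real i * real j * \<rho> ^ (i - 1) * \<beta> ^ (2 * j - 1) * (\<alpha> * \<gamma>) + 2 * real j * real (2 * j - 1) * \<rho> ^ i * \<beta> ^ (2 * j - 2) * \<gamma>\<^sup>2"
    for i j :: nat and \<rho> \<alpha> \<beta> \<gamma> :: real
  have D1: "((\<lambda>s. ((r + s *\<^sub>R e) \<bullet> (r + s *\<^sub>R e)) ^ i * ((r + s *\<^sub>R e) \<bullet> z) ^ (2 * j)) has_real_derivative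
      d1 i j (r \<bullet> r) (r \<bullet> e) (r \<bullet> z) (e \<bullet> z)) (at 0)" for r e z :: 'a and i j
    unfolding d1_def by (auto intro!: derivative_eq_intros simp: inner_commute algebra_simps)
  have D2: "((\<lambda>s. d1 i j ((r + s *\<^sub>R e) \<bullet> (r + s *\<^sub>R e)) ((r + s *\<^sub>R e) \<bullet> e) ((r + s *\<^sub>R e) \<bullet> z) (e \<bullet> z)) has_real_derivative
      d2 i j (r \<bullet> r) (r \<bullet> e) (r \<bullet> z) (e \<bullet> z)) (at 0)" if "e \<bullet> e = 1" for r e z :: 'a and i j
  proof -
    have d\<rho>: "((\<lambda>s. (r + s *\<^sub>R e) \<bullet> (r + s *\<^sub>R e)) has_real_derivative 2 * (r \<bullet> e)) (at 0)"
      by (auto intro!: derivative_eq_intros simp: inner_commute algebra_simps)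
    have d\<alpha>: "((\<lambda>s. (r + s *\<^sub>R e) \<bullet> e) has_real_derivative 1) (at 0)"
      using that by (auto intro!: derivative_eq_intros simp: inner_commute algebra_simps)
    have d\<beta>: "((\<lambda>s. (r + s *\<^sub>R e) \<bullet> z) has_real_derivative e \<bullet> z) (at 0)"
      by (auto intro!: derivative_eq_intros simp: inner_commute algebra_simps)
    show ?thesis
      unfolding d1_def d2_def
      by (rule d\<rho> d\<alpha> d\<beta> derivative_eq_intros refl)+
         (simp add: power2_eq_square diff_diff_eq numeral_2_eq_2 algebra_simps)
  qed
  have const: "c = 0" if "(f has_real_derivative c) (at 0)" "\<And>s. f s = 0" for f :: "real \<Rightarrow> real" and c
  proof -
    have "f = (\<lambda>_. 0)" using that(2) by auto
    thus ?thesis using DERIV_unique[OF that(1)] DERIV_const[of 0] by auto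
  qed
  have line: "r + s *\<^sub>R e \<in> span E" if "r \<in> span E" "e \<in> E" for r e s
    using that by (intro span_add[OF _ span_scale[OF span_base]])
  have z1: "(\<Sum>j\<le>Suc m. \<Sum>k\<in>K. w j k * d1 (Suc m - j) j (r \<bullet> r) (r \<bullet> e) (r \<bullet> y k) (e \<bullet> y k)) = 0" if "r \<in> span E" "e \<in> E" for r e
  proof (rule const)
    show "((\<lambda>s. \<Sum>j\<le>Suc m. \<Sum>k\<in>K. w j k * (((r + s *\<^sub>R e) \<bullet> (r + s *\<^sub>R e)) ^ (Suc m - j) * ((r + s *\<^sub>R e) \<bullet> y k) ^ (2 * j)))
      has_real_derivative (\<Sum>j\<le>Suc m. \<Sum>k\<in>K. w j k * d1 (Suc m - j) j (r \<bullet> r) (r \<bullet> e) (r \<bullet> y k) (e \<bullet> y k))) (at 0)"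
      by (intro DERIV_sum DERIV_cmult D1)
  qed (use zero[OF line[OF that]] in \<open>simp only: mult.assoc\<close>)
  have z2: "(\<Sum>j\<le>Suc m. \<Sum>k\<in>K. w j k * d2 (Suc m - j) j (r \<bullet> r) (r \<bullet> e) (r \<bullet> y k) (e \<bullet> y k)) = 0" if e: "e \<in> E" for e
  proof (rule const)
    have "e \<bullet> e = 1" using E(2)[OF e] by (simp add: dot_square_norm)
    thus "((\<lambda>s. \<Sum>j\<le>Suc m. \<Sum>k\<in>K. w j k * d1 (Suc m - j) j ((r + s *\<^sub>R e) \<bullet> (r + s *\<^sub>R e)) ((r + s *\<^sub>R e) \<bullet> e) ((r + s *\<^sub>R e) \<bullet> y k) (e \<bullet> y k))
      has_real_derivative (\<Sum>j\<le>Suc m. \<Sum>k\<in>K. w j k * d2 (Suc m - j) j (r \<bullet> r) (r \<bullet> e) (r \<bullet> y k) (e \<bullet> y k))) (at 0)"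
      by (intro DERIV_sum DERIV_cmult D2)
  qed (rule z1[OF line[OF r e] e])
  define \<rho> where "\<rho> = r \<bullet> r"
  define \<beta> where "\<beta> k = r \<bullet> y k" for k
  define Y where "Y k = (\<Sum>e\<in>E. (e \<bullet> y k)\<^sup>2)" for k
  define P where "P j k = 2 * real (Suc m - j) * (2 * real (Suc m - j) - 2 + real (card E) + 4 * real j) * w j k * \<rho> ^ (m - j) * \<beta> k ^ (2 * j)" for j k
  define R where "R j k = 2 * real j * (2 * real j - 1) * Y k * w j k * \<rho> ^ (Suc m - j) * \<beta> k ^ (2 * j - 2)" for j k
  \<comment> \<open>Summed over the orthonormal basis, \<alpha>^2 gives \<rho> and \<alpha>\<gamma>
    gives \<beta>. P collects the terms that keep the power of \<beta>; R comes from the second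
    derivative of that power alone and moves to index j - 1.\<close>
  have lap: "(\<Sum>e\<in>E. w j k * d2 (Suc m - j) j (r \<bullet> r) (r \<bullet> e) (r \<bullet> y k) (e \<bullet> y k)) = P j k + R j k" if j: "j \<le> Suc m" for j k
  proof -
    define i where "i = Suc m - j"
    have s1: "(\<Sum>e\<in>E. (r \<bullet> e) * (r \<bullet> e)) = \<rho>" using E_inner[OF r, of r] by (simp add: \<rho>_def inner_commute)
    have s2: "(\<Sum>e\<in>E. (r \<bullet> e) * (e \<bullet> y k)) = \<beta> k" using E_inner[OF r, of "y k"] by (simp add: \<beta>_def)
    have p1: "real i * real (i - 1) * (\<rho> ^ (i - 2) * \<rho>) = real i * (real i - 1) * \<rho> ^ (i - 1)"
    proof (cases "i \<ge> 2")
      case True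
      then obtain l where "i = Suc (Suc l)" by (metis add_2_eq_Suc le_Suc_ex)
      thus ?thesis by simp
    qed (auto simp: not_le less_2_cases_iff)
    have p2: "real j * (\<beta> k ^ (2 * j - 1) * \<beta> k) = real j * \<beta> k ^ (2 * j)"
      by (cases j) auto
    have p3: "real j * real (2 * j - 1) = real j * (2 * real j - 1)" by (cases j) auto
    have "(\<Sum>e\<in>E. d2 i j \<rho> (r \<bullet> e) (\<beta> k) (e \<bullet> y k)) =
        4 * real i * real (i - 1) * \<rho> ^ (i - 2) * \<beta> k ^ (2 * j) * (\<Sum>e\<in>E. (r \<bullet> e) * (r \<bullet> e)) + real (card E) * (2 * real i * \<rho> ^ (i - 1) * \<beta> k ^ (2 * j))
     + 8 * real i * real j * \<rho> ^ (i - 1) * \<beta> k ^ (2 * j - 1) * (\<Sum>e\<in>E. (r \<bullet> e) * (e \<bullet> y k)) + 2 * real j * real (2 * j - 1) * \<rho> ^ i * \<beta> k ^ (2 * j - 2) * Y k"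
      unfolding d2_def Y_def sum.distrib sum_distrib_left by simp
    also have "\<dots> = 4 * \<beta> k ^ (2 * j) * (real i * real (i - 1) * (\<rho> ^ (i - 2) * \<rho>)) + real (card E) * (2 * real i * \<rho> ^ (i - 1) * \<beta> k ^ (2 * j))
     + 8 * real i * \<rho> ^ (i - 1) * (real j * (\<beta> k ^ (2 * j - 1) * \<beta> k)) + 2 * (real j * real (2 * j - 1)) * \<rho> ^ i * \<beta> k ^ (2 * j - 2) * Y k"
      unfolding s1 s2 by (simp only: mult_ac)
    also have "\<dots> = 2 * real i * (2 * real i - 2 + real (card E) + 4 * real j) * \<rho> ^ (i - 1) * \<beta> k ^ (2 * j)
       + 2 * real j * (2 * real j - 1) * Y k * \<rho> ^ i * \<beta> k ^ (2 * j - 2)"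
      unfolding p1 p2 p3 by (simp add: algebra_simps)
    finally have "(\<Sum>e\<in>E. w j k * d2 i j \<rho> (r \<bullet> e) (\<beta> k) (e \<bullet> y k)) = w j k * \<dots>" by (simp only: sum_distrib_left[symmetric])
    thus ?thesis using j by (simp add: P_def R_def i_def \<rho>_def \<beta>_def algebra_simps)
  qed
  have "0 = (\<Sum>e\<in>E. \<Sum>j\<le>Suc m. \<Sum>k\<in>K. w j k * d2 (Suc m - j) j (r \<bullet> r) (r \<bullet> e) (r \<bullet> y k) (e \<bullet> y k))"
    by (simp only: z2 sum.neutral_const cong: sum.cong)
  also have "\<dots> = (\<Sum>j\<le>Suc m. \<Sum>e\<in>E. \<Sum>k\<in>K. w j k * d2 (Suc m - j) j (r \<bullet> r) (r \<bullet> e) (r \<bullet> y k) (e \<bullet> y k))"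
    by (rule sum.swap)
  also have "\<dots> = (\<Sum>j\<le>Suc m. \<Sum>k\<in>K. P j k + R j k)"
    by (rule sum.cong[OF refl], subst sum.swap, rule sum.cong[OF refl], rule lap) simp
  also have "\<dots> = (\<Sum>j\<le>Suc m. \<Sum>k\<in>K. P j k) + (\<Sum>j\<le>Suc m. \<Sum>k\<in>K. R j k)"
    by (simp add: sum.distrib)
  also have "(\<Sum>j\<le>Suc m. \<Sum>k\<in>K. P j k) = (\<Sum>j\<le>m. \<Sum>k\<in>K. P j k)" by (simp add: P_def)
  also have "(\<Sum>j\<le>Suc m. \<Sum>k\<in>K. R j k) = (\<Sum>j\<le>m. \<Sum>k\<in>K. R (Suc j) k)"
    by (subst sum.atMost_Suc_shift) (simp add: R_def)
  finally have "(\<Sum>j\<le>m. \<Sum>k\<in>K. P j k + R (Suc j) k) = 0" by (simp add: sum.distrib)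
  moreover have "P j k + R (Suc j) k = (2 * real (Suc m - j) * (2 * real (Suc m - j) - 2 + real (card E) + 4 * real j) * w j k
      + (2 * real j + 2) * (2 * real j + 1) * (\<Sum>e\<in>E. (e \<bullet> y k)\<^sup>2) * w (Suc j) k) * (r \<bullet> r) ^ (m - j) * (r \<bullet> y k) ^ (2 * j)" for j k
    by (simp add: P_def R_def Y_def \<rho>_def \<beta>_def algebra_simps)
  ultimately show ?thesis by simp
qed

text \<open>Averaging over unit vectors r replaces \<open>r \<bullet> r\<close> by 1 and the power
  of \<open>r \<bullet> y k\<close> by a sphere moment times the same power of the projected length
  of \<open>y k\<close>. The recursion (D + 2j - 2) \<kappa> j = (2j - 1) \<kappa> (j - 1) makes the
  average of the Laplacian equal to (2m + 2)(2m + D) times the average of the polynomial, and this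
  factor is positive.\<close>

lemma laplacian_mean:
  assumes "\<And>r. r \<in> span E \<Longrightarrow> (\<Sum>j\<le>m. \<Sum>k\<in>K. w j k * (r \<bullet> r) ^ (m - j) * (r \<bullet> y k) ^ (2 * j)) = 0"
    and D: "card E > 0"
  shows "(\<Sum>j\<le>m. sphere_moment (card E) j * (\<Sum>k\<in>K. w j k * (\<Sum>e\<in>E. (e \<bullet> y k)\<^sup>2) ^ j)) = 0"
  using assms(1)
proof (induction m arbitrary: w)
  case 0
  thus ?case using 0[of 0] by (simp add: sphere_moment_def span_zero)
next
  case (Suc m)
  define D where "D = real (card E)"
  have D0: "D > 0" using D by (simp add: D_def)
  define Y where "Y k = (\<Sum>e\<in>E. (e \<bullet> y k)\<^sup>2)" for k
  define \<kappa> where "\<kappa> = sphere_moment D"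
  define s where "s j l = (\<Sum>k\<in>K. w j k * Y k ^ l)" for j l
  have IH: "(\<Sum>j\<le>m. \<kappa> j * (\<Sum>k\<in>K. (2 * real (Suc m - j) * (2 * real (Suc m - j) - 2 + D + 4 * real j) * w j k
      + (2 * real j + 2) * (2 * real j + 1) * Y k * w (Suc j) k) * Y k ^ j)) = 0"
    unfolding \<kappa>_def D_def Y_def
    by (rule Suc.IH) (rule laplacian_step[OF Suc.prems])
  have inner: "(\<Sum>k\<in>K. (c * w j k + d * Y k * w (Suc j) k) * Y k ^ j) = c * s j j + d * s (Suc j) (Suc j)" for c d j
    unfolding s_def sum_distrib_left sum.distrib[symmetric] by (intro sum.cong) (simp_all add: algebra_simps)
  define p where "p j = 2 * real (Suc m - j) * (2 * real (Suc m - j) - 2 + D + 4 * real j) * \<kappa> j * s j j" for j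
  define q where "q j = 2 * real j * (2 * real j - 1) * \<kappa> (j - 1) * s j j" for j
  have "(\<Sum>j\<le>m. p j + q (Suc j)) = 0"
    using IH unfolding inner p_def q_def by (simp add: algebra_simps)
  hence "0 = (\<Sum>j\<le>Suc m. p j) + (\<Sum>j\<le>Suc m. q j)"
    unfolding sum.atMost_Suc_shift[of q] by (simp add: sum.distrib p_def) (simp add: q_def)
  also have "\<dots> = (\<Sum>j\<le>Suc m. p j + q j)" by (simp add: sum.distrib)
  also have "\<dots> = (\<Sum>j\<le>Suc m. (2 * real m + 2) * (2 * real m + D) * (\<kappa> j * s j j))"
  proof (rule sum.cong[OF refl])
    fix j assume j: "j \<in> {..Suc m}"
    have k: "real j * ((2 * real j - 1) * \<kappa> (j - 1)) = real j * ((D + 2 * real j - 2) * \<kappa> j)"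
    proof (cases j)
      case (Suc i)
      have "\<kappa> (Suc i) = \<kappa> i * ((2 * real i + 1) / (D + 2 * real i))" by (simp add: \<kappa>_def sphere_moment_def)
      moreover have "D + 2 * real i > 0" using D0 by (simp add: add_pos_nonneg)
      ultimately have "(D + 2 * real i) * \<kappa> (Suc i) = (2 * real i + 1) * \<kappa> i" by (simp add: field_simps)
      thus ?thesis using Suc by (simp add: algebra_simps)
    qed simp
    have "q j = 2 * (real j * ((2 * real j - 1) * \<kappa> (j - 1))) * s j j" by (simp add: q_def)
    also have "\<dots> = 2 * real j * (D + 2 * real j - 2) * \<kappa> j * s j j" unfolding k by simp
    finally have "p j + q j = (2 * real (Suc m - j) * (2 * real (Suc m - j) - 2 + D + 4 * real j) + 2 * real j * (D + 2 * real j - 2)) * (\<kappa> j * s j j)"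
      unfolding p_def by (simp only: distrib_right mult.assoc)
    also have "real (Suc m - j) = real m + 1 - real j" using j by (simp add: of_nat_diff)
    finally show "p j + q j = (2 * real m + 2) * (2 * real m + D) * (\<kappa> j * s j j)" by (simp add: algebra_simps)
  qed
  also have "\<dots> = (2 * real m + 2) * (2 * real m + D) * (\<Sum>j\<le>Suc m. \<kappa> j * s j j)" by (simp only: sum_distrib_left)
  finally have "(\<Sum>j\<le>Suc m. \<kappa> j * s j j) = 0"
    using D0 by (simp del: sum.atMost_Suc add: add_nonneg_eq_0_iff)
  thus ?case by (simp add: \<kappa>_def s_def Y_def D_def)
qed

end

lemma sum_atMost_even_odd: "(\<Sum>k\<le>2 * m. f k) = (\<Sum>j\<le>m. f (2 * j)) + (\<Sum>j<m. f (Suc (2 * j)))"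
  for f :: "nat \<Rightarrow> 'a::comm_monoid_add"
  by (induction m) (simp_all add: ac_simps)

lemma Re_even_power:
  "Re ((of_real x + \<i> * of_real y) ^ (2 * m)) = (\<Sum>j\<le>m. real ((2 * m) choose (2 * j)) * (- 1) ^ j * x ^ (2 * (m - j)) * y ^ (2 * j))"
proof -
  have iy: "(\<i> * of_real y) ^ (2 * j) = of_real ((- 1) ^ j * y ^ (2 * j))" for j
  proof -
    have "(\<i> * of_real y) ^ (2 * j) = complex_of_real ((- (y\<^sup>2)) ^ j)" by (simp add: power_mult power_mult_distrib)
    also have "(- (y\<^sup>2)) ^ j = (- 1) ^ j * y ^ (2 * j)" by (subst power_minus) (simp add: power_mult)
    finally show ?thesis .
  qed
  have even: "Re (of_nat ((2 * m) choose (2 * j)) * (\<i> * of_real y) ^ (2 * j) * of_real x ^ (2 * m - 2 * j)) =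
       real ((2 * m) choose (2 * j)) * (- 1) ^ j * x ^ (2 * (m - j)) * y ^ (2 * j)" for j
  proof -
    have "of_nat ((2 * m) choose (2 * j)) * (\<i> * of_real y) ^ (2 * j) * of_real x ^ (2 * m - 2 * j)
       = complex_of_real (real ((2 * m) choose (2 * j)) * ((- 1) ^ j * y ^ (2 * j)) * x ^ (2 * m - 2 * j))"
      unfolding iy by simp
    hence "Re (of_nat ((2 * m) choose (2 * j)) * (\<i> * of_real y) ^ (2 * j) * of_real x ^ (2 * m - 2 * j))
       = real ((2 * m) choose (2 * j)) * ((- 1) ^ j * y ^ (2 * j)) * x ^ (2 * m - 2 * j)"
      by (simp only: Re_complex_of_real)
    moreover have "2 * (m - j) = 2 * m - 2 * j" by (rule diff_mult_distrib2)
    ultimately show ?thesis by (simp only: mult_ac)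
  qed
  have odd: "Re (of_nat ((2 * m) choose (Suc (2 * j))) * (\<i> * of_real y) ^ (Suc (2 * j)) * of_real x ^ (2 * m - Suc (2 * j))) = 0" for j
  proof -
    have "of_nat ((2 * m) choose (Suc (2 * j))) * (\<i> * of_real y) ^ (Suc (2 * j)) * of_real x ^ (2 * m - Suc (2 * j))
       = \<i> * complex_of_real (real ((2 * m) choose (Suc (2 * j))) * (y * ((- 1) ^ j * y ^ (2 * j))) * x ^ (2 * m - Suc (2 * j)))"
      unfolding power_Suc iy by simp
    thus ?thesis by (simp only: Re_i_times Im_complex_of_real)
  qed
  have "(of_real x + \<i> * of_real y) ^ (2 * m) = (\<Sum>k\<le>2 * m. of_nat ((2 * m) choose k) * (\<i> * of_real y) ^ k * of_real x ^ (2 * m - k))"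
    by (subst add.commute) (rule binomial_ring)
  also have "Re \<dots> = (\<Sum>k\<le>2 * m. Re (of_nat ((2 * m) choose k) * (\<i> * of_real y) ^ k * of_real x ^ (2 * m - k)))"
    by (rule Re_sum)
  also have "\<dots> = (\<Sum>j\<le>m. Re (of_nat ((2 * m) choose (2 * j)) * (\<i> * of_real y) ^ (2 * j) * of_real x ^ (2 * m - 2 * j)))
     + (\<Sum>j<m. Re (of_nat ((2 * m) choose (Suc (2 * j))) * (\<i> * of_real y) ^ (Suc (2 * j)) * of_real x ^ (2 * m - Suc (2 * j))))"
    by (rule sum_atMost_even_odd)
  also have "\<dots> = (\<Sum>j\<le>m. real ((2 * m) choose (2 * j)) * (- 1) ^ j * x ^ (2 * (m - j)) * y ^ (2 * j))"
    unfolding odd even by simp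
  finally show ?thesis .
qed

section \<open>Power sums over the minimal vectors\<close>

context leech
begin

lemma shell_2_dot: "B \<in> shell L 2 \<Longrightarrow> B \<bullet> B = 4"
  by (simp add: shell_def dot_square_norm)

text \<open>For r orthogonal to u the pair of |r| u and r is isotropic, so the real part of its
  power sum of degree 2m vanishes. Averaging over r in the hyperplane, of dimension 23, leaves a
  polynomial in \<open>u \<bullet> B\<close> alone: up to normalization the zonal harmonic of degree
  2m with pole u. The hyperplane component of B has squared length 4 - (u . B)^2.\<close>

lemma shell_zonal_sum:
  assumes u: "norm u = 1" and m: "0 < m" "m \<le> 5"
  shows "(\<Sum>B\<in>shell L 2. \<Sum>j\<le>m. sphere_moment 23 j * (real ((2 * m) choose (2 * j)) * (- 1) ^ j * (u \<bullet> B) ^ (2 * (m - j)) * (4 - (u \<bullet> B)\<^sup>2) ^ j)) = 0"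
proof -
  define V where "V = {x. u \<bullet> x = 0}"
  have "u \<noteq> 0" using u by auto
  hence dimV: "dim V = 23" unfolding V_def by (subst dim_hyperplane) auto
  have "subspace V" unfolding V_def by (rule subspace_hyperplane)
  then obtain E where E: "E \<subseteq> V" "pairwise orthogonal E" "\<And>e. e \<in> E \<Longrightarrow> norm e = 1"
      "independent E" "card E = dim V" "span E = V"
    using orthonormal_basis_subspace by blast
  have finE: "finite E" using E(4) independent_bound by blast
  define w where "w j B = real ((2 * m) choose (2 * j)) * (- 1) ^ j * (u \<bullet> B) ^ (2 * (m - j))" for j B
  have zero: "(\<Sum>j\<le>m. \<Sum>B\<in>shell L 2. w j B * (r \<bullet> r) ^ (m - j) * (r \<bullet> B) ^ (2 * j)) = 0" if r: "r \<in> span E" for r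
  proof -
    have ur: "u \<bullet> r = 0" using r E(6) by (simp add: V_def)
    have "0 = (\<Sum>B\<in>shell L 2. Re (complex_inner (norm r *\<^sub>R u) r B ^ (2 * m)))"
      unfolding Re_sum[symmetric]
      by (subst shell_isotropic_sum) (use ur u m in \<open>auto simp: dot_square_norm power2_eq_square\<close>)
    also have "\<dots> = (\<Sum>B\<in>shell L 2. \<Sum>j\<le>m. w j B * (r \<bullet> r) ^ (m - j) * (r \<bullet> B) ^ (2 * j))"
    proof (rule sum.cong[OF refl])
      fix B
      have "complex_inner (norm r *\<^sub>R u) r B = of_real (norm r * (u \<bullet> B)) + \<i> * of_real (r \<bullet> B)"
        by (simp add: complex_inner_def complex_eq_iff)
      moreover have "(norm r * (u \<bullet> B)) ^ (2 * l) = (r \<bullet> r) ^ l * (u \<bullet> B) ^ (2 * l)" for l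
        by (simp add: power_mult_distrib power_mult dot_square_norm)
      ultimately show "Re (complex_inner (norm r *\<^sub>R u) r B ^ (2 * m)) = (\<Sum>j\<le>m. w j B * (r \<bullet> r) ^ (m - j) * (r \<bullet> B) ^ (2 * j))"
        by (simp only: Re_even_power w_def) (simp only: mult_ac)
    qed
    finally have "(\<Sum>B\<in>shell L 2. \<Sum>j\<le>m. w j B * (r \<bullet> r) ^ (m - j) * (r \<bullet> B) ^ (2 * j)) = 0" by simp
    thus ?thesis by (subst sum.swap)
  qed
  have Y: "(\<Sum>e\<in>E. (e \<bullet> B)\<^sup>2) = 4 - (u \<bullet> B)\<^sup>2" if B: "B \<in> shell L 2" for B
  proof -
    define B' where "B' = B - (u \<bullet> B) *\<^sub>R u"
    have "u \<bullet> u = 1" using u by (simp add: dot_square_norm)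
    hence "B' \<in> span E" unfolding E(6) V_def B'_def by (simp add: inner_diff_right)
    from E_inner[OF finE E(2,3) this, of B] have "(\<Sum>e\<in>E. (B' \<bullet> e) * (e \<bullet> B)) = B' \<bullet> B" by simp
    moreover have "B' \<bullet> e = e \<bullet> B" if "e \<in> E" for e
    proof -
      have "u \<bullet> e = 0" using that E(1) by (auto simp: V_def)
      thus ?thesis unfolding B'_def inner_diff_left inner_scaleR_left by (simp add: inner_commute[of B e])
    qed
    moreover have "B' \<bullet> B = 4 - (u \<bullet> B)\<^sup>2" using shell_2_dot[OF B] by (simp add: B'_def inner_diff_left power2_eq_square)
    ultimately show ?thesis by (simp add: power2_eq_square)
  qed
  have "(\<Sum>j\<le>m. sphere_moment (card E) j * (\<Sum>B\<in>shell L 2. w j B * (\<Sum>e\<in>E. (e \<bullet> B)\<^sup>2) ^ j)) = 0"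
    by (rule laplacian_mean[OF finE E(2,3) zero]) (auto simp: E(5) dimV)
  hence "(\<Sum>j\<le>m. \<Sum>B\<in>shell L 2. sphere_moment 23 j * (w j B * (4 - (u \<bullet> B)\<^sup>2) ^ j)) = 0"
    by (simp add: E(5) dimV Y sum_distrib_left)
  thus ?thesis unfolding w_def by (subst sum.swap)
qed

text \<open>The five zonal polynomials form a triangular system for the even power sums. Its
  solution is the mean over the sphere of radius 2 in dimension 24, times the size of the shell,
  which is still unknown at this point.\<close>

lemma shell_power_sum_unit:
  assumes u: "norm u = 1" and m: "m \<le> 5"
  shows "(\<Sum>B\<in>shell L 2. (u \<bullet> B) ^ (2 * m)) = real (card (shell L 2)) * (4 ^ m * sphere_moment 24 m)"
proof -
  define N where "N = real (card (shell L 2))"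
  define s where "s j = (\<Sum>B\<in>shell L 2. (u \<bullet> B) ^ j)" for j
  have s0: "s 0 = N" by (simp add: s_def N_def)
  have atMost: "(\<Sum>j\<le>1. f j) = f 0 + f 1" "(\<Sum>j\<le>2. f j) = f 0 + f 1 + f 2" "(\<Sum>j\<le>3. f j) = f 0 + f 1 + f 2 + f 3"
    "(\<Sum>j\<le>4. f j) = f 0 + f 1 + f 2 + f 3 + f 4" "(\<Sum>j\<le>5. f j) = f 0 + f 1 + f 2 + f 3 + f 4 + f 5" for f :: "nat \<Rightarrow> real"
    by (simp_all add: eval_nat_numeral)
  have mom23: "sphere_moment 23 0 = 1" "sphere_moment 23 1 = 1/23" "sphere_moment 23 2 = 3/575" "sphere_moment 23 3 = 1/1035" "sphere_moment 23 4 = 7/30015" "sphere_moment 23 5 = 7/103385"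
    by (simp_all add: sphere_moment_def eval_nat_numeral)
  have mom24: "sphere_moment 24 0 = 1" "sphere_moment 24 1 = 1/24" "sphere_moment 24 2 = 1/208" "sphere_moment 24 3 = 5/5824" "sphere_moment 24 4 = 1/4992" "sphere_moment 24 5 = 3/53248"
    by (simp_all add: sphere_moment_def eval_nat_numeral)
  have choose: "(4::nat) choose 2 = 6" "(6::nat) choose 2 = 15" "(6::nat) choose 4 = 15" "(8::nat) choose 2 = 28" "(8::nat) choose 4 = 70" "(8::nat) choose 6 = 28" "(10::nat) choose 2 = 45" "(10::nat) choose 4 = 210" "(10::nat) choose 6 = 210" "(10::nat) choose 8 = 45"
    by (simp_all add: eval_nat_numeral)
  have 1: "(-4/23) * s 0 + (24/23) * s 2 = 0"
  proof -
    have "(\<Sum>j\<le>1. sphere_moment 23 j * (real ((2 * 1) choose (2 * j)) * (- 1) ^ j * (u \<bullet> B) ^ (2 * (1 - j)) * (4 - (u \<bullet> B)\<^sup>2) ^ j))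
      = (-4/23) * (u \<bullet> B) ^ 0 + (24/23) * (u \<bullet> B) ^ 2" for B
      unfolding atMost by (simp add: mom23 mom23(2)[unfolded One_nat_def] choose) (simp add: eval_nat_numeral field_simps)
    from shell_zonal_sum[OF u, of 1, unfolded this] show ?thesis
      by (simp only: s_def sum.distrib sum_distrib_left)
  qed
  have 2: "(48/575) * s 0 + (-624/575) * s 2 + (728/575) * s 4 = 0"
  proof -
    have "(\<Sum>j\<le>2. sphere_moment 23 j * (real ((2 * 2) choose (2 * j)) * (- 1) ^ j * (u \<bullet> B) ^ (2 * (2 - j)) * (4 - (u \<bullet> B)\<^sup>2) ^ j))
      = (48/575) * (u \<bullet> B) ^ 0 + (-624/575) * (u \<bullet> B) ^ 2 + (728/575) * (u \<bullet> B) ^ 4" for B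
      unfolding atMost by (simp add: mom23 mom23(2)[unfolded One_nat_def] choose) (simp add: eval_nat_numeral field_simps)
    from shell_zonal_sum[OF u, of 2, unfolded this] show ?thesis
      by (simp only: s_def sum.distrib sum_distrib_left)
  qed
  have 3: "(-64/1035) * s 0 + (448/345) * s 2 + (-224/69) * s 4 + (1792/1035) * s 6 = 0"
  proof -
    have "(\<Sum>j\<le>3. sphere_moment 23 j * (real ((2 * 3) choose (2 * j)) * (- 1) ^ j * (u \<bullet> B) ^ (2 * (3 - j)) * (4 - (u \<bullet> B)\<^sup>2) ^ j))
      = (-64/1035) * (u \<bullet> B) ^ 0 + (448/345) * (u \<bullet> B) ^ 2 + (-224/69) * (u \<bullet> B) ^ 4 + (1792/1035) * (u \<bullet> B) ^ 6" for B
      unfolding atMost by (simp add: mom23 mom23(2)[unfolded One_nat_def] choose) (simp add: eval_nat_numeral field_simps)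
    from shell_zonal_sum[OF u, of 3, unfolded this] show ?thesis
      by (simp only: s_def sum.distrib sum_distrib_left)
  qed
  have 4: "(1792/30015) * s 0 + (-3584/2001) * s 2 + (14336/2001) * s 4 + (-243712/30015) * s 6 + (8704/3335) * s 8 = 0"
  proof -
    have "(\<Sum>j\<le>4. sphere_moment 23 j * (real ((2 * 4) choose (2 * j)) * (- 1) ^ j * (u \<bullet> B) ^ (2 * (4 - j)) * (4 - (u \<bullet> B)\<^sup>2) ^ j))
      = (1792/30015) * (u \<bullet> B) ^ 0 + (-3584/2001) * (u \<bullet> B) ^ 2 + (14336/2001) * (u \<bullet> B) ^ 4 + (-243712/30015) * (u \<bullet> B) ^ 6 + (8704/3335) * (u \<bullet> B) ^ 8" for B
      unfolding atMost by (simp add: mom23 mom23(2)[unfolded One_nat_def] choose) (simp add: eval_nat_numeral field_simps)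
    from shell_zonal_sum[OF u, of 4, unfolded this] show ?thesis
      by (simp only: s_def sum.distrib sum_distrib_left)
  qed
  have 5: "(-7168/103385) * s 0 + (57344/20677) * s 2 + (-974848/62031) * s 4 + (2924544/103385) * s 6 + (-1984512/103385) * s 8 + (1323008/310155) * s 10 = 0"
  proof -
    have "(\<Sum>j\<le>5. sphere_moment 23 j * (real ((2 * 5) choose (2 * j)) * (- 1) ^ j * (u \<bullet> B) ^ (2 * (5 - j)) * (4 - (u \<bullet> B)\<^sup>2) ^ j))
      = (-7168/103385) * (u \<bullet> B) ^ 0 + (57344/20677) * (u \<bullet> B) ^ 2 + (-974848/62031) * (u \<bullet> B) ^ 4 + (2924544/103385) * (u \<bullet> B) ^ 6 + (-1984512/103385) * (u \<bullet> B) ^ 8 + (1323008/310155) * (u \<bullet> B) ^ 10" for B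
      unfolding atMost by (simp add: mom23 mom23(2)[unfolded One_nat_def] choose) (simp add: eval_nat_numeral field_simps)
    from shell_zonal_sum[OF u, of 5, unfolded this] show ?thesis
      by (simp only: s_def sum.distrib sum_distrib_left)
  qed
  have "m = 0 \<or> m = 1 \<or> m = 2 \<or> m = 3 \<or> m = 4 \<or> m = 5" using m by auto
  thus ?thesis unfolding N_def[symmetric] s_def[symmetric]
    using s0 1 2 3 4 5 by (elim disjE) (simp_all add: mom24 mom24(2)[unfolded One_nat_def])
qed

lemma shell_power_sum:
  assumes "m \<le> 5"
  shows "(\<Sum>B\<in>shell L 2. (v \<bullet> B) ^ (2 * m)) = real (card (shell L 2)) * (4 ^ m * sphere_moment 24 m) * (v \<bullet> v) ^ m"
proof (cases "v = 0")
  case True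
  thus ?thesis by (cases "m = 0") (auto simp: sphere_moment_def power_0_left)
next
  case False
  define u where "u = v /\<^sub>R norm v"
  have u: "norm u = 1" using False by (simp add: u_def)
  have v: "v = norm v *\<^sub>R u" using False by (simp add: u_def)
  have "(\<Sum>B\<in>shell L 2. (v \<bullet> B) ^ (2 * m)) = (v \<bullet> v) ^ m * (\<Sum>B\<in>shell L 2. (u \<bullet> B) ^ (2 * m))"
    by (subst v) (simp add: sum_distrib_left power_mult_distrib power_mult dot_square_norm)
  thus ?thesis using shell_power_sum_unit[OF u assms] by simp
qed

text \<open>Both sides of the power sum formula for \<alpha> A + x are polynomials in \<alpha>, and
  \<open>A \<bullet> x = 0\<close> makes the right-hand side even in \<alpha>; coefficients are
  compared.\<close>

lemma shell_mixed_moments: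
  assumes m: "m \<le> 5" and A: "A \<bullet> A = 4" "A \<bullet> x = 0"
  shows "i \<le> m \<Longrightarrow> real ((2 * m) choose (2 * i)) * (\<Sum>B\<in>shell L 2. (A \<bullet> B) ^ (2 * i) * (x \<bullet> B) ^ (2 * m - 2 * i))
      = real (card (shell L 2)) * (4 ^ m * sphere_moment 24 m) * (real (m choose i) * 4 ^ i * (x \<bullet> x) ^ (m - i))"
    and "i < m \<Longrightarrow> (\<Sum>B\<in>shell L 2. (A \<bullet> B) ^ Suc (2 * i) * (x \<bullet> B) ^ (2 * m - Suc (2 * i))) = 0"
proof -
  define c where "c = real (card (shell L 2)) * (4 ^ m * sphere_moment 24 m)"
  define S where "S l = real ((2 * m) choose l) * (\<Sum>B\<in>shell L 2. (A \<bullet> B) ^ l * (x \<bullet> B) ^ (2 * m - l))" for l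
  define d where "d l = (if even l then c * (real (m choose (l div 2)) * 4 ^ (l div 2) * (x \<bullet> x) ^ (m - l div 2)) else 0)" for l
  have "(\<Sum>l\<le>2 * m. S l * \<alpha> ^ l) = (\<Sum>l\<le>2 * m. d l * \<alpha> ^ l)" for \<alpha>
  proof -
    have "(\<Sum>l\<le>2 * m. S l * \<alpha> ^ l) = (\<Sum>l\<le>2 * m. \<Sum>B\<in>shell L 2. real ((2 * m) choose l) * (\<alpha> * (A \<bullet> B)) ^ l * (x \<bullet> B) ^ (2 * m - l))"
      unfolding S_def sum_distrib_left sum_distrib_right by (simp add: power_mult_distrib mult_ac)
    also have "\<dots> = (\<Sum>B\<in>shell L 2. (\<alpha> * (A \<bullet> B) + x \<bullet> B) ^ (2 * m))"
      by (subst sum.swap) (simp add: binomial_ring)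
    also have "\<dots> = (\<Sum>B\<in>shell L 2. ((\<alpha> *\<^sub>R A + x) \<bullet> B) ^ (2 * m))" by (simp add: inner_add_left)
    also have "\<dots> = c * ((\<alpha> *\<^sub>R A + x) \<bullet> (\<alpha> *\<^sub>R A + x)) ^ m" unfolding c_def by (rule shell_power_sum[OF m])
    also have "(\<alpha> *\<^sub>R A + x) \<bullet> (\<alpha> *\<^sub>R A + x) = 4 * \<alpha>\<^sup>2 + x \<bullet> x"
      using A by (simp add: inner_add_left inner_add_right inner_commute[of x A] power2_eq_square)
    also have "c * (4 * \<alpha>\<^sup>2 + x \<bullet> x) ^ m = (\<Sum>j\<le>m. d (2 * j) * \<alpha> ^ (2 * j))"
      unfolding binomial_ring sum_distrib_left by (simp add: d_def power_mult_distrib mult_ac flip: power_mult)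
    also have "\<dots> = (\<Sum>l\<le>2 * m. d l * \<alpha> ^ l)"
      unfolding sum_atMost_even_odd by (simp add: d_def)
    finally show ?thesis .
  qed
  hence eq: "S l = d l" if "l \<le> 2 * m" for l using polyfun_eq_coeffs[of S "2 * m" d] that by (simp add: mult.commute)
  show "i \<le> m \<Longrightarrow> real ((2 * m) choose (2 * i)) * (\<Sum>B\<in>shell L 2. (A \<bullet> B) ^ (2 * i) * (x \<bullet> B) ^ (2 * m - 2 * i))
      = real (card (shell L 2)) * (4 ^ m * sphere_moment 24 m) * (real (m choose i) * 4 ^ i * (x \<bullet> x) ^ (m - i))"
    using eq[of "2 * i"] unfolding S_def d_def c_def by simp
  show "(\<Sum>B\<in>shell L 2. (A \<bullet> B) ^ Suc (2 * i) * (x \<bullet> B) ^ (2 * m - Suc (2 * i))) = 0" if "i < m"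
  proof -
    have "real ((2 * m) choose (Suc (2 * i))) * (\<Sum>B\<in>shell L 2. (A \<bullet> B) ^ Suc (2 * i) * (x \<bullet> B) ^ (2 * m - Suc (2 * i))) = 0"
      using eq[of "Suc (2 * i)"] that unfolding S_def d_def by simp
    moreover have "(2 * m) choose (Suc (2 * i)) > 0" using that by simp
    ultimately show ?thesis by simp
  qed
qed

end

subsection \<open>The layers of minimal vectors around a minimal vector\<close>

locale leech_pole = leech +
  fixes A assumes A: "A \<in> shell L 2"
begin

definition layer :: "real \<Rightarrow> (real^24) set" where
  "layer a = {B \<in> shell L 2. A \<bullet> B = a}"

lemma A_L: "A \<in> L" and A_dot: "A \<bullet> A = 4"
  using A shell_2_dot by (auto simp: shell_def)

lemma shell_mem: "B \<in> shell L 2 \<longleftrightarrow> B \<in> L \<and> B \<bullet> B = 4"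
  by (auto simp: shell_def dot_square_norm)

lemma finite_layer: "finite (layer a)"
  using finite_shell by (simp add: layer_def)

lemma no_norm_2: "x \<in> L \<Longrightarrow> x \<bullet> x \<noteq> 2"
  using leech by (auto simp: leech_lattice_def dot_square_norm)

lemma norm_ge_4:
  assumes "x \<in> L" "x \<noteq> 0"
  shows "x \<bullet> x \<ge> 4"
  using level[OF assms(1)] level_ne_1[OF assms(1)] level_eq_0[OF assms(1)] assms(2) by linarith

lemma shell_dot_cases:
  assumes "B \<in> shell L 2" "C \<in> shell L 2" "B \<noteq> C" "B \<noteq> - C"
  shows "B \<bullet> C \<in> {-2, -1, 0, 1, 2}"
proof -
  have BC: "B \<in> L" "C \<in> L" "B \<bullet> B = 4" "C \<bullet> C = 4" using assms by (auto simp: shell_mem)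
  have "(B - C) \<bullet> (B - C) \<ge> 4" by (rule norm_ge_4) (use assms BC diff_mem in auto)
  hence 1: "B \<bullet> C \<le> 2" using BC by (simp add: inner_diff_left inner_diff_right inner_commute[of C B])
  have "B + C \<noteq> 0" using assms(4) by (simp add: eq_neg_iff_add_eq_0)
  hence "(B + C) \<bullet> (B + C) \<ge> 4" by (intro norm_ge_4 add_mem BC)
  hence 2: "B \<bullet> C \<ge> -2" using BC by (simp add: inner_add_left inner_add_right inner_commute[of C B])
  obtain k :: int where k: "B \<bullet> C = of_int k" using inner_Ints[OF BC(1,2)] by (auto elim: Ints_cases)
  hence "k = -2 \<or> k = -1 \<or> k = 0 \<or> k = 1 \<or> k = 2" using 1 2 by auto
  thus ?thesis using k by auto
qed

lemma layer_uminus: "layer (- a) = uminus ` layer a"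
proof -
  have "- B \<in> shell L 2 \<longleftrightarrow> B \<in> shell L 2" for B using uminus_mem[of B] uminus_mem[of "- B"] by (auto simp: shell_mem)
  moreover have "x \<in> uminus ` layer a \<longleftrightarrow> - x \<in> layer a" for x by (metis (no_types, lifting) image_iff minus_minus)
  ultimately show ?thesis by (auto simp: layer_def)
qed

lemma layer_4: "layer 4 = {A}"
proof -
  have "B = A" if "B \<in> shell L 2" "A \<bullet> B = 4" for B
  proof -
    have "(A - B) \<bullet> (A - B) = 0" using that A_dot by (simp add: shell_mem inner_diff_left inner_diff_right inner_commute[of B A])
    thus ?thesis by simp
  qed
  thus ?thesis using A A_dot by (auto simp: layer_def)
qed

lemma sum_shell_layers:
  "(\<Sum>B\<in>shell L 2. F B) = F A + F (- A) + (\<Sum>B\<in>layer 2. F B + F (- B)) + (\<Sum>B\<in>layer 1. F B + F (- B)) + (\<Sum>B\<in>layer 0. F B)"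
  for F :: "real^24 \<Rightarrow> real"
proof -
  have neg: "(\<Sum>B\<in>layer (- a). F B) = (\<Sum>B\<in>layer a. F (- B))" for a
    unfolding layer_uminus by (subst sum.reindex) (auto simp: inj_on_def)
  have "shell L 2 \<subseteq> (\<Union>a\<in>{4, -4, 2, -2, 1, -1, 0}. layer a)"
  proof
    fix B assume B: "B \<in> shell L 2"
    have "A \<bullet> B \<in> {4, -4, 2, -2, 1, -1, 0}"
    proof (cases "B = A \<or> B = - A")
      case False
      hence "B \<bullet> A \<in> {-2, -1, 0, 1, 2}" using shell_dot_cases[OF B A] by blast
      thus ?thesis by (auto simp: inner_commute)
    qed (use A_dot in auto)
    thus "B \<in> (\<Union>a\<in>{4, -4, 2, -2, 1, -1, 0}. layer a)" using B by (auto simp: layer_def)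
  qed
  hence shell: "shell L 2 = (\<Union>a\<in>{4, -4, 2, -2, 1, -1, 0}. layer a)" by (auto simp: layer_def)
  have "(\<Sum>B\<in>shell L 2. F B) = (\<Sum>a\<in>{4, -4, 2, -2, 1, -1, 0}. \<Sum>B\<in>layer a. F B)"
    by (subst shell, rule sum.UNION_disjoint) (simp_all only: finite_layer finite.intros ball_simps, auto simp: layer_def)
  also have "\<dots> = (\<Sum>B\<in>layer 4. F B) + (\<Sum>B\<in>layer (- 4). F B) + (\<Sum>B\<in>layer 2. F B) + (\<Sum>B\<in>layer (- 2). F B)
     + (\<Sum>B\<in>layer 1. F B) + (\<Sum>B\<in>layer (- 1). F B) + (\<Sum>B\<in>layer 0. F B)"
    by simp
  finally show ?thesis unfolding neg layer_4 by (simp add: sum.distrib)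
qed

definition layer_sum :: "real \<Rightarrow> nat \<Rightarrow> real^24 \<Rightarrow> real" where
  "layer_sum a j x = (\<Sum>B\<in>layer a. (x \<bullet> B) ^ j)"

text \<open>Opposite layers contribute equally because l + j is even. With \<open>0 ^ 0 = 1\<close>,
  the vectors +-A count only for j = 0 and layer 0 only for l = 0.\<close>

lemma mixed_layer_sum:
  assumes "A \<bullet> x = 0" "even (l + j)"
  shows "(\<Sum>B\<in>shell L 2. (A \<bullet> B) ^ l * (x \<bullet> B) ^ j)
     = 2 * 4 ^ l * 0 ^ j + 2 * 2 ^ l * layer_sum 2 j x + 2 * layer_sum 1 j x + 0 ^ l * layer_sum 0 j x"
proof -
  have neg: "(A \<bullet> - B) ^ l * (x \<bullet> - B) ^ j = (A \<bullet> B) ^ l * (x \<bullet> B) ^ j" for B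
  proof -
    have "(A \<bullet> - B) ^ l * (x \<bullet> - B) ^ j = (- 1) ^ (l + j) * ((A \<bullet> B) ^ l * (x \<bullet> B) ^ j)"
      unfolding inner_minus_right power_minus[of "A \<bullet> B"] power_minus[of "x \<bullet> B"] power_add by (simp only: mult_ac)
    thus ?thesis using assms(2) by simp
  qed
  have lay: "(\<Sum>B\<in>layer a. (A \<bullet> B) ^ l * (x \<bullet> B) ^ j) = a ^ l * layer_sum a j x" for a
    unfolding layer_sum_def sum_distrib_left by (rule sum.cong) (auto simp: layer_def)
  show ?thesis
    unfolding sum_shell_layers neg sum.distrib lay using assms(1) A_dot by (simp add: inner_commute)
qed

text \<open>With h the squared length 4 - a^2/4 of the hyperplane components, this says that the
  components of the layer form a spherical 7-design on the sphere of radius sqrt h.\<close>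

definition layer_moment :: "real \<Rightarrow> real \<Rightarrow> bool" where
  "layer_moment a h \<longleftrightarrow> (\<forall>x j. A \<bullet> x = 0 \<longrightarrow> j \<le> 7 \<longrightarrow>
     layer_sum a j x = real (card (layer a)) * (if even j then sphere_moment 23 (j div 2) * (h * (x \<bullet> x)) ^ (j div 2) else 0))"

text \<open>Each group belongs to one degree j in x and runs through the powers 0, 2, 4 of
  \<open>A \<bullet> B\<close>; degree 0 adds the power 6, because N is unknown too.\<close>

lemma shell_even_moments:
  assumes "A \<bullet> x = 0"
  defines "N \<equiv> real (card (shell L 2))"
  shows "2 + 2 * layer_sum 2 0 x + 2 * layer_sum 1 0 x + layer_sum 0 0 x = N"
    and "32 + 8 * layer_sum 2 0 x + 2 * layer_sum 1 0 x = 2/3 * N"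
    and "512 + 32 * layer_sum 2 0 x + 2 * layer_sum 1 0 x = 16/13 * N"
    and "8192 + 128 * layer_sum 2 0 x + 2 * layer_sum 1 0 x = 320/91 * N"
    and "2 * layer_sum 2 2 x + 2 * layer_sum 1 2 x + layer_sum 0 2 x = 1/6 * N * (x \<bullet> x)"
    and "8 * layer_sum 2 2 x + 2 * layer_sum 1 2 x = 4/39 * N * (x \<bullet> x)"
    and "32 * layer_sum 2 2 x + 2 * layer_sum 1 2 x = 16/91 * N * (x \<bullet> x)"
    and "2 * layer_sum 2 4 x + 2 * layer_sum 1 4 x + layer_sum 0 4 x = 1/13 * N * (x \<bullet> x) ^ 2"
    and "8 * layer_sum 2 4 x + 2 * layer_sum 1 4 x = 4/91 * N * (x \<bullet> x) ^ 2"
    and "32 * layer_sum 2 4 x + 2 * layer_sum 1 4 x = 32/455 * N * (x \<bullet> x) ^ 2"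
    and "2 * layer_sum 2 6 x + 2 * layer_sum 1 6 x + layer_sum 0 6 x = 5/91 * N * (x \<bullet> x) ^ 3"
    and "8 * layer_sum 2 6 x + 2 * layer_sum 1 6 x = 8/273 * N * (x \<bullet> x) ^ 3"
    and "32 * layer_sum 2 6 x + 2 * layer_sum 1 6 x = 4/91 * N * (x \<bullet> x) ^ 3"
proof -
  have mom24: "sphere_moment 24 0 = 1" "sphere_moment 24 1 = 1/24" "sphere_moment 24 2 = 1/208" "sphere_moment 24 3 = 5/5824" "sphere_moment 24 4 = 1/4992" "sphere_moment 24 5 = 3/53248"
    by (simp_all add: sphere_moment_def eval_nat_numeral)
  have choose: "(2::nat) choose 1 = 2" "(3::nat) choose 1 = 3" "(3::nat) choose 2 = 3" "(4::nat) choose 1 = 4" "(4::nat) choose 2 = 6" "(5::nat) choose 2 = 10" "(6::nat) choose 2 = 15" "(6::nat) choose 4 = 15" "(8::nat) choose 2 = 28" "(8::nat) choose 4 = 70" "(10::nat) choose 4 = 210"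
    by (simp_all add: eval_nat_numeral)
  show "2 + 2 * layer_sum 2 0 x + 2 * layer_sum 1 0 x + layer_sum 0 0 x = N"
    using mixed_layer_sum[OF assms(1), of 0 0] shell_mixed_moments(1)[OF _ A_dot assms(1), of 0 0]
    by (simp add: N_def mom24 mom24(2)[unfolded One_nat_def] choose)
  show "32 + 8 * layer_sum 2 0 x + 2 * layer_sum 1 0 x = 2/3 * N"
    using mixed_layer_sum[OF assms(1), of 2 0] shell_mixed_moments(1)[OF _ A_dot assms(1), of 1 1]
    by (simp add: N_def mom24 mom24(2)[unfolded One_nat_def] choose)
  show "512 + 32 * layer_sum 2 0 x + 2 * layer_sum 1 0 x = 16/13 * N"
    using mixed_layer_sum[OF assms(1), of 4 0] shell_mixed_moments(1)[OF _ A_dot assms(1), of 2 2]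
    by (simp add: N_def mom24 mom24(2)[unfolded One_nat_def] choose)
  show "8192 + 128 * layer_sum 2 0 x + 2 * layer_sum 1 0 x = 320/91 * N"
    using mixed_layer_sum[OF assms(1), of 6 0] shell_mixed_moments(1)[OF _ A_dot assms(1), of 3 3]
    by (simp add: N_def mom24 mom24(2)[unfolded One_nat_def] choose)
  show "2 * layer_sum 2 2 x + 2 * layer_sum 1 2 x + layer_sum 0 2 x = 1/6 * N * (x \<bullet> x)"
    using mixed_layer_sum[OF assms(1), of 0 2] shell_mixed_moments(1)[OF _ A_dot assms(1), of 1 0]
    by (simp add: N_def mom24 mom24(2)[unfolded One_nat_def] choose)
  show "8 * layer_sum 2 2 x + 2 * layer_sum 1 2 x = 4/39 * N * (x \<bullet> x)"
    using mixed_layer_sum[OF assms(1), of 2 2] shell_mixed_moments(1)[OF _ A_dot assms(1), of 2 1]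
    by (simp add: N_def mom24 mom24(2)[unfolded One_nat_def] choose)
  show "32 * layer_sum 2 2 x + 2 * layer_sum 1 2 x = 16/91 * N * (x \<bullet> x)"
    using mixed_layer_sum[OF assms(1), of 4 2] shell_mixed_moments(1)[OF _ A_dot assms(1), of 3 2]
    by (simp add: N_def mom24 mom24(2)[unfolded One_nat_def] choose)
  show "2 * layer_sum 2 4 x + 2 * layer_sum 1 4 x + layer_sum 0 4 x = 1/13 * N * (x \<bullet> x) ^ 2"
    using mixed_layer_sum[OF assms(1), of 0 4] shell_mixed_moments(1)[OF _ A_dot assms(1), of 2 0]
    by (simp add: N_def mom24 mom24(2)[unfolded One_nat_def] choose)
  show "8 * layer_sum 2 4 x + 2 * layer_sum 1 4 x = 4/91 * N * (x \<bullet> x) ^ 2"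
    using mixed_layer_sum[OF assms(1), of 2 4] shell_mixed_moments(1)[OF _ A_dot assms(1), of 3 1]
    by (simp add: N_def mom24 mom24(2)[unfolded One_nat_def] choose)
  show "32 * layer_sum 2 4 x + 2 * layer_sum 1 4 x = 32/455 * N * (x \<bullet> x) ^ 2"
    using mixed_layer_sum[OF assms(1), of 4 4] shell_mixed_moments(1)[OF _ A_dot assms(1), of 4 2]
    by (simp add: N_def mom24 mom24(2)[unfolded One_nat_def] choose)
  show "2 * layer_sum 2 6 x + 2 * layer_sum 1 6 x + layer_sum 0 6 x = 5/91 * N * (x \<bullet> x) ^ 3"
    using mixed_layer_sum[OF assms(1), of 0 6] shell_mixed_moments(1)[OF _ A_dot assms(1), of 3 0]
    by (simp add: N_def mom24 mom24(2)[unfolded One_nat_def] choose)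
  show "8 * layer_sum 2 6 x + 2 * layer_sum 1 6 x = 8/273 * N * (x \<bullet> x) ^ 3"
    using mixed_layer_sum[OF assms(1), of 2 6] shell_mixed_moments(1)[OF _ A_dot assms(1), of 4 1]
    by (simp add: N_def mom24 mom24(2)[unfolded One_nat_def] choose)
  show "32 * layer_sum 2 6 x + 2 * layer_sum 1 6 x = 4/91 * N * (x \<bullet> x) ^ 3"
    using mixed_layer_sum[OF assms(1), of 4 6] shell_mixed_moments(1)[OF _ A_dot assms(1), of 5 2]
    by (simp add: N_def mom24 mom24(2)[unfolded One_nat_def] choose)
qed

lemma layer_sum_0: "layer_sum a 0 x = real (card (layer a))"
  by (simp add: layer_sum_def)

lemma shell_layer_cards:
  "card (shell L 2) = 196560" "card (layer 2) = 4600" "card (layer 1) = 47104" "card (layer 0) = 93150"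
proof -
  note eqs = shell_even_moments(1-4)[of 0, unfolded layer_sum_0, simplified]
  have "real (card (shell L 2)) = 196560" "real (card (layer 2)) = 4600" "real (card (layer 1)) = 47104" "real (card (layer 0)) = 93150"
    using eqs by linarith+
  thus "card (shell L 2) = 196560" "card (layer 2) = 4600" "card (layer 1) = 47104" "card (layer 0) = 93150"
    by linarith+
qed

text \<open>Layer 0 is stable under negation and layer 2 under B \<mapsto> A - B, which negates the
  hyperplane component. Layer 1 has no such symmetry; there the mixed moment with one factor
  \<open>A \<bullet> B\<close> is used, whose total degree j + 1 is at most 10.\<close>

lemma layer_sum_odd:
  assumes x: "A \<bullet> x = 0" and j: "odd j"
  shows "layer_sum 0 j x = 0" and "layer_sum 2 j x = 0" and "j \<le> 9 \<Longrightarrow> layer_sum 1 j x = 0"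
proof -
  have pw: "(- y) ^ j = - (y ^ j)" for y :: real using j by simp
  have "layer_sum 0 j x = (\<Sum>B\<in>uminus ` layer 0. (x \<bullet> B) ^ j)" using layer_uminus[of 0] by (simp add: layer_sum_def)
  also have "\<dots> = - layer_sum 0 j x" by (subst sum.reindex) (auto simp: inj_on_def layer_sum_def pw sum_negf)
  finally show "layer_sum 0 j x = 0" by simp
  have "A - B \<in> layer 2" if "B \<in> layer 2" for B
    using that diff_mem[OF A_L] A_dot
    by (auto simp: layer_def shell_mem inner_diff_left inner_diff_right inner_commute[of B A])
  hence "bij_betw (\<lambda>B. A - B) (layer 2) (layer 2)" by (intro bij_betwI[where g = "\<lambda>B. A - B"]) auto
  from sum.reindex_bij_betw[OF this, of "\<lambda>B. (x \<bullet> B) ^ j"]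
  have "layer_sum 2 j x = (\<Sum>B\<in>layer 2. (x \<bullet> (A - B)) ^ j)" by (simp add: layer_sum_def)
  also have "\<dots> = - layer_sum 2 j x" using x by (simp add: inner_diff_right inner_commute[of x A] layer_sum_def pw sum_negf)
  finally show l2: "layer_sum 2 j x = 0" by simp
  show "layer_sum 1 j x = 0" if "j \<le> 9"
  proof -
    obtain i where i: "j = 2 * i + 1" using j by (auto elim: oddE)
    have "(\<Sum>B\<in>shell L 2. (A \<bullet> B) ^ 1 * (x \<bullet> B) ^ j) = 0"
      using shell_mixed_moments(2)[OF _ A_dot x, of "i + 1" 0] that i by simp
    thus ?thesis using mixed_layer_sum[OF x, of 1 j] l2 j i by (simp add: power_0_left)
  qed
qed

lemma layer_moments: "layer_moment 2 3" "layer_moment 1 (15/4)" "layer_moment 0 4"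
proof -
  have mom23: "sphere_moment 23 0 = 1" "sphere_moment 23 1 = 1/23" "sphere_moment 23 2 = 3/575" "sphere_moment 23 3 = 1/1035"
    by (simp_all add: sphere_moment_def eval_nat_numeral)
  have "(layer_sum a j x = real (card (layer a)) * (if even j then sphere_moment 23 (j div 2) * (h * (x \<bullet> x)) ^ (j div 2) else 0))"
    if x: "A \<bullet> x = 0" and j: "j \<le> 7" and ah: "(a, h) \<in> {(2, 3), (1, 15/4), (0, 4)}" for a h :: real and x j
  proof (cases "even j")
    case False
    thus ?thesis using layer_sum_odd[OF x] j ah by auto
  next
    case True
    define X where "X = x \<bullet> x"
    note eqs = shell_even_moments[OF x, unfolded shell_layer_cards, folded X_def]
    have "j = 0 \<or> j = 2 \<or> j = 4 \<or> j = 6" using True j by presburger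
    moreover have "layer_sum 2 2 x = 600 * X" "layer_sum 1 2 x = 7680 * X" "layer_sum 0 2 x = 16200 * X"
      using eqs(5-7) by linarith+
    moreover have "layer_sum 2 4 x = 216 * X ^ 2" "layer_sum 1 4 x = 3456 * X ^ 2" "layer_sum 0 4 x = 7776 * X ^ 2"
      using eqs(8-10) by linarith+
    moreover have "layer_sum 2 6 x = 120 * X ^ 3" "layer_sum 1 6 x = 2400 * X ^ 3" "layer_sum 0 6 x = 5760 * X ^ 3"
      using eqs(11-13) by linarith+
    moreover have "a = 2 \<and> h = 3 \<or> a = 1 \<and> h = 15/4 \<or> a = 0 \<and> h = 4" using ah by auto
    ultimately show ?thesis
      unfolding X_def[symmetric]
      by (elim disjE conjE)
         (simp_all only: layer_sum_0 shell_layer_cards, simp_all add: mom23 mom23(2)[unfolded One_nat_def] power_mult_distrib power_divide)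
  qed
  thus "layer_moment 2 3" "layer_moment 1 (15/4)" "layer_moment 0 4" by (simp_all add: layer_moment_def)
qed

end

subsection \<open>Hermite interpolation\<close>

text \<open>Newton's construction: W vanishes doubly at the old nodes, so a multiple of W by a
  linear polynomial M adjusts value and derivative at the new node without disturbing the others.
  For empty S the degree bound reads 0, by truncated subtraction.\<close>

lemma hermite_interpolant_exists:
  fixes f f' :: "real \<Rightarrow> real"
  assumes "finite S"
  shows "\<exists>p. (\<forall>s\<in>S. poly p s = f s \<and> poly (pderiv p) s = f' s) \<and> degree p \<le> 2 * card S - 1"
  using assms
proof (induction S rule: finite_induct)
  case empty
  show ?case by (intro exI[of _ 0]) auto
next
  case (insert t S)
  then obtain p where p: "\<forall>s\<in>S. poly p s = f s \<and> poly (pderiv p) s = f' s" "degree p \<le> 2 * card S - 1" by blast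
  define V where "V = (\<Prod>s\<in>S. [:- s, 1:])"
  define W where "W = V ^ 2"
  have "poly V s = 0" if "s \<in> S" for s using that insert.hyps by (auto simp: V_def poly_prod)
  hence W0: "poly W s = 0" "poly (pderiv W) s = 0" if "s \<in> S" for s
    using that by (auto simp: W_def power2_eq_square pderiv_mult)
  have Wt: "poly W t \<noteq> 0" using insert.hyps by (auto simp: W_def V_def poly_prod)
  have "degree V = card S" unfolding V_def by (subst degree_prod_eq_sum_degree) auto
  hence dW: "degree W \<le> 2 * card S" unfolding W_def using degree_power_le[of V 2] by simp
  define a where "a = (f t - poly p t) / poly W t"
  define b where "b = (f' t - poly (pderiv p) t - poly (pderiv W) t * a) / poly W t"
  define M where "M = [:a - b * t, b:]"
  have M: "poly M t = a" "pderiv M = [:b:]" by (simp_all add: M_def pderiv_pCons)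
  define q where "q = p + W * M"
  have "poly q s = f s \<and> poly (pderiv q) s = f' s" if "s \<in> insert t S" for s
    using that p(1) W0 Wt unfolding q_def pderiv_add pderiv_mult M by (auto simp: M a_def b_def)
  moreover have "degree q \<le> 2 * card (insert t S) - 1"
  proof -
    have "degree M \<le> 1" by (simp add: M_def)
    hence "degree (W * M) \<le> 2 * card S + 1"
      using degree_mult_le[of W M] dW by linarith
    thus ?thesis unfolding q_def using insert.hyps p(2) by (intro degree_add_le) auto
  qed
  ultimately show ?case by blast
qed

text \<open>Between neighbouring zeros lies a new one. The clause that each new zero is below some
  element of Z separates those found so far from the one obtained when a larger zero is inserted, so
  the count is right.\<close>

lemma rolle_zeros:
  fixes g g' :: "real \<Rightarrow> real"
  assumes "finite Z" and "Z \<subseteq> {a..b}" and "continuous_on {a..b} g"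
    and "\<And>x. a < x \<Longrightarrow> x < b \<Longrightarrow> (g has_real_derivative g' x) (at x)" and "\<And>z. z \<in> Z \<Longrightarrow> g z = 0"
  shows "\<exists>Z'. finite Z' \<and> card Z' = card Z - 1 \<and> (\<forall>z\<in>Z'. g' z = 0 \<and> z \<notin> Z \<and> a < z \<and> z < b \<and> (\<exists>v\<in>Z. z < v))"
  using assms(1,2,5)
proof (induction Z rule: finite_linorder_max_induct)
  case empty
  show ?case by (intro exI[of _ "{}"]) auto
next
  case (insert v Z)
  show ?case
  proof (cases "Z = {}")
    case True
    thus ?thesis by (intro exI[of _ "{}"]) auto
  next
    case False
    obtain Z' where Z': "finite Z'" "card Z' = card Z - 1" "\<forall>z\<in>Z'. g' z = 0 \<and> z \<notin> Z \<and> a < z \<and> z < b \<and> (\<exists>v\<in>Z. z < v)"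
      using insert by auto
    define m where "m = Max Z"
    have m: "m \<in> Z" "\<And>z. z \<in> Z \<Longrightarrow> z \<le> m" using False insert.hyps by (auto simp: m_def)
    have mv: "a \<le> m" "m < v" "v \<le> b" using m insert by auto
    have "\<exists>z. m < z \<and> z < v \<and> (g has_real_derivative 0) (at z)"
    proof (rule Rolle[OF mv(2)])
      show "g m = g v" using m insert.prems(2) by simp
      show "continuous_on {m..v} g" by (rule continuous_on_subset[OF assms(3)]) (use mv in auto)
      show "g differentiable (at x)" if "m < x" "x < v" for x
        using assms(4)[of x] that mv real_differentiable_def by force
    qed
    then obtain z where z: "m < z" "z < v" "(g has_real_derivative 0) (at z)" by blast
    hence "g' z = 0" using assms(4)[of z] mv DERIV_unique by force
    moreover have "z \<notin> Z'" "z \<notin> Z" using Z'(3) m(2) z(1) by force+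
    moreover have "v \<notin> Z'" using Z'(3) insert.hyps by force
    moreover have "v \<notin> Z" using insert.hyps by auto
    moreover have "card Z > 0" using False insert.hyps by (simp add: card_gt_0_iff)
    ultimately show ?thesis
      using Z' z mv insert.hyps
      by (intro exI[of _ "insert z Z'"]) (auto intro: less_trans)
  qed
qed

lemma rolle_iterate:
  fixes G :: "nat \<Rightarrow> real \<Rightarrow> real"
  assumes "finite Z" "n < card Z" "Z \<subseteq> {a<..<b}" "\<And>z. z \<in> Z \<Longrightarrow> G 0 z = 0"
    and "\<And>j x. j < n \<Longrightarrow> a < x \<Longrightarrow> x < b \<Longrightarrow> (G j has_real_derivative G (Suc j) x) (at x)"
  shows "\<exists>\<xi>. a < \<xi> \<and> \<xi> < b \<and> G n \<xi> = 0"
  using assms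
proof (induction n arbitrary: G Z)
  case 0
  then obtain z where "z \<in> Z" by fastforce
  thus ?case using 0 by (intro exI[of _ z]) auto
next
  case (Suc n)
  have ne: "Z \<noteq> {}" using Suc.prems by auto
  have mm: "Min Z \<in> Z" "Max Z \<in> Z" using ne Suc.prems(1) by auto
  have cont: "continuous_on {Min Z..Max Z} (G 0)"
  proof (rule DERIV_continuous_on)
    fix x assume "x \<in> {Min Z..Max Z}"
    hence "a < x" "x < b" using mm Suc.prems(3) by force+
    thus "(G 0 has_real_derivative G 1 x) (at x within {Min Z..Max Z})"
      using Suc.prems(5)[of 0 x] by (auto intro: has_field_derivative_at_within)
  qed
  have "\<exists>Z'. finite Z' \<and> card Z' = card Z - 1 \<and> (\<forall>z\<in>Z'. G 1 z = 0 \<and> z \<notin> Z \<and> Min Z < z \<and> z < Max Z \<and> (\<exists>v\<in>Z. z < v))"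
  proof (rule rolle_zeros[OF Suc.prems(1) _ cont])
    show "Z \<subseteq> {Min Z..Max Z}" using Suc.prems(1) by auto
    show "(G 0 has_real_derivative G 1 x) (at x)" if "Min Z < x" "x < Max Z" for x
      using that mm Suc.prems(3) Suc.prems(5)[of 0 x] by force
  qed (use Suc.prems in auto)
  then obtain Z' where Z': "finite Z'" "card Z' = card Z - 1" "\<And>z. z \<in> Z' \<Longrightarrow> G 1 z = 0 \<and> Min Z < z \<and> z < Max Z" by blast
  have "Z' \<subseteq> {a<..<b}" using Z'(3) mm Suc.prems(3) by force
  thus ?case
    using Suc.IH[of Z' "\<lambda>j. G (Suc j)"] Z' Suc.prems(2,5) by auto
qed

text \<open>The classical remainder formula. With c chosen so that f - p - c W also vanishes at t,
  there are card S + 1 zeros; its derivative vanishes between them and at the nodes, hence at 2 card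
  S points. Rolle then gives a point where the derivative of order 2 card S equals (2 card S)! c, so
  c > 0. The first application of Rolle is separate because t may be an endpoint, where f is merely
  continuous.\<close>

lemma hermite_error_pos:
  fixes f :: "real \<Rightarrow> real" and p :: "real poly"
  assumes S: "finite S" "S \<noteq> {}" "S \<subseteq> {a<..<b}" and t: "t \<in> {a..b}" "t \<notin> S"
    and p: "\<And>s. s \<in> S \<Longrightarrow> poly p s = f s \<and> poly (pderiv p) s = deriv f s" "degree p \<le> 2 * card S - 1"
    and cont: "continuous_on {a..b} f"
    and diff: "\<And>j x. j < 2 * card S \<Longrightarrow> a < x \<Longrightarrow> x < b \<Longrightarrow> (deriv ^^ j) f differentiable (at x)"
    and pos: "\<And>x. a < x \<Longrightarrow> x < b \<Longrightarrow> (deriv ^^ (2 * card S)) f x > 0"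
  shows "poly p t < f t"
proof -
  define n where "n = card S"
  have n: "n > 0" using S by (simp add: n_def card_gt_0_iff)
  define V where "V = (\<Prod>s\<in>S. [:- s, 1:])"
  define W where "W = V ^ 2"
  have "poly V s = 0" if "s \<in> S" for s using that S by (auto simp: V_def poly_prod)
  hence W0: "poly W s = 0" "poly (pderiv W) s = 0" if "s \<in> S" for s
    using that by (auto simp: W_def power2_eq_square pderiv_mult)
  have Wt: "poly W t > 0" using S t by (auto simp: W_def V_def poly_prod)
  have "degree V = n" unfolding V_def n_def by (subst degree_prod_eq_sum_degree) auto
  moreover have V: "lead_coeff V = 1" unfolding V_def by (simp add: lead_coeff_prod)
  ultimately have W: "degree W = 2 * n" unfolding W_def by (subst degree_power_eq) auto
  moreover have "lead_coeff W = 1" unfolding W_def lead_coeff_power V by simp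
  ultimately have W2: "coeff W (2 * n) = 1" by simp
  define c where "c = (f t - poly p t) / poly W t"
  define q where "q = p + smult c W"
  have der: "((deriv ^^ j) f has_real_derivative (deriv ^^ (Suc j)) f x) (at x)" if jx: "j < 2 * n" "a < x" "x < b" for j x
  proof -
    obtain y where "((deriv ^^ j) f has_real_derivative y) (at x)"
      using diff[of j x] jx unfolding n_def real_differentiable_def by blast
    thus ?thesis using DERIV_imp_deriv by fastforce
  qed
  define G where "G j x = (deriv ^^ j) f x - poly ((pderiv ^^ j) q) x" for j x
  have dG: "(G j has_real_derivative G (Suc j) x) (at x)" if "j < 2 * n" "a < x" "x < b" for j x
    unfolding G_def by (auto intro!: DERIV_diff der[OF that, simplified] poly_DERIV)
  have contG: "continuous_on {a..b} (G 0)"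
    unfolding G_def by (auto intro!: continuous_intros cont)
  have "\<exists>Z'. finite Z' \<and> card Z' = card (insert t S) - 1 \<and> (\<forall>z\<in>Z'. G 1 z = 0 \<and> z \<notin> insert t S \<and> a < z \<and> z < b \<and> (\<exists>v\<in>insert t S. z < v))"
  proof (rule rolle_zeros[OF _ _ contG])
    show "(G 0 has_real_derivative G 1 x) (at x)" if "a < x" "x < b" for x using dG[of 0 x] that n by simp
    show "G 0 z = 0" if "z \<in> insert t S" for z using that p(1) W0 Wt by (auto simp: G_def q_def c_def)
  qed (use S t in auto)
  then obtain Z' where Z': "finite Z'" "card Z' = n" "\<And>z. z \<in> Z' \<Longrightarrow> G 1 z = 0 \<and> z \<notin> S \<and> a < z \<and> z < b"
    using S t by (auto simp: n_def)
  have "\<exists>\<xi>. a < \<xi> \<and> \<xi> < b \<and> (\<lambda>j. G (Suc j)) (2 * n - 1) \<xi> = 0"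
  proof (rule rolle_iterate[where G = "\<lambda>j. G (Suc j)" and n = "2 * n - 1" and Z = "S \<union> Z'"])
    show "finite (S \<union> Z')" using S Z' by simp
    have "S \<inter> Z' = {}" using Z' by auto
    hence "card (S \<union> Z') = 2 * n" using S Z' by (simp add: card_Un_disjoint n_def)
    thus "2 * n - 1 < card (S \<union> Z')" using n by simp
    show "S \<union> Z' \<subseteq> {a<..<b}" using S Z' by auto
    show "G (Suc 0) z = 0" if "z \<in> S \<union> Z'" for z
      using that Z'(3) p(1) W0 by (auto simp: G_def q_def pderiv_add pderiv_smult)
    show "(G (Suc j) has_real_derivative G (Suc (Suc j)) x) (at x)" if "j < 2 * n - 1" "a < x" "x < b" for j x
      using dG[of "Suc j" x] that by simp
  qed
  then obtain \<xi> where \<xi>: "a < \<xi>" "\<xi> < b" "G (2 * n) \<xi> = 0" using n by auto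
  have "(pderiv ^^ (2 * n)) q = [:fact (2 * n) * c:]"
  proof (rule poly_eqI)
    fix i
    have "coeff p (i + 2 * n) = 0" using p(2) n by (intro coeff_eq_0) (simp add: n_def)
    moreover have "coeff W (i + 2 * n) = (if i = 0 then 1 else 0)" using W W2 by (auto intro: coeff_eq_0)
    ultimately show "coeff ((pderiv ^^ (2 * n)) q) i = coeff [:fact (2 * n) * c:] i"
      unfolding coeff_higher_pderiv q_def by (cases i) (auto simp: pochhammer_fact)
  qed
  hence "fact (2 * n) * c = (deriv ^^ (2 * n)) f \<xi>" using \<xi>(3) by (simp add: G_def)
  also have "\<dots> > 0" using pos[OF \<xi>(1,2)] by (simp add: n_def)
  finally have "c > 0" by (simp add: zero_less_mult_iff)
  thus ?thesis using Wt by (simp add: c_def zero_less_divide_iff)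
qed


subsection \<open>Universal polarization bounds for spherical designs\<close>

text \<open>The four inner products are the nodes of a Gauss type quadrature on the 22-sphere that is exact for
  polynomials of degree at most 7; its weights are proportional to 275 and 2025.\<close>

definition nodes :: "real set" where
  "nodes = {- (sqrt 5 / 5), - (sqrt 5 / 15), sqrt 5 / 15, sqrt 5 / 5}"

definition node_mean :: "(real \<Rightarrow> real) \<Rightarrow> real" where
  "node_mean f = (275 * f (- (sqrt 5 / 5)) + 2025 * f (- (sqrt 5 / 15)) + 2025 * f (sqrt 5 / 15) + 275 * f (sqrt 5 / 5)) / 4600"

text \<open>Powers of linear forms span the homogeneous polynomials, so these sums test all
  polynomials of degree at most 7. The dimension 23 enters through the moments, not through the
  type.\<close>

definition spherical_7_design :: "'a::euclidean_space set \<Rightarrow> bool" where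
  "spherical_7_design Z \<longleftrightarrow> finite Z \<and> Z \<subseteq> sphere 0 1 \<and>
     (\<forall>y\<in>sphere 0 1. \<forall>j\<le>7. (\<Sum>z\<in>Z. (y \<bullet> z) ^ j) = real (card Z) * (if even j then sphere_moment 23 (j div 2) else 0))"

lemma nodes: "finite nodes" "card nodes = 4" "nodes \<subseteq> {-1<..<1}"
proof -
  define r where "r = sqrt 5"
  have r: "r > 0" "r < 5" unfolding r_def by (auto intro: real_less_lsqrt)
  note n = nodes_def[folded r_def]
  show "finite nodes" by (simp add: n)
  show "card nodes = 4" using r by (simp add: n card_insert_if)
  show "nodes \<subseteq> {-1<..<1}" using r by (auto simp: n)
qed

lemma node_mean_power:
  assumes "j \<le> 7"
  shows "node_mean (\<lambda>x. x ^ j) = (if even j then sphere_moment 23 (j div 2) else 0)"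
proof (cases "even j")
  case False
  thus ?thesis by (simp add: node_mean_def)
next
  case True
  have mom23: "sphere_moment 23 0 = 1" "sphere_moment 23 1 = 1/23" "sphere_moment 23 2 = 3/575" "sphere_moment 23 3 = 1/1035"
    by (simp_all add: sphere_moment_def eval_nat_numeral)
  have p: "sqrt 5 ^ 2 = 5" "sqrt 5 ^ 4 = 25" "sqrt 5 ^ 6 = 125"
    using power_mult[of "sqrt 5" 2 2] power_mult[of "sqrt 5" 2 3] by simp_all
  have "j = 0 \<or> j = 2 \<or> j = 4 \<or> j = 6" using True assms by presburger
  thus ?thesis
    by (elim disjE) (simp_all add: node_mean_def mom23 mom23(2)[unfolded One_nat_def] power_divide p)
qed

lemma design_poly_sum:
  assumes Z: "spherical_7_design Z" and y: "y \<in> sphere 0 1" and p: "degree p \<le> 7"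
  shows "(\<Sum>z\<in>Z. poly p (y \<bullet> z)) = real (card Z) * node_mean (poly p)"
proof -
  have p': "poly p x = (\<Sum>i\<le>7. coeff p i * x ^ i)" for x
    unfolding poly_altdef by (rule sum.mono_neutral_left) (use p in \<open>auto intro: coeff_eq_0\<close>)
  have "(\<Sum>z\<in>Z. poly p (y \<bullet> z)) = (\<Sum>i\<le>7. coeff p i * (\<Sum>z\<in>Z. (y \<bullet> z) ^ i))"
    unfolding p' sum_distrib_left by (rule sum.swap)
  also have "\<dots> = (\<Sum>i\<le>7. coeff p i * (real (card Z) * node_mean (\<lambda>x. x ^ i)))"
    using Z y by (intro sum.cong refl) (simp add: spherical_7_design_def node_mean_power)
  also have "\<dots> = real (card Z) * node_mean (poly p)"
    unfolding node_mean_def p' sum_distrib_left sum.distrib[symmetric] sum_divide_distrib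
    by (intro sum.cong refl) (simp add: field_simps)
  finally show ?thesis .
qed

lemma potential_above_interpolant:
  assumes h: "potential h" "positive_derivative 8 h"
  obtains p where "degree p \<le> 7"
    and "\<And>t. t \<in> nodes \<Longrightarrow> h t = ereal (poly p t)"
    and "\<And>t. t \<in> {-1..1} - nodes \<Longrightarrow> ereal (poly p t) < h t"
proof -
  define f where "f t = real_of_ereal (h t)" for t
  have fin: "h t = ereal (f t)" if "t \<in> {-1..<1}" for t
    using h(1) that by (simp add: potential_def f_def ereal_real)
  have contf: "continuous_on {-1..b} f" if "b \<le> 1" "b = 1 \<Longrightarrow> \<bar>h 1\<bar> \<noteq> \<infinity>" for b
  proof -
    have "continuous_on {-1..b} h" using h(1) that(1) unfolding potential_def by (auto intro: continuous_on_subset)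
    moreover have "\<bar>h t\<bar> \<noteq> \<infinity>" if "t \<in> {-1..b}" for t
      using fin[of t] \<open>b \<le> 1\<close> \<open>b = 1 \<Longrightarrow> \<bar>h 1\<bar> \<noteq> \<infinity>\<close> that by (cases "t = 1") auto
    ultimately have "continuous_on {-1..b} (real_of_ereal \<circ> h)"
      by (intro continuous_on_compose continuous_on_subset[OF continuous_on_real]) force+
    thus ?thesis by (simp add: f_def[abs_def] o_def)
  qed
  have pd: "\<And>j x. j < 8 \<Longrightarrow> -1 < x \<Longrightarrow> x < 1 \<Longrightarrow> (deriv ^^ j) f differentiable (at x)"
    "\<And>x. -1 < x \<Longrightarrow> x < 1 \<Longrightarrow> (deriv ^^ 8) f x > 0"
    using h(2) by (auto simp: positive_derivative_def f_def[abs_def] Let_def)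
  obtain p where p: "\<And>s. s \<in> nodes \<Longrightarrow> poly p s = f s \<and> poly (pderiv p) s = deriv f s" "degree p \<le> 7"
    using hermite_interpolant_exists[OF nodes(1), of f "deriv f"] nodes(2) by auto
  have err: "poly p t < f t" if t: "t \<in> {-1..1} - nodes" "t = 1 \<Longrightarrow> \<bar>h 1\<bar> \<noteq> \<infinity>" for t
  proof -
    define r where "r = sqrt 5"
    \<comment> \<open>The right end lies beyond the largest node sqrt 5 / 5 and equals 1 only for t
      = 1. If \<open>h 1\<close> is infinite, t = 1 is excluded here, so f is continuous on the
      whole interval.\<close>
    define b where "b = max t (r / 4)"
    have r: "r > 0" "r < 3" unfolding r_def by (auto intro: real_less_lsqrt)
    have "b \<ge> r / 4" by (simp add: b_def)
    hence n: "nodes \<subseteq> {-1<..<b}" using r by (auto simp: nodes_def[folded r_def])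
    have b: "b \<le> 1" "t \<le> b" "b = 1 \<Longrightarrow> t = 1"
      using t r by (auto simp: b_def max_def split: if_splits)
    show ?thesis
    proof (rule hermite_error_pos[of nodes "-1" b])
      show "continuous_on {-1..b} f" by (rule contf[OF b(1)]) (use b(3) t(2) in auto)
    qed (use nodes b n t p pd in auto)
  qed
  show thesis
  proof (rule that[of p])
    show "degree p \<le> 7" by (rule p)
    show "h t = ereal (poly p t)" if "t \<in> nodes" for t
      using fin[of t] p(1)[OF that] nodes(3) that by force
    show "ereal (poly p t) < h t" if t: "t \<in> {-1..1} - nodes" for t
    proof (cases "\<bar>h t\<bar> = \<infinity>")
      case True
      hence "t = 1" using fin[of t] t by (cases "t = 1") auto
      hence "h t = \<infinity>" using True h(1) by (cases "h t") (auto simp: potential_def)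
      thus ?thesis by simp
    next
      case False
      thus ?thesis using err[OF t] by (simp add: f_def flip: ereal_less(1)) (metis ereal_real less_ereal.simps(1))
    qed
  qed
qed

theorem design_polarization:
  fixes Z :: "'a::euclidean_space set"
  assumes Z: "spherical_7_design Z" and h: "potential h" "positive_derivative 8 h" and y: "y \<in> sphere 0 1"
  defines "q \<equiv> ereal (real (card Z) * node_mean (\<lambda>t. real_of_ereal (h t)))"
  shows "q \<le> U h y Z" and "U h y Z = q \<longleftrightarrow> (\<forall>z\<in>Z. y \<bullet> z \<in> nodes)"
proof -
  obtain p where p: "degree p \<le> 7" "\<And>t. t \<in> nodes \<Longrightarrow> h t = ereal (poly p t)"
    "\<And>t. t \<in> {-1..1} - nodes \<Longrightarrow> ereal (poly p t) < h t"
    using potential_above_interpolant[OF h] by blast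
  have fin: "finite Z" using Z by (simp add: spherical_7_design_def)
  have range: "y \<bullet> z \<in> {-1..1}" if "z \<in> Z" for z
  proof -
    have "norm z = 1" "norm y = 1" using Z that y by (auto simp: spherical_7_design_def)
    thus ?thesis using Cauchy_Schwarz_ineq2[of y z] by (simp add: abs_le_iff)
  qed
  have le: "ereal (poly p (y \<bullet> z)) \<le> h (y \<bullet> z)" if "z \<in> Z" for z
    using p(2,3)[of "y \<bullet> z"] range[OF that] by (cases "y \<bullet> z \<in> nodes") (auto simp: less_imp_le)
  have "node_mean (\<lambda>t. real_of_ereal (h t)) = node_mean (poly p)"
    unfolding node_mean_def using p(2) by (simp add: nodes_def)
  hence q: "q = (\<Sum>z\<in>Z. ereal (poly p (y \<bullet> z)))"
    unfolding q_def using design_poly_sum[OF Z y p(1)] by simp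
  show "q \<le> U h y Z" unfolding q U_def by (rule sum_mono[OF le])
  show "U h y Z = q \<longleftrightarrow> (\<forall>z\<in>Z. y \<bullet> z \<in> nodes)"
  proof
    assume "\<forall>z\<in>Z. y \<bullet> z \<in> nodes"
    thus "U h y Z = q" unfolding q U_def using p(2) by (intro sum.cong) auto
  next
    assume eq: "U h y Z = q"
    show "\<forall>z\<in>Z. y \<bullet> z \<in> nodes"
    proof (rule ccontr)
      assume "\<not> (\<forall>z\<in>Z. y \<bullet> z \<in> nodes)"
      then obtain z where z: "z \<in> Z" "y \<bullet> z \<notin> nodes" by blast
      have lt: "ereal (poly p (y \<bullet> z)) < h (y \<bullet> z)" using p(3) range[OF z(1)] z(2) by auto
      have "q = (\<Sum>w\<in>Z - {z}. ereal (poly p (y \<bullet> w))) + ereal (poly p (y \<bullet> z))"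
        unfolding q by (subst sum.remove[OF fin z(1)]) (simp add: add.commute)
      \<comment> \<open>Strictness survives addition because the other summands are still the finite
        polynomial values; only afterwards are they replaced by values of h, which may be
        infinite.\<close>
      also have "\<dots> < (\<Sum>w\<in>Z - {z}. ereal (poly p (y \<bullet> w))) + h (y \<bullet> z)"
        using lt by (cases "h (y \<bullet> z)") auto
      also have "\<dots> \<le> (\<Sum>w\<in>Z - {z}. h (y \<bullet> w)) + h (y \<bullet> z)"
        by (intro add_right_mono sum_mono le) auto
      also have "\<dots> = U h y Z" using sum.remove[OF fin z(1), of "\<lambda>w. h (y \<bullet> w)"] by (simp add: U_def add.commute)
      finally show False using eq by simp
    qed
  qed
qed

subsection \<open>Integrality determines the layers\<close>

context leech_pole
begin

lemma layer_sum_values: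
  assumes "A \<bullet> x = 0"
  shows "layer_sum 2 2 x = 600 * (x \<bullet> x)" "layer_sum 1 2 x = 7680 * (x \<bullet> x)" "layer_sum 0 2 x = 16200 * (x \<bullet> x)"
    "layer_sum 2 4 x = 216 * (x \<bullet> x)\<^sup>2" "layer_sum 1 4 x = 3456 * (x \<bullet> x)\<^sup>2" "layer_sum 0 4 x = 7776 * (x \<bullet> x)\<^sup>2"
    "layer_sum 2 6 x = 120 * (x \<bullet> x) ^ 3" "layer_sum 0 6 x = 5760 * (x \<bullet> x) ^ 3"
  using shell_even_moments(5-13)[OF assms, unfolded shell_layer_cards] by linarith+

lemma layer_mem: "B \<in> layer a \<longleftrightarrow> B \<in> L \<and> B \<bullet> B = 4 \<and> A \<bullet> B = a"
  by (auto simp: layer_def shell_mem)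

lemma layer_inner_Ints: "B \<in> layer a \<Longrightarrow> C \<in> layer b \<Longrightarrow> B \<bullet> C \<in> \<int>"
  by (auto simp: layer_mem intro: inner_Ints)

lemma bounded_Ints:
  assumes "t \<in> \<int>" "- 2 \<le> t" "t \<le> (2::real)"
  shows "t \<in> {-2, -1, 0, 1, 2}"
proof -
  obtain k :: int where k: "t = of_int k" using assms(1) by (auto elim: Ints_cases)
  hence "k = -2 \<or> k = -1 \<or> k = 0 \<or> k = 1 \<or> k = 2" using assms(2,3) by auto
  thus ?thesis using k by auto
qed

text \<open>The polynomials \<open>t\<^sup>2(t\<^sup>2 - 1)(t\<^sup>2 - 4)\<close> here and \<open>t\<^sup>2(t\<^sup>2 - 1)\<close>, \<open>t\<^sup>4(t\<^sup>2 - 1)\<close> below annihilate the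
  admissible inner products; summed over a layer, they are equations for \<open>x \<bullet> x\<close> whose only common root is 0.\<close>

lemma layer_orthogonal_zero:
  assumes x: "A \<bullet> x = 0"
    and t2: "\<And>B. B \<in> layer 2 \<Longrightarrow> x \<bullet> B \<in> {-2, -1, 0, 1, 2}" and t0: "\<And>B. B \<in> layer 0 \<Longrightarrow> x \<bullet> B \<in> {-2, -1, 0, 1, 2}"
  shows "x = 0"
proof -
  define P where "P = x \<bullet> x"
  have vanish: "t ^ 6 - 5 * t ^ 4 + 4 * t ^ 2 = 0" if "t \<in> {-2, -1, 0, 1, 2}" for t :: real
    using that by auto
  have "layer_sum a 6 x - 5 * layer_sum a 4 x + 4 * layer_sum a 2 x = (\<Sum>B\<in>layer a. (x \<bullet> B) ^ 6 - 5 * (x \<bullet> B) ^ 4 + 4 * (x \<bullet> B) ^ 2)" for a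
    by (simp add: layer_sum_def sum.distrib sum_subtractf sum_distrib_left)
  hence e: "layer_sum 2 6 x - 5 * layer_sum 2 4 x + 4 * layer_sum 2 2 x = 0" "layer_sum 0 6 x - 5 * layer_sum 0 4 x + 4 * layer_sum 0 2 x = 0"
    using vanish[OF t2] vanish[OF t0] by (simp_all add: sum.neutral)
  have "120 * (P * (P\<^sup>2 - 9 * P + 20)) = 0" "5760 * (P * (P\<^sup>2 - 27/4 * P + 45/4)) = 0"
    using e unfolding layer_sum_values[OF x] P_def[symmetric] by (simp_all add: power2_eq_square power3_eq_cube algebra_simps)
  hence *: "P = 0 \<or> P\<^sup>2 - 9 * P + 20 = 0 \<and> P\<^sup>2 - 27/4 * P + 45/4 = 0" by auto
  have "P = 0"
  proof (rule ccontr)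
    assume "P \<noteq> 0"
    hence p: "P\<^sup>2 - 9 * P + 20 = 0" "P\<^sup>2 - 27/4 * P + 45/4 = 0" using * by auto
    \<comment> \<open>The difference of the two quadratic equations is linear in P, and its root
      satisfies neither of them.\<close>
    hence P: "P = 35/9" by linarith
    show False using p(1) unfolding P by (simp add: power2_eq_square)
  qed
  thus ?thesis by (simp add: P_def)
qed

lemma layer_2_small_zero:
  assumes x: "A \<bullet> x = 0" and t2: "\<And>B. B \<in> layer 2 \<Longrightarrow> x \<bullet> B \<in> {-1, 0, 1}"
  shows "x = 0"
proof -
  define P where "P = x \<bullet> x"
  have vanish: "t ^ 4 - t ^ 2 = 0" "t ^ 6 - t ^ 4 = 0" if "t \<in> {-1, 0, 1}" for t :: real
    using that by auto
  have "layer_sum 2 4 x - layer_sum 2 2 x = (\<Sum>B\<in>layer 2. (x \<bullet> B) ^ 4 - (x \<bullet> B) ^ 2)"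
    "layer_sum 2 6 x - layer_sum 2 4 x = (\<Sum>B\<in>layer 2. (x \<bullet> B) ^ 6 - (x \<bullet> B) ^ 4)"
    by (simp_all add: layer_sum_def sum_subtractf)
  hence e: "layer_sum 2 4 x - layer_sum 2 2 x = 0" "layer_sum 2 6 x - layer_sum 2 4 x = 0"
    using vanish[OF t2] by (simp_all add: sum.neutral)
  have "P * (216 * P - 600) = 0" "P\<^sup>2 * (120 * P - 216) = 0"
    using e unfolding layer_sum_values[OF x] P_def[symmetric] by (simp_all add: power2_eq_square power3_eq_cube algebra_simps)
  hence "P = 0" by (auto simp: power2_eq_square)
  thus ?thesis by (simp add: P_def)
qed

text \<open>Translate \<open>y\<close> by the sublattice to a vector \<open>z\<close> of minimal length. Then \<open>\<bar>z \<bullet> v\<bar> \<le> 2\<close> for all its vectors \<open>v\<close>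
  of squared length 4, and the moments of the layers leave only \<open>z = 0\<close> or \<open>z = \<plusminus>A/2\<close>.\<close>

lemma even_sublattice_dual:
  assumes yA: "\<exists>k::int. A \<bullet> y = 2 * of_int k" and y: "\<And>x. x \<in> layer 0 \<union> layer 2 \<Longrightarrow> y \<bullet> x \<in> \<int>"
  shows "y \<in> L \<or> y - (1/2) *\<^sub>R A \<in> L"
proof -
  define E where "E = {x \<in> L. \<exists>k::int. A \<bullet> x = 2 * of_int k}"
  have E0: "0 \<in> E" by (auto simp: E_def intro: exI[of _ 0])
  have Eadd: "u + v \<in> E" if uv: "u \<in> E" "v \<in> E" for u v
  proof -
    obtain k l :: int where "A \<bullet> u = 2 * of_int k" "A \<bullet> v = 2 * of_int l" using uv by (auto simp: E_def)
    hence "A \<bullet> (u + v) = 2 * of_int (k + l)" by (simp add: inner_add_right)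
    thus ?thesis using uv add_mem unfolding E_def by blast
  qed
  have Eneg: "- v \<in> E" if v: "v \<in> E" for v
  proof -
    obtain l :: int where "A \<bullet> v = 2 * of_int l" using v by (auto simp: E_def)
    hence "A \<bullet> (- v) = 2 * of_int (- l)" by simp
    thus ?thesis using v uminus_mem unfolding E_def by blast
  qed
  have layE: "x \<in> E" if "x \<in> layer 0 \<union> layer 2" for x
    using that by (auto simp: E_def layer_mem intro: exI[of _ 0] exI[of _ 1])
  have AE: "A \<in> E" using A_L A_dot by (auto simp: E_def intro: exI[of _ 2])
  define F where "F = {x \<in> E. norm (y + x) \<le> norm y}"
  have "F \<subseteq> {x \<in> L. norm x \<le> 2 * norm y}"
  proof
    fix x assume x: "x \<in> F"
    have "norm x \<le> norm (y + x) + norm y" using norm_triangle_ineq4[of "y + x" y] by simp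
    thus "x \<in> {x \<in> L. norm x \<le> 2 * norm y}" using x by (auto simp: F_def E_def)
  qed
  hence "finite F" using finite_bounded finite_subset by blast
  moreover have "F \<noteq> {}" using E0 by (auto simp: F_def)
  ultimately obtain x0 where x0: "x0 \<in> F" "\<And>x. x \<in> F \<Longrightarrow> norm (y + x0) \<le> norm (y + x)"
    using arg_min_if_finite[of F "\<lambda>x. norm (y + x)"] by (metis not_le)
  have x0E: "x0 \<in> E" using x0 by (simp add: F_def)
  have min: "norm (y + x0) \<le> norm (y + x)" if "x \<in> E" for x
    using x0 that by (cases "x \<in> F") (force simp: F_def)+
  define z where "z = y + x0"
  \<comment> \<open>Minimality of z against z + v and z - v bounds the inner product by half of
    \<open>v \<bullet> v\<close>.\<close>
  have bound: "- 2 \<le> z \<bullet> v" "z \<bullet> v \<le> 2" if v: "v \<in> E" "v \<bullet> v = 4" for v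
  proof -
    have "norm z \<le> norm (z + w)" if "w \<in> E" for w
      using min[OF Eadd[OF x0E that]] by (simp add: z_def add.assoc)
    hence "z \<bullet> z \<le> (z + w) \<bullet> (z + w)" if "w \<in> E" for w
      using that by (simp add: norm_eq_sqrt_inner)
    from this[OF v(1)] this[OF Eneg[OF v(1)]]
    have "z \<bullet> z \<le> (z + v) \<bullet> (z + v)" "z \<bullet> z \<le> (z - v) \<bullet> (z - v)" by simp_all
    thus "- 2 \<le> z \<bullet> v" "z \<bullet> v \<le> 2"
      using v(2) by (simp_all add: inner_add_left inner_add_right inner_diff_left inner_diff_right inner_commute[of v z])
  qed
  have zlay: "z \<bullet> x \<in> {-2, -1, 0, 1, 2}" if x: "x \<in> layer 0 \<union> layer 2" for x
  proof (rule bounded_Ints)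
    show "z \<bullet> x \<in> \<int>" unfolding z_def inner_add_left
      using y[OF x] x x0E by (intro Ints_add) (auto simp: E_def layer_mem intro: inner_Ints)
    show "- 2 \<le> z \<bullet> x" "z \<bullet> x \<le> 2" using bound[OF layE[OF x]] x by (auto simp: layer_mem)
  qed
  have "\<exists>k::int. A \<bullet> z = 2 * of_int k"
  proof -
    obtain k l :: int where "A \<bullet> y = 2 * of_int k" "A \<bullet> x0 = 2 * of_int l" using yA x0E by (auto simp: E_def)
    hence "A \<bullet> z = 2 * of_int (k + l)" by (simp add: z_def inner_add_right)
    thus ?thesis by blast
  qed
  then obtain k :: int where k: "A \<bullet> z = 2 * of_int k" by blast
  \<comment> \<open>A itself lies in E and has squared length 4, so the bound applies to it.\<close>
  have "-1 \<le> k" "k \<le> 1" using bound[OF AE A_dot] k by (simp_all add: inner_commute[of z A])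
  hence "k = 0 \<or> k = 1 \<or> k = -1" by auto
  moreover have x0L: "- x0 \<in> L" using x0E uminus_mem by (simp add: E_def)
  moreover have "z = 0" if "k = 0"
    by (rule layer_orthogonal_zero) (use k that zlay in auto)
  moreover have "z = (of_int k / 2) *\<^sub>R A" if k1: "k = 1 \<or> k = -1"
  proof -
    define w where "w = z - (of_int k / 2) *\<^sub>R A"
    have "w = 0"
    proof (rule layer_2_small_zero)
      show "A \<bullet> w = 0" using k A_dot by (simp add: w_def inner_diff_right)
      fix B assume B: "B \<in> layer 2"
      \<comment> \<open>Both B and A - B lie in layer 2, so \<open>z \<bullet> B\<close> and 2k -
        \<open>z \<bullet> B\<close> are both at most 2 in modulus. For k = +-1 this confines
        \<open>w \<bullet> B\<close> to -1, 0, 1.\<close>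
      have "A - B \<in> layer 2"
        using B diff_mem[OF A_L] A_dot by (auto simp: layer_mem inner_diff_left inner_diff_right inner_commute[of B A])
      hence "z \<bullet> (A - B) \<in> {-2, -1, 0, 1, 2}" by (intro zlay) auto
      hence 1: "2 * of_int k - z \<bullet> B \<in> {-2, -1, 0, 1, 2}" using k by (simp add: inner_diff_right inner_commute[of z A])
      have 2: "z \<bullet> B \<in> {-2, -1, 0, 1, 2}" by (rule zlay) (use B in auto)
      have 3: "w \<bullet> B = z \<bullet> B - of_int k" using B by (simp add: w_def inner_diff_left layer_mem)
      show "w \<bullet> B \<in> {-1, 0, 1}" using k1 1 2 unfolding 3 by (elim disjE) auto
    qed
    thus ?thesis by (simp add: w_def)
  qed
  moreover have y0: "y = z - x0" by (simp add: z_def)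
  moreover have "- x0 - A \<in> L" using x0L A_L diff_mem by blast
  moreover have "(-1/2) *\<^sub>R A - x0 - (1/2) *\<^sub>R A = - x0 - A"
  proof -
    have "(1/2) *\<^sub>R A + (1/2) *\<^sub>R A = A" by (simp flip: scaleR_add_left)
    moreover have "(-1/2) *\<^sub>R A - x0 - (1/2) *\<^sub>R A = - x0 - ((1/2) *\<^sub>R A + (1/2) *\<^sub>R A)" by simp
    ultimately show ?thesis by simp
  qed
  moreover have "(1/2) *\<^sub>R A - x0 - (1/2) *\<^sub>R A = - x0" by simp
  ultimately show ?thesis by (elim disjE) (simp_all only: of_int_1 of_int_minus simp_thms diff_0)
qed

text \<open>The value -2 would give B + C - A squared length 2. After subtraction of 1/2, the effect
  of projecting away from A, the four values become symmetric: +-1/2, +-3/2.\<close>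

lemma layer_cross:
  assumes B: "B \<in> layer 2" and C: "C \<in> layer 1"
  shows "B \<bullet> C \<in> {-1, 0, 1, 2}"
proof -
  have "B \<noteq> C" "B \<noteq> - C" using B C by (auto simp: layer_mem)
  hence d: "B \<bullet> C \<in> {-2, -1, 0, 1, 2}" using shell_dot_cases B C by (auto simp: layer_def)
  have "B + C - A \<in> L" using B C A_L by (intro diff_mem add_mem) (auto simp: layer_mem)
  hence "(B + C - A) \<bullet> (B + C - A) \<noteq> 2" by (rule no_norm_2)
  hence "B \<bullet> C \<noteq> -2"
    using B C A_dot by (auto simp: layer_mem inner_diff_left inner_diff_right inner_add_left inner_add_right inner_commute)
  thus ?thesis using d by auto
qed

lemma layer_0_cases:
  assumes x: "x \<in> layer 0" and B: "B \<in> layer a" "a \<noteq> 0"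
  shows "x \<bullet> B \<in> {-2, -1, 0, 1, 2}"
proof -
  have "x \<noteq> B" "x \<noteq> - B" using x B by (auto simp: layer_mem)
  thus ?thesis using shell_dot_cases x B by (auto simp: layer_def)
qed

text \<open>Integrality on layer a passes to layer 0 through such differences. If the inner product
  2 never occurred, t (t + 2)(t^2 - 1) would vanish at all inner products of x with the layer; the
  moments show that its sum is not 0. An inner product 2 makes B - x a minimal vector again.\<close>

lemma layer_0_difference:
  assumes x: "x \<in> layer 0" and a: "a = 1 \<or> a = 2"
  obtains B where "B \<in> layer a" "B - x \<in> layer a"
proof -
  have "\<exists>B\<in>layer a. x \<bullet> B = 2"
  proof (rule ccontr)
    assume *: "\<not> (\<exists>B\<in>layer a. x \<bullet> B = 2)"
    have xA: "A \<bullet> x = 0" and xx: "x \<bullet> x = 4" using x by (auto simp: layer_mem)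
    have "(x \<bullet> B) ^ 4 + 2 * (x \<bullet> B) ^ 3 - (x \<bullet> B) ^ 2 - 2 * (x \<bullet> B) ^ 1 = 0" if "B \<in> layer a" for B
    proof -
      have "x \<bullet> B \<in> {-2, -1, 0, 1, 2}" using layer_0_cases[OF x that] a by auto
      moreover have "x \<bullet> B \<noteq> 2" using * that by blast
      ultimately show ?thesis by auto
    qed
    hence "(\<Sum>B\<in>layer a. (x \<bullet> B) ^ 4 + 2 * (x \<bullet> B) ^ 3 - (x \<bullet> B) ^ 2 - 2 * (x \<bullet> B) ^ 1) = 0" by (rule sum.neutral[rule_format])
    hence "layer_sum a 4 x + 2 * layer_sum a 3 x - layer_sum a 2 x - 2 * layer_sum a 1 x = 0"
      by (simp only: layer_sum_def sum.distrib sum_subtractf sum_distrib_left)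
    thus False
      using a layer_sum_odd[OF xA, of 3] layer_sum_odd[OF xA, of 1] layer_sum_values[OF xA] xx by auto
  qed
  then obtain B where B: "B \<in> layer a" "x \<bullet> B = 2" by blast
  moreover have "B - x \<in> layer a"
    using B x diff_mem by (auto simp: layer_mem inner_diff_left inner_diff_right inner_commute[of B x])
  ultimately show thesis using that by blast
qed

text \<open>The same argument for the component x of D, with the polynomial (t + 3/2)(t^2 - 1/4),
  whose roots are the values of \<open>x \<bullet> C\<close> for \<open>D \<bullet> C\<close> = -1,
  0, 1. It writes D as a sum of two vectors of layer 1.\<close>

lemma layer_2_difference:
  assumes D: "D \<in> layer 2"
  obtains C where "C \<in> layer 1" "D - C \<in> layer 1"
proof -
  define x where "x = D - (1/2) *\<^sub>R A"
  have xA: "A \<bullet> x = 0" and xx: "x \<bullet> x = 3"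
    using D A_dot by (auto simp: x_def layer_mem inner_diff_left inner_diff_right inner_commute[of D A])
  have "\<exists>C\<in>layer 1. D \<bullet> C = 2"
  proof (rule ccontr)
    assume *: "\<not> (\<exists>C\<in>layer 1. D \<bullet> C = 2)"
    have "(x \<bullet> C) ^ 3 + 3/2 * (x \<bullet> C) ^ 2 - 1/4 * (x \<bullet> C) ^ 1 - 3/8 * (x \<bullet> C) ^ 0 = 0" if C: "C \<in> layer 1" for C
    proof -
      have "D \<bullet> C \<in> {-1, 0, 1, 2}" using layer_cross[OF D C] .
      moreover have "D \<bullet> C \<noteq> 2" using * C by blast
      moreover have "x \<bullet> C = D \<bullet> C - 1/2" using C by (simp add: x_def inner_diff_left layer_mem)
      ultimately show ?thesis by (auto simp: power2_eq_square power3_eq_cube)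
    qed
    hence "(\<Sum>C\<in>layer 1. (x \<bullet> C) ^ 3 + 3/2 * (x \<bullet> C) ^ 2 - 1/4 * (x \<bullet> C) ^ 1 - 3/8 * (x \<bullet> C) ^ 0) = 0" by (rule sum.neutral[rule_format])
    hence "layer_sum 1 3 x + 3/2 * layer_sum 1 2 x - 1/4 * layer_sum 1 1 x - 3/8 * layer_sum 1 0 x = 0"
      by (simp only: layer_sum_def sum.distrib sum_subtractf sum_distrib_left)
    thus False
      using layer_sum_odd(3)[OF xA, of 3] layer_sum_odd(3)[OF xA, of 1] layer_sum_values[OF xA] xx
      by (simp add: layer_sum_0 shell_layer_cards)
  qed
  then obtain C where C: "C \<in> layer 1" "D \<bullet> C = 2" by blast
  moreover have "D - C \<in> layer 1"
    using C D diff_mem by (auto simp: layer_mem inner_diff_left inner_diff_right inner_commute[of C D])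
  ultimately show thesis using that by blast
qed

lemma layer_1_nonempty: "layer 1 \<noteq> {}"
  using shell_layer_cards(3) by auto

lemma half_Ints: "(t :: real) \<in> {-(3/2), -(1/2), 1/2, 3/2} \<Longrightarrow> t + 1/2 \<in> \<int>"
proof -
  assume "t \<in> {-(3/2), -(1/2), 1/2, 3/2}"
  hence "t + 1/2 = of_int (-1) \<or> t + 1/2 = of_int 0 \<or> t + 1/2 = of_int 1 \<or> t + 1/2 = of_int 2" by auto
  thus ?thesis by (metis Ints_of_int)
qed

text \<open>The lift C of y has odd inner product 1 with A, so the duality lemma is applied to C - D
  for some D in layer 1. Its two cosets give the two alternatives, because A/2 - C is the lift of
  -y.\<close>

lemma layer_1_dual:
  assumes y: "A \<bullet> y = 0" "y \<bullet> y = 15/4"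
    and t: "\<And>B. B \<in> layer 2 \<Longrightarrow> y \<bullet> B \<in> {-(3/2), -(1/2), 1/2, 3/2}"
  shows "(1/4) *\<^sub>R A + y \<in> layer 1 \<or> (1/4) *\<^sub>R A - y \<in> layer 1"
proof -
  define C where "C = (1/4) *\<^sub>R A + y"
  obtain D where D: "D \<in> layer 1" using layer_1_nonempty by blast
  have CB: "C \<bullet> B \<in> \<int>" if B: "B \<in> layer 2" for B
  proof -
    have "C \<bullet> B = y \<bullet> B + 1/2" using B by (simp add: C_def inner_add_left layer_mem)
    thus ?thesis using half_Ints[OF t[OF B]] by simp
  qed
  have Cx: "C \<bullet> x \<in> \<int>" if x: "x \<in> layer 0" for x
  proof -
    obtain B where B: "B \<in> layer 2" "B - x \<in> layer 2" using layer_0_difference[OF x, of 2] by blast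
    have "C \<bullet> x = C \<bullet> B - C \<bullet> (B - x)" by (simp add: inner_diff_right)
    thus ?thesis using CB[OF B(1)] CB[OF B(2)] by simp
  qed
  have "C - D \<in> L \<or> C - D - (1/2) *\<^sub>R A \<in> L"
  proof (rule even_sublattice_dual)
    have "A \<bullet> (C - D) = 2 * of_int 0"
      using y D A_dot by (simp add: C_def inner_add_right inner_diff_right layer_mem)
    thus "\<exists>k::int. A \<bullet> (C - D) = 2 * of_int k" by blast
    show "(C - D) \<bullet> x \<in> \<int>" if "x \<in> layer 0 \<union> layer 2" for x
      using that CB Cx layer_inner_Ints[OF D] unfolding inner_diff_left by (intro Ints_diff) auto
  qed
  moreover have "D \<in> L" using D by (simp add: layer_mem)
  ultimately have "C \<in> L \<or> C - (1/2) *\<^sub>R A \<in> L"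
    using add_mem[of "C - D" D] add_mem[of "C - D - (1/2) *\<^sub>R A" D] by (auto simp: algebra_simps)
  moreover have "- (C - (1/2) *\<^sub>R A) = (1/4) *\<^sub>R A - y"
  proof -
    have "(1/2) *\<^sub>R A = (1/4) *\<^sub>R A + (1/4) *\<^sub>R A" by (simp flip: scaleR_add_left)
    thus ?thesis by (simp add: C_def)
  qed
  ultimately have "(1/4) *\<^sub>R A + y \<in> L \<or> (1/4) *\<^sub>R A - y \<in> L"
    using uminus_mem[of "C - (1/2) *\<^sub>R A"] unfolding C_def by metis
  thus ?thesis
    using y A_dot by (auto simp: layer_mem inner_add_left inner_add_right inner_diff_left inner_diff_right inner_commute[of y A])
qed

text \<open>Here the lift B has even inner product with A and the duality lemma applies directly.
  The coset of A/2 is impossible: y would lie in L, while its inner products with layer 1 are not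
  integral. Hence no sign ambiguity remains.\<close>

lemma layer_2_dual:
  assumes y: "A \<bullet> y = 0" "y \<bullet> y = 3"
    and t: "\<And>C. C \<in> layer 1 \<Longrightarrow> y \<bullet> C \<in> {-(3/2), -(1/2), 1/2, 3/2}"
  shows "(1/2) *\<^sub>R A + y \<in> layer 2"
proof -
  define B where "B = (1/2) *\<^sub>R A + y"
  have BC: "B \<bullet> C \<in> \<int>" if C: "C \<in> layer 1" for C
  proof -
    have "B \<bullet> C = y \<bullet> C + 1/2" using C by (simp add: B_def inner_add_left layer_mem)
    thus ?thesis using half_Ints[OF t[OF C]] by simp
  qed
  have "B \<bullet> x \<in> \<int>" if x: "x \<in> layer 0 \<union> layer 2" for x
  proof (cases "x \<in> layer 0")
    case True
    obtain C where C: "C \<in> layer 1" "C - x \<in> layer 1" using layer_0_difference[OF True, of 1] by blast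
    have "B \<bullet> x = B \<bullet> C - B \<bullet> (C - x)" by (simp add: inner_diff_right)
    thus ?thesis using BC[OF C(1)] BC[OF C(2)] by simp
  next
    case False
    then obtain C where C: "C \<in> layer 1" "x - C \<in> layer 1" using layer_2_difference x by blast
    have "B \<bullet> x = B \<bullet> C + B \<bullet> (x - C)" by (simp add: inner_diff_right)
    thus ?thesis using BC[OF C(1)] BC[OF C(2)] by simp
  qed
  moreover have "A \<bullet> B = 2 * of_int 1" using y A_dot by (simp add: B_def inner_add_right)
  ultimately have "B \<in> L \<or> B - (1/2) *\<^sub>R A \<in> L" using even_sublattice_dual by blast
  moreover have "y \<notin> L"
  proof
    assume yL: "y \<in> L"
    obtain C where C: "C \<in> layer 1" using layer_1_nonempty by blast
    have "y \<bullet> C \<in> \<int>" using yL C inner_Ints by (auto simp: layer_mem)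
    then obtain k :: int where k: "y \<bullet> C = of_int k" by (auto elim: Ints_cases)
    have "2 * (y \<bullet> C) \<in> {-3, -1, 1, 3}" using t[OF C] by auto
    hence "real_of_int (2 * k) = of_int (-3) \<or> real_of_int (2 * k) = of_int (-1) \<or> real_of_int (2 * k) = of_int 1 \<or> real_of_int (2 * k) = of_int 3"
      unfolding k by auto
    hence "2 * k = -3 \<or> 2 * k = -1 \<or> 2 * k = 1 \<or> 2 * k = 3" unfolding of_int_eq_iff .
    thus False by presburger
  qed
  ultimately have "B \<in> L" by (auto simp: B_def)
  thus ?thesis
    using y A_dot by (auto simp: B_def layer_mem inner_add_left inner_add_right inner_commute[of y A])
qed

end

subsection \<open>Transport to the sphere in dimension 23\<close>

lemma spherical_7_design_Un_uminus:
  assumes Z: "spherical_7_design Z" and disj: "Z \<inter> uminus ` Z = {}"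
  shows "spherical_7_design (Z \<union> uminus ` Z)" and "card (Z \<union> uminus ` Z) = 2 * card Z"
proof -
  have fin: "finite Z" using Z by (simp add: spherical_7_design_def)
  have cneg: "card (uminus ` Z) = card Z" by (rule card_image) (simp add: inj_on_def)
  thus c: "card (Z \<union> uminus ` Z) = 2 * card Z" using card_Un_disjoint[OF fin _ disj] fin by simp
  have s: "(\<Sum>z\<in>Z \<union> uminus ` Z. (y \<bullet> z) ^ j) = (\<Sum>z\<in>Z. (y \<bullet> z) ^ j) + (- 1) ^ j * (\<Sum>z\<in>Z. (y \<bullet> z) ^ j)" for y j
  proof -
    have "(\<Sum>z\<in>uminus ` Z. (y \<bullet> z) ^ j) = (\<Sum>z\<in>Z. (- (y \<bullet> z)) ^ j)" by (subst sum.reindex) (auto simp: inj_on_def)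
    also have "\<dots> = (- 1) ^ j * (\<Sum>z\<in>Z. (y \<bullet> z) ^ j)" by (subst power_minus) (simp add: sum_distrib_left)
    finally show ?thesis using sum.union_disjoint[OF fin _ disj, of "\<lambda>z. (y \<bullet> z) ^ j"] fin by simp
  qed
  show "spherical_7_design (Z \<union> uminus ` Z)"
    unfolding spherical_7_design_def
  proof (intro conjI ballI allI impI)
    fix y :: 'a and j :: nat assume "y \<in> sphere 0 1" "j \<le> 7"
    hence "(\<Sum>z\<in>Z. (y \<bullet> z) ^ j) = real (card Z) * (if even j then sphere_moment 23 (j div 2) else 0)"
      using Z by (simp add: spherical_7_design_def)
    thus "(\<Sum>z\<in>Z \<union> uminus ` Z. (y \<bullet> z) ^ j) = real (card (Z \<union> uminus ` Z)) * (if even j then sphere_moment 23 (j div 2) else 0)"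
      unfolding s c by simp
  qed (use Z fin in \<open>auto simp: spherical_7_design_def\<close>)
qed

lemma design_minimizers:
  assumes Z: "spherical_7_design Z" and h: "potential h" "positive_derivative 8 h"
    and D: "D = {y \<in> sphere 0 1. \<forall>z\<in>Z. y \<bullet> z \<in> nodes}" "D \<noteq> {}"
  shows "minimizers h Z = D" and "polarization h Z = ereal (real (card Z) * node_mean (\<lambda>t. real_of_ereal (h t)))"
proof -
  define q where "q = ereal (real (card Z) * node_mean (\<lambda>t. real_of_ereal (h t)))"
  have le: "q \<le> U h y Z" and eq: "U h y Z = q \<longleftrightarrow> (\<forall>z\<in>Z. y \<bullet> z \<in> nodes)" if "y \<in> sphere 0 1" for y
    using design_polarization[OF Z h that] by (simp_all add: q_def)
  obtain y0 where y0: "y0 \<in> sphere 0 1" "U h y0 Z = q" using D eq by auto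
  show "minimizers h Z = D"
  proof (intro equalityI subsetI)
    fix y assume "y \<in> minimizers h Z"
    hence y: "y \<in> sphere 0 1" "U h y Z \<le> U h y0 Z" using y0 by (auto simp: minimizers_def)
    hence "U h y Z = q" using le[OF y(1)] y0 by simp
    thus "y \<in> D" using D y eq by simp
  next
    fix y assume "y \<in> D"
    hence "y \<in> sphere 0 1" "U h y Z = q" using D eq by auto
    thus "y \<in> minimizers h Z" using le by (simp add: minimizers_def)
  qed
  show "polarization h Z = ereal (real (card Z) * node_mean (\<lambda>t. real_of_ereal (h t)))"
    unfolding polarization_def q_def[symmetric]
    by (rule antisym, rule INF_lower2[OF y0(1)]) (use y0 le in \<open>auto intro: INF_greatest\<close>)
qed

text \<open>The factor c rescales the weights from 4600 points to N points. All values at nodes are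
  finite, so the arithmetic can be done in the reals.\<close>

lemma node_mean_weights:
  assumes h: "potential h" and N: "4600 * c = N" "275 * c = v" "2025 * c = w"
  shows "ereal (N * node_mean (\<lambda>t. real_of_ereal (h t))) =
     ereal v * h (- (sqrt 5 / 5)) + ereal w * h (- (sqrt 5 / 15)) + ereal w * h (sqrt 5 / 15) + ereal v * h (sqrt 5 / 5)"
proof -
  have fin: "h t = ereal (real_of_ereal (h t))" if "t \<in> nodes" for t
  proof -
    have "t \<in> {-1..<1}" using nodes(3) that by force
    thus ?thesis using h by (simp add: potential_def ereal_real)
  qed
  obtain a1 a2 a3 a4 where a: "h (- (sqrt 5 / 5)) = ereal a1" "h (- (sqrt 5 / 15)) = ereal a2" "h (sqrt 5 / 15) = ereal a3" "h (sqrt 5 / 5) = ereal a4"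
    using fin unfolding nodes_def by blast
  have "N * node_mean (\<lambda>t. real_of_ereal (h t)) = c * (275 * a1 + 2025 * a2 + 2025 * a3 + 275 * a4)"
    unfolding node_mean_def a N(1)[symmetric] by simp
  also have "\<dots> = v * a1 + w * a2 + w * a3 + v * a4"
    unfolding N(2,3)[symmetric] by (simp add: algebra_simps)
  finally show ?thesis unfolding a by (simp only: times_ereal.simps plus_ereal.simps)
qed

lemma nodes_uminus: "- t \<in> nodes \<longleftrightarrow> t \<in> nodes"
  by (auto simp: nodes_def)

text \<open>The product of the lengths sqrt 3 and sqrt (15/4) is 3 sqrt 5 / 2, and dividing +-1/2,
  +-3/2 by it gives the nodes.\<close>

lemma node_scale: "t / (sqrt 3 * sqrt (15/4)) \<in> nodes \<longleftrightarrow> t \<in> {-(3/2), -(1/2), 1/2, 3/2}"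
proof -
  define r where "r = sqrt 5"
  have r: "r > 0" "r * r = 5" by (simp_all add: r_def)
  have "sqrt 3 * sqrt (15/4) = sqrt ((3/2 * r)\<^sup>2)"
    unfolding real_sqrt_mult[symmetric] by (simp add: power_mult_distrib power_divide r_def)
  hence "sqrt 3 * sqrt (15/4) = 3/2 * r" using r by simp
  moreover have "t / (3/2 * r) = (2 * t / 15) * r" using r by (simp add: field_simps)
  ultimately have e: "t / (sqrt 3 * sqrt (15/4)) = (2 * t / 15) * r" by (simp only:)
  have "t / (sqrt 3 * sqrt (15/4)) \<in> nodes \<longleftrightarrow> (2 * t / 15) * r \<in> {(- (1/5)) * r, (- (1/15)) * r, (1/15) * r, (1/5) * r}"
    unfolding e nodes_def r_def[symmetric] by simp
  also have "\<dots> \<longleftrightarrow> 2 * t / 15 \<in> {- (1/5), - (1/15), 1/15, 1/5}" using r unfolding insert_iff mult_cancel_right by auto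
  also have "\<dots> \<longleftrightarrow> t \<in> {-(3/2), -(1/2), 1/2, 3/2}" by (auto simp: field_simps)
  finally show ?thesis .
qed

locale leech_projection = leech_pole +
  fixes \<phi> :: "real^24 \<Rightarrow> real^23"
  assumes iso: "linear_isometry_onto \<phi> ((span {A})\<^sup>\<bottom>)"
begin

lemma polar_iff: "x \<in> (span {A})\<^sup>\<bottom> \<longleftrightarrow> A \<bullet> x = 0"
proof
  assume "x \<in> (span {A})\<^sup>\<bottom>"
  thus "A \<bullet> x = 0" by (auto simp: orthogonal_comp_def orthogonal_def span_base inner_commute)
next
  assume "A \<bullet> x = 0"
  thus "x \<in> (span {A})\<^sup>\<bottom>"
    by (auto simp: orthogonal_comp_def orthogonal_def span_singleton inner_commute)
qed

lemma linear_phi: "linear \<phi>" and norm_phi: "A \<bullet> x = 0 \<Longrightarrow> norm (\<phi> x) = norm x"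
  using iso polar_iff by (auto simp: linear_isometry_onto_def)

lemma phi_surj: "\<exists>x. A \<bullet> x = 0 \<and> \<phi> x = y"
proof -
  have "y \<in> \<phi> ` ((span {A})\<^sup>\<bottom>)" using iso by (simp add: linear_isometry_onto_def)
  thus ?thesis using polar_iff by blast
qed

lemma phi_inner:
  assumes "A \<bullet> x = 0" "A \<bullet> y = 0"
  shows "\<phi> x \<bullet> \<phi> y = x \<bullet> y"
proof -
  have "norm (\<phi> (x + y)) = norm (x + y)" by (rule norm_phi) (use assms in \<open>simp add: inner_add_right\<close>)
  hence "norm (\<phi> x + \<phi> y) = norm (x + y)" by (simp add: linear_add[OF linear_phi])
  thus ?thesis using norm_phi[OF assms(1)] norm_phi[OF assms(2)] by (simp add: dot_norm)
qed

lemma phi_inj: "A \<bullet> x = 0 \<Longrightarrow> A \<bullet> y = 0 \<Longrightarrow> \<phi> x = \<phi> y \<Longrightarrow> x = y"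
  using norm_phi[of "x - y"] by (simp add: inner_diff_right linear_diff[OF linear_phi])

lemma orth_proj_A: "orth_proj (span {A}) x = ((A \<bullet> x) / 4) *\<^sub>R A"
proof -
  obtain c where c: "orth_proj (span {A}) x = c *\<^sub>R A"
    using orth_proj(1)[OF subspace_span[of "{A}"], of x] unfolding span_singleton by blast
  have "A \<bullet> (x - c *\<^sub>R A) = 0" using orth_proj(2)[OF subspace_span[of "{A}"], of x] polar_iff c by simp
  hence "c = (A \<bullet> x) / 4" using A_dot by (simp add: inner_diff_right)
  thus ?thesis using c by simp
qed

section \<open>The projected layers as codes on the 22-sphere\<close>

definition normalized :: "real \<Rightarrow> real \<Rightarrow> real^24 \<Rightarrow> real^24" where
  "normalized a h B = (B - (a / 4) *\<^sub>R A) /\<^sub>R sqrt h"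

definition code :: "real \<Rightarrow> (real^23) set" where
  "code a = \<phi> ` proj_sphere (span {A}) ` layer a"

lemma inner_layer_remainder:
  assumes "B \<in> layer a"
  shows "(B - (a / 4) *\<^sub>R A) \<bullet> (B - (a / 4) *\<^sub>R A) = 4 - a\<^sup>2 / 4"
proof -
  have AB: "A \<bullet> B = a" "B \<bullet> A = a" "B \<bullet> B = 4" using assms by (simp_all add: layer_mem inner_commute)
  have "(B - (a / 4) *\<^sub>R A) \<bullet> (B - (a / 4) *\<^sub>R A) = 4 - a / 4 * a - a / 4 * (a - a / 4 * 4)"
    by (simp only: inner_diff_left inner_diff_right inner_scaleR_left inner_scaleR_right AB A_dot)
  also have "\<dots> = 4 - a\<^sup>2 / 4" by (simp add: power2_eq_square)
  finally show ?thesis .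
qed

lemma norm_layer_remainder:
  assumes "B \<in> layer a" "h = 4 - a\<^sup>2 / 4"
  shows "norm (B - (a / 4) *\<^sub>R A) = sqrt h"
  by (simp only: norm_eq_sqrt_inner inner_layer_remainder[OF assms(1)] assms(2))

lemma proj_sphere_layer:
  assumes B: "B \<in> layer a" and h: "h = 4 - a\<^sup>2 / 4"
  shows "proj_sphere (span {A}) B = normalized a h B" and "proj_sphere (span {A}) (A - B) = - normalized a h B"
proof -
  note n = norm_layer_remainder[OF B h]
  have AB: "A \<bullet> B = a" using B by (simp add: layer_mem inner_commute)
  show "proj_sphere (span {A}) B = normalized a h B"
    by (simp only: proj_sphere_def orth_proj_A normalized_def AB n)
  have "A \<bullet> (A - B) / 4 = 1 - a / 4" by (simp only: inner_diff_right AB A_dot diff_divide_distrib)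
  hence "A - B - (A \<bullet> (A - B) / 4) *\<^sub>R A = - (B - (a / 4) *\<^sub>R A)" by (simp only: scaleR_diff_left) simp
  thus "proj_sphere (span {A}) (A - B) = - normalized a h B"
    by (simp only: proj_sphere_def orth_proj_A norm_minus_cancel normalized_def scaleR_minus_right n)
qed

lemma normalized:
  assumes B: "B \<in> layer a" and h: "h = 4 - a\<^sup>2 / 4" "h > 0"
  shows "A \<bullet> normalized a h B = 0" and "norm (normalized a h B) = 1"
    and "A \<bullet> x = 0 \<Longrightarrow> x \<bullet> normalized a h B = (x \<bullet> B) / sqrt h"
proof -
  have "A \<bullet> B = a" using B by (simp add: layer_mem inner_commute)
  hence "A \<bullet> (B - (a / 4) *\<^sub>R A) = a - a / 4 * 4"
    by (simp only: inner_diff_right inner_scaleR_right A_dot)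
  thus "A \<bullet> normalized a h B = 0" by (simp only: normalized_def inner_scaleR_right) simp
  have "norm (normalized a h B) = \<bar>inverse (sqrt h)\<bar> * sqrt h"
    by (simp only: normalized_def norm_scaleR norm_layer_remainder[OF B h(1)])
  thus "norm (normalized a h B) = 1" using h(2) by (simp only: abs_inverse) simp
  show "x \<bullet> normalized a h B = (x \<bullet> B) / sqrt h" if "A \<bullet> x = 0"
  proof -
    have "x \<bullet> A = 0" using that by (simp only: inner_commute[of x A])
    thus ?thesis by (simp only: normalized_def inner_diff_right inner_scaleR_right divide_inverse mult.commute) simp
  qed
qed

lemma code_eq: "h = 4 - a\<^sup>2 / 4 \<Longrightarrow> code a = (\<lambda>B. \<phi> (normalized a h B)) ` layer a"
  unfolding code_def image_image using proj_sphere_layer(1) by (intro image_cong) auto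

lemma inj_on_normalized:
  assumes h: "h = 4 - a\<^sup>2 / 4" "h > 0"
  shows "inj_on (\<lambda>B. \<phi> (normalized a h B)) (layer a)"
proof (rule inj_onI)
  fix B C assume BC: "B \<in> layer a" "C \<in> layer a" "\<phi> (normalized a h B) = \<phi> (normalized a h C)"
  have "normalized a h B = normalized a h C"
    by (rule phi_inj) (use BC normalized(1)[OF _ h] in auto)
  thus "B = C" using h(2) by (simp add: normalized_def)
qed

lemma card_code: "h = 4 - a\<^sup>2 / 4 \<Longrightarrow> h > 0 \<Longrightarrow> card (code a) = card (layer a)"
  using card_image[OF inj_on_normalized] code_eq by metis

lemma sphere_phi:
  assumes "y \<in> sphere 0 1"
  obtains x where "A \<bullet> x = 0" "norm x = 1" "y = \<phi> x"
proof -
  obtain x where x: "A \<bullet> x = 0" "\<phi> x = y" using phi_surj by blast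
  thus thesis using that[of x] norm_phi[of x] assms by simp
qed

lemma code_sphere:
  assumes h: "h = 4 - a\<^sup>2 / 4" "h > 0"
  shows "code a \<subseteq> sphere 0 1"
proof
  fix y assume "y \<in> code a"
  then obtain B where B: "B \<in> layer a" "y = \<phi> (normalized a h B)" unfolding code_eq[OF h(1)] by blast
  show "y \<in> sphere 0 1"
    unfolding B(2) mem_sphere_0 using norm_phi[OF normalized(1)[OF B(1) h]] normalized(2)[OF B(1) h] by simp
qed

lemma code_design:
  assumes h: "h = 4 - a\<^sup>2 / 4" "h > 0" and m: "layer_moment a h"
  shows "spherical_7_design (code a)"
  unfolding spherical_7_design_def
proof (intro conjI ballI allI impI)
  show "finite (code a)" unfolding code_def using finite_layer by blast
  show "code a \<subseteq> sphere 0 1" by (rule code_sphere[OF h])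
  fix y :: "real^23" and j :: nat assume y: "y \<in> sphere 0 1" and j: "j \<le> 7"
  obtain x where x: "A \<bullet> x = 0" "norm x = 1" "y = \<phi> x" using sphere_phi[OF y] by blast
  have xx: "x \<bullet> x = 1" using x(2) by (simp add: dot_square_norm)
  have "(\<Sum>z\<in>code a. (y \<bullet> z) ^ j) = (\<Sum>B\<in>layer a. (\<phi> x \<bullet> \<phi> (normalized a h B)) ^ j)"
    unfolding code_eq[OF h(1)] x(3) by (subst sum.reindex[OF inj_on_normalized[OF h]]) simp
  also have "\<dots> = (\<Sum>B\<in>layer a. (x \<bullet> B) ^ j / sqrt h ^ j)"
    using phi_inner[OF x(1) normalized(1)[OF _ h]] normalized(3)[OF _ h x(1)]
    by (intro sum.cong refl) (simp add: power_divide)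
  also have "\<dots> = layer_sum a j x / sqrt h ^ j" by (simp add: layer_sum_def sum_divide_distrib)
  also have "layer_sum a j x = real (card (layer a)) * (if even j then sphere_moment 23 (j div 2) * h ^ (j div 2) else 0)"
    using m x(1) j xx by (simp add: layer_moment_def)
  also have "\<dots> / sqrt h ^ j = real (card (code a)) * (if even j then sphere_moment 23 (j div 2) else 0)"
  proof (cases "even j")
    case True
    then obtain i where i: "j = 2 * i" by (auto elim: evenE)
    have "sqrt h ^ j = h ^ i" using h(2) power_mult[of "sqrt h" 2 i] by (simp add: i)
    thus ?thesis using h(2) by (simp add: i card_code[OF h])
  qed simp
  finally show "(\<Sum>z\<in>code a. (y \<bullet> z) ^ j) = real (card (code a)) * (if even j then sphere_moment 23 (j div 2) else 0)" .
qed

lemma heights: "(3::real) = 4 - 2\<^sup>2 / 4" "(15/4::real) = 4 - 1\<^sup>2 / 4"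
  by simp_all

text \<open>The image of \<open>K2tilde\<close>: the hyperplane component of A - C is the negative
  of that of C.\<close>

definition bicode :: "(real^23) set" where
  "bicode = code 1 \<union> uminus ` code 1"

lemma code_2: "code 2 = (\<lambda>B. \<phi> (normalized 2 3 B)) ` layer 2"
  and code_1: "code 1 = (\<lambda>B. \<phi> (normalized 1 (15/4) B)) ` layer 1"
  by (rule code_eq, simp)+

text \<open>Opposite projections of B and C would mean \<open>B \<bullet> C\<close> - 1/4 = -15/4,
  hence \<open>B \<bullet> C\<close> = -7/2, against integrality. The count 94208 rests on
  this.\<close>

lemma code_1_disjoint: "code 1 \<inter> uminus ` code 1 = {}"
proof -
  have "\<phi> (normalized 1 (15/4) B) \<noteq> - \<phi> (normalized 1 (15/4) C)" if BC: "B \<in> layer 1" "C \<in> layer 1" for B C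
  proof
    assume "\<phi> (normalized 1 (15/4) B) = - \<phi> (normalized 1 (15/4) C)"
    hence "\<phi> (normalized 1 (15/4) B) = \<phi> (- normalized 1 (15/4) C)" by (simp add: linear_neg[OF linear_phi])
    hence "normalized 1 (15/4) B = - normalized 1 (15/4) C"
      by (rule phi_inj[rotated 2]) (use normalized(1)[OF _ heights(2)] BC in auto)
    hence "sqrt (15/4) *\<^sub>R normalized 1 (15/4) B = - (sqrt (15/4) *\<^sub>R normalized 1 (15/4) C)" by simp
    hence e: "B - (1/4) *\<^sub>R A = - (C - (1/4) *\<^sub>R A)" by (simp only: normalized_def) simp
    have BA: "B \<bullet> A = 1" "C \<bullet> A = 1" using BC by (simp_all add: layer_mem inner_commute)
    have "B \<bullet> C - 1/4 = (B - (1/4) *\<^sub>R A) \<bullet> (C - (1/4) *\<^sub>R A)"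
      using BC A_dot BA by (simp add: layer_mem inner_diff_left inner_diff_right)
    also have "\<dots> = - ((C - (1/4) *\<^sub>R A) \<bullet> (C - (1/4) *\<^sub>R A))" by (simp only: e inner_minus_left)
    also have "\<dots> = - (15/4)"
      using BC A_dot BA by (simp add: layer_mem inner_diff_left inner_diff_right)
    finally have "2 * (B \<bullet> C) = -7" by simp
    moreover obtain k :: int where k: "B \<bullet> C = of_int k" using layer_inner_Ints[OF BC] by (auto elim: Ints_cases)
    ultimately have "real_of_int (2 * k) = of_int (-7)" by simp
    hence "2 * k = -7" by (subst (asm) of_int_eq_iff)
    thus False by presburger
  qed
  thus ?thesis unfolding code_1 by blast
qed

lemma design_code_2: "spherical_7_design (code 2)" "card (code 2) = 4600"
  and design_code_1: "spherical_7_design (code 1)" "card (code 1) = 47104"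
  and design_bicode: "spherical_7_design bicode" "card bicode = 94208"
proof -
  show 2: "spherical_7_design (code 2)" by (rule code_design[OF heights(1) _ layer_moments(1)]) simp
  show "card (code 2) = 4600" using card_code[OF heights(1)] shell_layer_cards by simp
  show 1: "spherical_7_design (code 1)" by (rule code_design[OF heights(2) _ layer_moments(2)]) simp
  show c: "card (code 1) = 47104" using card_code[OF heights(2)] shell_layer_cards by simp
  show "spherical_7_design bicode" "card bicode = 94208"
    using spherical_7_design_Un_uminus[OF 1 code_1_disjoint] c by (simp_all add: bicode_def)
qed

lemma inner_codes:
  assumes B: "B \<in> layer 2" and C: "C \<in> layer 1"
  shows "\<phi> (normalized 1 (15/4) C) \<bullet> \<phi> (normalized 2 3 B) \<in> nodes"
proof -
  have NC: "A \<bullet> normalized 1 (15/4) C = 0" and NB: "A \<bullet> normalized 2 3 B = 0"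
    by (rule normalized(1)[OF C heights(2)], simp, rule normalized(1)[OF B heights(1)], simp)
  have "normalized 1 (15/4) C \<bullet> B = (B \<bullet> C - 1/4 * (A \<bullet> B)) / sqrt (15/4)"
    by (simp only: normalized_def inner_scaleR_left inner_diff_left divide_inverse mult.commute inner_commute[of C B])
  hence q: "normalized 1 (15/4) C \<bullet> B = (B \<bullet> C - 1/2) / sqrt (15/4)" using B by (simp only: layer_mem) simp
  have "\<phi> (normalized 1 (15/4) C) \<bullet> \<phi> (normalized 2 3 B) = normalized 1 (15/4) C \<bullet> normalized 2 3 B"
    by (rule phi_inner[OF NC NB])
  also have "\<dots> = (normalized 1 (15/4) C \<bullet> B) / sqrt 3"
    by (rule normalized(3)[OF B heights(1) _ NC]) simp
  also have "\<dots> = (B \<bullet> C - 1/2) / (sqrt 3 * sqrt (15/4))"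
    unfolding q divide_divide_eq_left by (simp only: mult.commute)
  also have "\<dots> \<in> nodes" unfolding node_scale using layer_cross[OF B C] by auto
  finally show ?thesis .
qed

lemma polar_code_2: "{y \<in> sphere 0 1. \<forall>z\<in>code 2. y \<bullet> z \<in> nodes} = bicode"
proof (intro equalityI subsetI)
  fix y assume "y \<in> {y \<in> sphere 0 1. \<forall>z\<in>code 2. y \<bullet> z \<in> nodes}"
  hence y: "y \<in> sphere 0 1" "\<And>z. z \<in> code 2 \<Longrightarrow> y \<bullet> z \<in> nodes" by auto
  obtain x where x: "A \<bullet> x = 0" "norm x = 1" "y = \<phi> x" using sphere_phi[OF y(1)] by blast
  \<comment> \<open>Rescaled to the length of the hyperplane components of layer 1, y has inner
    products +-1/2, +-3/2 with layer 2 exactly when those with the code are nodes.\<close>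
  define v where "v = sqrt (15/4) *\<^sub>R x"
  have vA: "A \<bullet> v = 0" using x by (simp add: v_def)
  have vv: "v \<bullet> v = 15/4" using x(2) by (simp add: v_def dot_square_norm)
  have t: "v \<bullet> B \<in> {-(3/2), -(1/2), 1/2, 3/2}" if B: "B \<in> layer 2" for B
  proof -
    have "y \<bullet> \<phi> (normalized 2 3 B) \<in> nodes" using y(2) B by (auto simp: code_2)
    moreover have "y \<bullet> \<phi> (normalized 2 3 B) = (x \<bullet> B) / sqrt 3"
      unfolding x(3) using phi_inner[OF x(1) normalized(1)[OF B heights(1)]] normalized(3)[OF B heights(1) _ x(1)] by simp
    moreover have "(x \<bullet> B) / sqrt 3 = (v \<bullet> B) / (sqrt 3 * sqrt (15/4))" by (simp add: v_def)
    ultimately show ?thesis by (simp only: node_scale)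
  qed
  have nx: "normalized 1 (15/4) ((1/4) *\<^sub>R A + v) = x" "normalized 1 (15/4) ((1/4) *\<^sub>R A - v) = - x"
    by (simp_all add: normalized_def v_def)
  from layer_1_dual[OF vA vv t] show "y \<in> bicode"
  proof
    assume "(1/4) *\<^sub>R A + v \<in> layer 1"
    hence "\<phi> x \<in> code 1" unfolding code_1 using nx(1) by (metis (no_types, lifting) imageI)
    thus ?thesis by (simp add: bicode_def x(3))
  next
    assume "(1/4) *\<^sub>R A - v \<in> layer 1"
    hence "\<phi> (- x) \<in> code 1" unfolding code_1 using nx(2) by (metis (no_types, lifting) imageI)
    hence "- \<phi> (- x) \<in> uminus ` code 1" by (rule imageI)
    thus ?thesis by (simp add: bicode_def x(3) linear_neg[OF linear_phi])
  qed
next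
  fix y assume y: "y \<in> bicode"
  then obtain C where C: "C \<in> layer 1" "y = \<phi> (normalized 1 (15/4) C) \<or> y = - \<phi> (normalized 1 (15/4) C)"
    unfolding bicode_def code_1 by blast
  have "y \<in> sphere 0 1" using y design_bicode(1) by (auto simp: spherical_7_design_def)
  moreover have "y \<bullet> z \<in> nodes" if "z \<in> code 2" for z
    using that inner_codes[OF _ C(1)] C(2) by (auto simp: code_2 nodes_uminus)
  ultimately show "y \<in> {y \<in> sphere 0 1. \<forall>z\<in>code 2. y \<bullet> z \<in> nodes}" by blast
qed

lemma polar_code_1: "{y \<in> sphere 0 1. \<forall>z\<in>code 1. y \<bullet> z \<in> nodes} = code 2"
proof (intro equalityI subsetI)
  fix y assume "y \<in> {y \<in> sphere 0 1. \<forall>z\<in>code 1. y \<bullet> z \<in> nodes}"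
  hence y: "y \<in> sphere 0 1" "\<And>z. z \<in> code 1 \<Longrightarrow> y \<bullet> z \<in> nodes" by auto
  obtain x where x: "A \<bullet> x = 0" "norm x = 1" "y = \<phi> x" using sphere_phi[OF y(1)] by blast
  \<comment> \<open>Now the length is that of the hyperplane components of layer 2.\<close>
  define v where "v = sqrt 3 *\<^sub>R x"
  have vA: "A \<bullet> v = 0" using x by (simp add: v_def)
  have vv: "v \<bullet> v = 3" using x(2) by (simp add: v_def dot_square_norm)
  have t: "v \<bullet> C \<in> {-(3/2), -(1/2), 1/2, 3/2}" if C: "C \<in> layer 1" for C
  proof -
    have "y \<bullet> \<phi> (normalized 1 (15/4) C) \<in> nodes" using y(2) C by (auto simp: code_1)
    moreover have "y \<bullet> \<phi> (normalized 1 (15/4) C) = (x \<bullet> C) / sqrt (15/4)"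
      unfolding x(3) using phi_inner[OF x(1) normalized(1)[OF C heights(2)]] normalized(3)[OF C heights(2) _ x(1)] by simp
    moreover have "(x \<bullet> C) / sqrt (15/4) = (v \<bullet> C) / (sqrt 3 * sqrt (15/4))" by (simp add: v_def)
    ultimately show ?thesis by (simp only: node_scale)
  qed
  have "normalized 2 3 ((1/2) *\<^sub>R A + v) = x" by (simp add: normalized_def v_def)
  hence "\<phi> x \<in> code 2" unfolding code_2 using layer_2_dual[OF vA vv t] by (metis (no_types, lifting) imageI)
  thus "y \<in> code 2" by (simp add: x(3))
next
  fix y assume y: "y \<in> code 2"
  then obtain B where B: "B \<in> layer 2" "y = \<phi> (normalized 2 3 B)" unfolding code_2 by blast
  have "y \<in> sphere 0 1" using y design_code_2(1) by (auto simp: spherical_7_design_def)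
  moreover have "y \<bullet> z \<in> nodes" if "z \<in> code 1" for z
    using that inner_codes[OF B(1)] B(2) by (auto simp: code_1 inner_commute)
  ultimately show "y \<in> {y \<in> sphere 0 1. \<forall>z\<in>code 1. y \<bullet> z \<in> nodes}" by blast
qed

lemma polar_bicode: "{y \<in> sphere 0 1. \<forall>z\<in>bicode. y \<bullet> z \<in> nodes} = code 2"
proof -
  have "(\<forall>z\<in>bicode. y \<bullet> z \<in> nodes) \<longleftrightarrow> (\<forall>z\<in>code 1. y \<bullet> z \<in> nodes)" for y
    by (auto simp: bicode_def nodes_uminus)
  thus ?thesis using polar_code_1 by simp
qed

lemma codes_nonempty: "code 2 \<noteq> {}" "bicode \<noteq> {}"
  using design_code_2(2) design_bicode(2) by auto

end

section \<open>Identification of the codes and conclusion\<close>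

theorem theorem5p6:
  fixes L :: "(real^24) set" and A :: "real^24" and \<phi> :: "real^24 \<Rightarrow> real^23"
    and W K1 K2 K2bar K2tilde :: "(real^24) set"
    and K1hat K2hat K2tildehat :: "(real^23) set"
  assumes "leech_lattice L" and "A \<in> shell L 2"
    and "K1 = {B \<in> shell L 2. norm (A - B) = 2}"
    and "K2 = {C \<in> shell L 2. norm (A - C) = sqrt 6}"
    and "K2bar = (\<lambda>C. A - C) ` K2"
    and "K2tilde = K2 \<union> K2bar"
    and "W = span {A}"
    and "linear_isometry_onto \<phi> (W\<^sup>\<bottom>)"
    and "K1hat = \<phi> ` proj_sphere W ` K1"
    and "K2hat = \<phi> ` proj_sphere W ` K2"
    and "K2tildehat = \<phi> ` proj_sphere W ` K2tilde"
  shows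
    "card K1 = 4600 \<and> card K2 = 47104 \<and> card K2tildehat = 94208 \<and>
     K1 \<inter> W = {} \<and> K2tilde \<inter> W = {} \<and>
     K1hat \<subseteq> sphere 0 1 \<and> K2hat \<subseteq> sphere 0 1 \<and> K2tildehat \<subseteq> sphere 0 1 \<and>
     (\<forall>h. potential h \<and> positive_derivative 8 h \<longrightarrow>
        polarization h K2hat =
          2816 * h (- (sqrt 5 / 5)) + 20736 * h (- (sqrt 5 / 15))
            + 20736 * h (sqrt 5 / 15) + 2816 * h (sqrt 5 / 5) \<and>
        polarization h K2tildehat =
          5632 * h (- (sqrt 5 / 5)) + 41472 * h (- (sqrt 5 / 15))
            + 41472 * h (sqrt 5 / 15) + 5632 * h (sqrt 5 / 5) \<and>
        K1hat \<subseteq> minimizers h K2hat \<and> K1hat \<subseteq> minimizers h K2tildehat \<and>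
        polarization h K1hat =
          275 * h (- (sqrt 5 / 5)) + 2025 * h (- (sqrt 5 / 15))
            + 2025 * h (sqrt 5 / 15) + 275 * h (sqrt 5 / 5) \<and>
        minimizers h K1hat \<noteq> {} \<and>
        polarization h K1hat / 4600 = polarization h K2tildehat / 94208 \<and>
        polarization h K2tildehat / 94208 = polarization h K2hat / 47104) \<and>
     universal_polar_dual_pair K1hat K2tildehat"
proof -
  interpret leech_projection L A \<phi>
    using assms(1,2,8) unfolding assms(7)
    by (simp add: leech_projection_def leech_projection_axioms_def leech_pole_def leech_pole_axioms_def leech_def)
  have nrm: "(norm (A - B))\<^sup>2 = 8 - 2 * (A \<bullet> B)" if "B \<in> shell L 2" for B
    using that A_dot by (simp add: shell_mem power2_norm_eq_inner inner_diff_left inner_diff_right inner_commute[of B A])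
  have "norm (A - B) = 2 \<longleftrightarrow> A \<bullet> B = 2" if "B \<in> shell L 2" for B
    using nrm[OF that] power2_eq_iff_nonneg[of "norm (A - B)" 2] by auto
  hence K1: "K1 = layer 2" unfolding assms(3) layer_def by blast
  have "norm (A - B) = sqrt 6 \<longleftrightarrow> A \<bullet> B = 1" if "B \<in> shell L 2" for B
    using nrm[OF that] power2_eq_iff_nonneg[of "norm (A - B)" "sqrt 6"] by auto
  hence K2: "K2 = layer 1" unfolding assms(4) layer_def by blast
  have K1h: "K1hat = code 2" and K2h: "K2hat = code 1"
    unfolding assms(9,10) K1 K2 assms(7) code_def by simp_all
  have "\<phi> ` proj_sphere W ` K2bar = uminus ` code 1"
  proof -
    have "\<phi> (proj_sphere (span {A}) (A - B)) = - \<phi> (proj_sphere (span {A}) B)" if "B \<in> layer 1" for B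
      using proj_sphere_layer[OF that heights(2)] by (simp add: linear_neg[OF linear_phi])
    thus ?thesis unfolding assms(5,7) K2 code_def image_image by (intro image_cong) auto
  qed
  hence K2t: "K2tildehat = bicode" unfolding assms(11,6) image_Un bicode_def using K2h assms(10) by simp
  have notW: "B \<notin> span {A}" if "B \<in> layer a" "a = 1 \<or> a = 2" for B a
  proof
    assume "B \<in> span {A}"
    then obtain c where c: "B = c *\<^sub>R A" by (auto simp: span_singleton)
    have a: "4 * c = a" "4 * (c * c) = 4" using that(1) A_dot by (auto simp: layer_mem c)
    have "a * a = 4 * (4 * (c * c))" unfolding a(1)[symmetric] by simp
    thus False using a(2) that(2) by auto
  qed
  have W1: "K1 \<inter> W = {}" using notW K1 assms(7) by auto
  have W2: "K2tilde \<inter> W = {}"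
  proof -
    have "A - B \<notin> span {A}" if "B \<in> layer 1" for B
    proof
      assume "A - B \<in> span {A}"
      from span_diff[OF span_base[of A "{A}"] this] show False using notW that by simp
    qed
    thus ?thesis using notW unfolding assms(6,5,7) K2 by auto
  qed
  \<comment> \<open>The exact sets of minimizers are included here: they are the same for all
    potentials with positive eighth derivative, and the universal dual pair is a special
    case.\<close>
  have main: "polarization h K2hat =
          2816 * h (- (sqrt 5 / 5)) + 20736 * h (- (sqrt 5 / 15))
            + 20736 * h (sqrt 5 / 15) + 2816 * h (sqrt 5 / 5) \<and>
        polarization h K2tildehat =
          5632 * h (- (sqrt 5 / 5)) + 41472 * h (- (sqrt 5 / 15))
            + 41472 * h (sqrt 5 / 15) + 5632 * h (sqrt 5 / 5) \<and>
        K1hat \<subseteq> minimizers h K2hat \<and> K1hat \<subseteq> minimizers h K2tildehat \<and>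
        polarization h K1hat =
          275 * h (- (sqrt 5 / 5)) + 2025 * h (- (sqrt 5 / 15))
            + 2025 * h (sqrt 5 / 15) + 275 * h (sqrt 5 / 5) \<and>
        minimizers h K1hat \<noteq> {} \<and>
        polarization h K1hat / 4600 = polarization h K2tildehat / 94208 \<and>
        polarization h K2tildehat / 94208 = polarization h K2hat / 47104 \<and>
        minimizers h K1hat = K2tildehat \<and> minimizers h K2tildehat = K1hat"
    if h: "potential h" "positive_derivative 8 h" for h
  proof -
    note m1 = design_minimizers[OF design_code_1(1) h polar_code_1[symmetric] codes_nonempty(1)]
    note m2 = design_minimizers[OF design_code_2(1) h polar_code_2[symmetric] codes_nonempty(2)]
    note m3 = design_minimizers[OF design_bicode(1) h polar_bicode[symmetric] codes_nonempty(1)]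
    note p = m1(2)[unfolded design_code_1(2)] m2(2)[unfolded design_code_2(2)] m3(2)[unfolded design_bicode(2)]
    have div: "ereal (n * x) / ereal n = ereal x" if "n \<noteq> 0" for n x :: real
      using that by simp
    show ?thesis
      unfolding K1h K2h K2t m1(1) m2(1) m3(1) p numeral_eq_ereal of_nat_numeral
    proof (intro conjI)
      \<comment> \<open>The scaling factors are the quotients of the code sizes by 4600: 47104/4600
        = 256/25, and twice that for the doubled code.\<close>
      show "ereal (47104 * node_mean (\<lambda>t. real_of_ereal (h t))) = ereal 2816 * h (- (sqrt 5 / 5)) + ereal 20736 * h (- (sqrt 5 / 15))
          + ereal 20736 * h (sqrt 5 / 15) + ereal 2816 * h (sqrt 5 / 5)"
        by (rule node_mean_weights[OF h(1), of "256/25"]) simp_all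
      show "ereal (94208 * node_mean (\<lambda>t. real_of_ereal (h t))) = ereal 5632 * h (- (sqrt 5 / 5)) + ereal 41472 * h (- (sqrt 5 / 15))
          + ereal 41472 * h (sqrt 5 / 15) + ereal 5632 * h (sqrt 5 / 5)"
        by (rule node_mean_weights[OF h(1), of "512/25"]) simp_all
      show "ereal (4600 * node_mean (\<lambda>t. real_of_ereal (h t))) = ereal 275 * h (- (sqrt 5 / 5)) + ereal 2025 * h (- (sqrt 5 / 15))
          + ereal 2025 * h (sqrt 5 / 15) + ereal 275 * h (sqrt 5 / 5)"
        by (rule node_mean_weights[OF h(1), of 1]) simp_all
    qed (simp_all only: div codes_nonempty subset_refl not_False_eq_True numeral_neq_zero)
  qed
  have "universal_polar_dual_pair K1hat K2tildehat"
    unfolding universal_polar_dual_pair_def strictly_absolutely_monotone_def using main by blast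
  moreover have "K1hat \<subseteq> sphere 0 1" "K2hat \<subseteq> sphere 0 1" "K2tildehat \<subseteq> sphere 0 1"
    unfolding K1h K2h K2t using design_code_1(1) design_code_2(1) design_bicode(1) by (simp_all add: spherical_7_design_def)
  moreover have "card K1 = 4600" "card K2 = 47104" "card K2tildehat = 94208"
    unfolding K1 K2 K2t by (rule shell_layer_cards design_bicode)+
  ultimately show ?thesis
    using W1 W2 by (intro conjI allI impI) (assumption | elim conjE, drule (1) main, elim conjE, assumption)+
qed

end
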